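(* Let $m>5/2$ and let $v\in C([0,T);H^m(\mathbb{R}^3))$ be a solution of the incompressible Euler equations $$\frac{\partial v}{\partial t}+v\cdot\nabla v=-\nabla p,\qquad \mathrm{div}\,v=0,\qquad v(x,0)=v_0(x)\qquad (x\in\mathbb{R}^3)$$ corresponding to initial data $v_0\in H^m(\mathbb{R}^3)$ with $\mathrm{div}\,v_0=0$, where $T$ is the maximal time of local well-posedness. Let $\omega=\mathrm{curl}\,v$ and $\omega_0=\mathrm{curl}\,v_0$. Then for all $\varepsilon>0$ and $t_0\in(0,T)$ there exists $R_0=R_0(v_0,t_0,\varepsilon)$ such that $$|\omega(X_t(a),t)|\le e^{\varepsilon t}|\omega_0(a)|\qquad\text{for all }(a,t)\in\left(\mathbb{R}^3\setminus B(0,R_0)\right)\times[0,t_0],$$ where $\{X_t(\cdot)\}$ is the particle trajectory mapping generated by the velocity field $v(x,t)$.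
   Context: $v=v(x,t)\in\mathbb{R}^3$ is the velocity and $p=p(x,t)$ the scalar pressure. $H^m(\mathbb{R}^3)$ is the standard $L^2$-based Sobolev space (of vector fields). $B(0,r)=\{y\in\mathbb{R}^3: |y|<r\}$. The particle trajectory mapping $X_t(a)$ is defined by $\frac{\partial X_t(a)}{\partial t}=v(X_t(a),t)$, $X_0(a)=a$, for $a\in\mathbb{R}^3$. *)

theory Defs
  imports "HOL-Analysis.Analysis"
begin

text \<open>
  Plancherel transform: \<open>g\<close> is the limit in \<open>L\<^sup>2\<close>, as \<open>R\<close> tends to infinity, of the Fourier integrals of
  \<open>f\<close> cut off to the ball of radius \<open>R\<close>.  It determines \<open>g\<close> up to a null set.
  No normalizing power of \<open>2\<pi>\<close> is used; this only rescales the Sobolev norms.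
\<close>

definition is_L2_fourier :: "(real^3 \<Rightarrow> real) \<Rightarrow> (real^3 \<Rightarrow> complex) \<Rightarrow> bool" where
  "is_L2_fourier f g \<longleftrightarrow>
     f \<in> borel_measurable lborel \<and> integrable lborel (\<lambda>x. (f x)\<^sup>2) \<and>
     g \<in> borel_measurable lborel \<and> integrable lborel (\<lambda>\<xi>. (cmod (g \<xi>))\<^sup>2) \<and>
     ((\<lambda>R::real. \<integral>\<^sup>+\<xi>. ennreal ((cmod
          ((LINT x:ball 0 R|lborel. cis (- (x \<bullet> \<xi>)) * complex_of_real (f x)) - g \<xi>))\<^sup>2) \<partial>lborel)
       \<longlongrightarrow> 0) at_top"

definition L2_fourier :: "(real^3 \<Rightarrow> real) \<Rightarrow> real^3 \<Rightarrow> complex" where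
  "L2_fourier f = (SOME g. is_L2_fourier f g)"

text \<open>
  The space \<open>H\<^sup>m\<close> of vector fields, for real \<open>m \<ge> 0\<close>.
\<close>

definition Sobolev :: "real \<Rightarrow> (real^3 \<Rightarrow> real^3) set" where
  "Sobolev m = {f. \<forall>i. \<exists>g. is_L2_fourier (\<lambda>x. f x $ i) g \<and>
      integrable lborel (\<lambda>\<xi>. (1 + (norm \<xi>)\<^sup>2) powr m * (cmod (g \<xi>))\<^sup>2)}"

definition Sobolev_norm :: "real \<Rightarrow> (real^3 \<Rightarrow> real^3) \<Rightarrow> real" where
  "Sobolev_norm m f = sqrt (\<Sum>i\<in>UNIV. LINT \<xi>|lborel.
      (1 + (norm \<xi>)\<^sup>2) powr m * (cmod (L2_fourier (\<lambda>x. f x $ i) \<xi>))\<^sup>2)"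

definition time_interval :: "ereal \<Rightarrow> real set" where
  "time_interval T = {t. 0 \<le> t \<and> ereal t < T}"

definition continuous_in_Sobolev :: "real \<Rightarrow> ereal \<Rightarrow> (real \<Rightarrow> real^3 \<Rightarrow> real^3) \<Rightarrow> bool" where
  "continuous_in_Sobolev m T v \<longleftrightarrow>
     (\<forall>t\<in>time_interval T. v t \<in> Sobolev m \<and>
        ((\<lambda>s. Sobolev_norm m (\<lambda>x. v s x - v t x)) \<longlongrightarrow> 0) (at t within time_interval T))"

definition partial_deriv :: "3 \<Rightarrow> (real^3 \<Rightarrow> 'b::real_normed_vector) \<Rightarrow> real^3 \<Rightarrow> 'b" where
  "partial_deriv i f x = frechet_derivative f (at x) (axis i 1)"

definition grad :: "(real^3 \<Rightarrow> real) \<Rightarrow> real^3 \<Rightarrow> real^3" where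
  "grad q x = (\<chi> i. partial_deriv i q x)"

definition divergence :: "(real^3 \<Rightarrow> real^3) \<Rightarrow> real^3 \<Rightarrow> real" where
  "divergence u x = (\<Sum>i\<in>UNIV. partial_deriv i u x $ i)"

definition curl :: "(real^3 \<Rightarrow> real^3) \<Rightarrow> real^3 \<Rightarrow> real^3" where
  "curl u x = vector
     [partial_deriv 2 u x $ 3 - partial_deriv 3 u x $ 2,
      partial_deriv 3 u x $ 1 - partial_deriv 1 u x $ 3,
      partial_deriv 1 u x $ 2 - partial_deriv 2 u x $ 1]"

definition advection :: "(real^3 \<Rightarrow> real^3) \<Rightarrow> (real^3 \<Rightarrow> real^3) \<Rightarrow> real^3 \<Rightarrow> real^3" where
  "advection u w x = (\<Sum>j\<in>UNIV. (u x $ j) *\<^sub>R partial_deriv j w x)"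

text \<open>
  Solutions in \<open>C([0,T); H\<^sup>m)\<close>, with \<open>T\<close> possibly infinite.  Since \<open>m > 5/2\<close>, elements of \<open>H\<^sup>m\<close> have
  \<open>C\<^sup>1\<close> representatives and the time derivative of a solution belongs to \<open>C([0,T); H\<^sup>m\<^sup>-\<^sup>1)\<close>,
  hence is continuous in \<open>(t, x)\<close>.  So \<open>v t\<close> denotes the differentiable representative and the
  equations hold in the classical sense.  The time derivative at \<open>t = 0\<close> is one-sided.
\<close>

definition euler_solution ::
  "real \<Rightarrow> (real^3 \<Rightarrow> real^3) \<Rightarrow> ereal \<Rightarrow> (real \<Rightarrow> real^3 \<Rightarrow> real^3) \<Rightarrow> (real \<Rightarrow> real^3 \<Rightarrow> real) \<Rightarrow> bool"
where
  "euler_solution m v0 T v p \<longleftrightarrow>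
     0 < T \<and>
     continuous_in_Sobolev m T v \<and>
     (\<forall>t\<in>time_interval T. \<forall>x. v t differentiable (at x) \<and> p t differentiable (at x)) \<and>
     (\<exists>v'. continuous_on (time_interval T \<times> UNIV) (\<lambda>(t, x). v' t x) \<and>
        (\<forall>t\<in>time_interval T. \<forall>x.
           ((\<lambda>s. v s x) has_vector_derivative v' t x) (at t within time_interval T) \<and>
           v' t x + advection (v t) (v t) x = - grad (p t) x)) \<and>
     (\<forall>t\<in>time_interval T. \<forall>x. divergence (v t) x = 0) \<and>
     (\<forall>x. v 0 x = v0 x)"

definition euler_lifespan :: "real \<Rightarrow> (real^3 \<Rightarrow> real^3) \<Rightarrow> ereal" where
  "euler_lifespan m v0 = Sup {T. \<exists>v p. euler_solution m v0 T v p}"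

definition particle_trajectories ::
  "ereal \<Rightarrow> (real \<Rightarrow> real^3 \<Rightarrow> real^3) \<Rightarrow> (real \<Rightarrow> real^3 \<Rightarrow> real^3) \<Rightarrow> bool"
where
  "particle_trajectories T v X \<longleftrightarrow>
     (\<forall>a. X 0 a = a \<and>
        (\<forall>t\<in>time_interval T.
           ((\<lambda>s. X s a) has_vector_derivative v t (X t a)) (at t within time_interval T)))"

end

theory Submission
  imports Defs "HOL-Probability.Probability" "HOL-Real_Asymp.Real_Asymp"
begin

text \<open>
  The velocity gradient tends to zero at infinity, uniformly for \<open>t \<in> [0, t\<^sub>0]\<close>, and trajectories travel
  a bounded distance, so a trajectory that starts far away only meets gradients of norm at most \<open>\<epsilon>\<close>.
  It remains to bound \<open>\<bar>\<omega>(X\<^sub>t(a),t)\<bar>\<close> by \<open>\<bar>\<omega>\<^sub>0(a)\<bar> exp (k t)\<close> if the gradient is at most \<open>k\<close> along the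
  trajectory.  As \<open>v\<close> is only \<open>C\<^sup>1\<close>, the vorticity equation is not available pointwise.  Kelvin's theorem is
  used instead, on polygons of particles, so that only the Lipschitz continuity of \<open>X\<^sub>t\<close> enters: with
  trapezoidal sums the kinetic term telescopes and the pressure term telescopes up to an error
  that vanishes with the mesh.  For a small loop around \<open>a\<close> the circulation is \<open>\<omega> \<bullet> S\<close> up to a small error, where
  the vector area \<open>S\<close> solves \<open>S' = - (\<nabla>v)\<^sup>T S\<close> approximately.  Three loops with independent
  initial areas then determine \<open>\<omega>(X\<^sub>t(a),t)\<close>, and Gronwall's inequality for \<open>S\<close>, run backwards in time, gives the bound.

  The decay at infinity comes from Fourier inversion: \<open>m > 5/2\<close> makes \<open>\<bar>\<xi>\<bar> \<bar>g(\<xi>)\<bar>\<close> integrable, which bounds the gradient by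
  the Sobolev norm and makes it uniformly continuous; as \<open>v\<close> is in \<open>L\<^sup>2\<close>, both \<open>v\<close> and its gradient tend to zero.
\<close>

section \<open>Polygons and their circulation\<close>

text \<open>Circulation and \<open>\<omega> \<bullet> S\<close> agree only up to the linearization
  error of \<open>v\<close>, so the loops must shrink. On a loop of radius \<open>\<rho>\<close>
  both are of order \<open>\<rho>\<^sup>2\<close>, hence every error has to be a small multiple of
  \<open>\<rho>\<^sup>2\<close>. With \<open>N\<close> edges of length at most \<open>d\<close>, the
  error per edge is \<open>\<eta> * \<rho> * d\<close>, and \<open>N * d = 2 * pi * \<rho>\<close>
  makes the total independent of \<open>N\<close>. The tolerance \<open>\<eta>\<close> therefore
  fixes the radius, and \<open>N\<close> comes last, large enough for the pressure, whose gradient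
  is merely continuous. The final bound is a duality: the areas solve the adjoint of the vorticity
  equation, and \<open>\<omega> \<bullet> S\<close> is nearly conserved. For the area that arrives
  at \<open>\<omega>\<close> itself, the conserved quantity is the square of
  \<open>\<bar>\<omega>\<bar>\<close> at the end and at most
  \<open>\<bar>\<omega>\<^sub>0\<bar>\<close> times the initial area at the start. An area that
  shrinks at most at rate \<open>k\<close> started no larger than \<open>exp (k * t)\<close> times
  its final size. Letting \<open>\<eta>\<close> tend to 0 leaves the exact constant.\<close>

lemma norm_matrix_vector_mult_le:
  fixes A :: "real^'n^'m"
  shows "norm (A *v x) \<le> norm A * norm x"
proof (rule power2_le_imp_le)
  have comp: "(A *v x) $ i = A $ i \<bullet> x" for i
    by (simp add: matrix_mult_dot)
  have "(norm (A *v x))\<^sup>2 = (\<Sum>i\<in>UNIV. (A $ i \<bullet> x)\<^sup>2)"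
    unfolding power2_norm_eq_inner inner_vec_def[of "A *v x"] comp by (simp add: power2_eq_square)
  also have "\<dots> \<le> (\<Sum>i\<in>UNIV. (norm (A $ i))\<^sup>2 * (norm x)\<^sup>2)"
    by (intro sum_mono) (simp add: Cauchy_Schwarz_ineq power2_norm_eq_inner)
  also have "\<dots> = (norm A * norm x)\<^sup>2"
    unfolding power_mult_distrib power2_norm_eq_inner[of A] inner_vec_def[of A]
    by (simp add: sum_distrib_right power2_norm_eq_inner)
  finally show "(norm (A *v x))\<^sup>2 \<le> (norm A * norm x)\<^sup>2" .
qed simp

lemma norm_transpose: "norm (transpose A) = norm (A :: real^'n^'m)"
proof -
  have "(\<Sum>i\<in>UNIV. \<Sum>j\<in>UNIV. A $ j $ i * A $ j $ i) = (\<Sum>j\<in>UNIV. \<Sum>i\<in>UNIV. A $ j $ i * A $ j $ i)"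
    by (rule sum.swap)
  then show ?thesis
    by (simp add: norm_eq_sqrt_inner inner_vec_def transpose_def)
qed

text \<open>The norm of the type \<open>real^'n^'m\<close> is the Frobenius norm. It dominates the
  operator norm, so bounds and continuity of Jacobians in this norm feed the mean value theorems,
  which are phrased with \<open>onorm\<close>.\<close>

lemma onorm_matrix_le: "onorm ((*v) A) \<le> norm (A :: real^'n^'m)"
  by (rule onorm_le) (rule norm_matrix_vector_mult_le)

section \<open>Gronwall's inequality forwards and backwards in time\<close>

lemma gronwall_norm:
  fixes Z :: "real \<Rightarrow> 'a::real_inner"
  assumes "0 \<le> T" "0 \<le> k" "0 \<le> e"
    and der: "\<And>t. t \<in> {0..T} \<Longrightarrow> (Z has_vector_derivative Z' t) (at t within {0..T})"
    and bound: "\<And>t. t \<in> {0..T} \<Longrightarrow> norm (Z' t) \<le> k * norm (Z t) + e"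
  shows "norm (Z T) \<le> exp (k * T) * (norm (Z 0) + e * T)"
proof -
  have "exp (- k * T) * norm (Z T) \<le> norm (Z 0) + e * T + \<mu>" if "\<mu> > 0" for \<mu>
  proof -
    \<comment> \<open>\<open>norm (Z t)\<close> may fail to be differentiable where \<open>Z\<close>
      vanishes. The root regularized by \<open>\<mu>\<close> is differentiable wherever
      \<open>Z\<close> is, lies above the norm, and costs at most \<open>\<mu>\<close> at time
      0.\<close>
    define s where "s t = sqrt (Z t \<bullet> Z t + \<mu>\<^sup>2)" for t
    have pos: "Z t \<bullet> Z t + \<mu>\<^sup>2 > 0" for t
      using that by (intro add_nonneg_pos) auto
    then have s_pos: "s t > 0" for t
      by (simp add: s_def)
    have s_ge: "norm (Z t) \<le> s t" for t
      unfolding s_def norm_eq_sqrt_inner using that by simp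
    \<comment> \<open>Subtracting \<open>e * t\<close> absorbs the forcing, since
      \<open>exp (- k * t) \<le> 1\<close>; thus \<open>\<phi>\<close> is nonincreasing, also for
      \<open>k = 0\<close>.\<close>
    define \<phi> where "\<phi> t = exp (- k * t) * s t - e * t" for t
    have contZ: "continuous_on {0..T} Z"
      by (meson continuous_on_eq_continuous_within der has_vector_derivative_continuous)
    have "\<phi> T \<le> \<phi> 0"
    proof (rule DERIV_nonpos_imp_decreasing_open[OF \<open>0 \<le> T\<close>])
      fix t assume t: "0 < t" "t < T"
      have Z': "(Z has_vector_derivative Z' t) (at t)"
        using der[of t] t by (simp add: at_within_Icc_at)
      have "((\<lambda>t. Z t \<bullet> Z t) has_vector_derivative Z t \<bullet> Z' t + Z' t \<bullet> Z t) (at t)"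
        by (rule bounded_bilinear.has_vector_derivative[OF bounded_bilinear_inner Z' Z'])
      then have "((\<lambda>t. Z t \<bullet> Z t) has_real_derivative 2 * (Z t \<bullet> Z' t)) (at t)"
        by (simp add: has_real_derivative_iff_has_vector_derivative inner_commute)
      then have ds: "(s has_real_derivative (Z t \<bullet> Z' t) / s t) (at t)"
        unfolding s_def using pos[of t]
        by (auto intro!: derivative_eq_intros simp: field_simps)
      have d\<phi>: "(\<phi> has_real_derivative exp (- k * t) * ((Z t \<bullet> Z' t) / s t) - k * exp (- k * t) * s t - e) (at t)"
        unfolding \<phi>_def by (rule derivative_eq_intros ds refl | simp)+
      have "Z t \<bullet> Z' t \<le> norm (Z t) * norm (Z' t)"
        by (rule norm_cauchy_schwarz)
      also have "\<dots> \<le> s t * norm (Z' t)"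
        by (intro mult_right_mono s_ge) auto
      finally have "(Z t \<bullet> Z' t) / s t \<le> norm (Z' t)"
        using s_pos[of t] by (simp add: field_simps)
      also have "\<dots> \<le> k * norm (Z t) + e"
        using bound t by auto
      also have "\<dots> \<le> k * s t + e"
        using s_ge[of t] \<open>0 \<le> k\<close> by (simp add: mult_left_mono)
      finally have "exp (- k * t) * ((Z t \<bullet> Z' t) / s t) \<le> exp (- k * t) * (k * s t + e)"
        by (intro mult_left_mono) auto
      moreover have "exp (- k * t) * e \<le> e"
        using \<open>0 \<le> k\<close> \<open>0 \<le> e\<close> t by (intro mult_left_le_one_le) auto
      ultimately have "exp (- k * t) * ((Z t \<bullet> Z' t) / s t) - k * exp (- k * t) * s t - e \<le> 0"
        by (simp add: algebra_simps)
      with d\<phi> show "\<exists>y. (\<phi> has_real_derivative y) (at t) \<and> y \<le> 0"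
        by blast
    next
      show "continuous_on {0..T} \<phi>"
        unfolding \<phi>_def s_def by (intro continuous_intros contZ)
    qed
    then have "exp (- k * T) * s T \<le> s 0 + e * T"
      by (simp add: \<phi>_def)
    moreover have "s 0 \<le> norm (Z 0) + \<mu>"
    proof -
      have "s 0 \<le> sqrt (Z 0 \<bullet> Z 0) + sqrt (\<mu>\<^sup>2)"
        unfolding s_def by (rule sqrt_add_le_add_sqrt) auto
      then show ?thesis
        using that by (simp add: norm_eq_sqrt_inner)
    qed
    moreover have "exp (- k * T) * norm (Z T) \<le> exp (- k * T) * s T"
      by (simp add: s_ge)
    ultimately show ?thesis
      by linarith
  qed
  then have "exp (- k * T) * norm (Z T) \<le> norm (Z 0) + e * T"
    by (rule field_le_epsilon)
  then have "exp (k * T) * (exp (- k * T) * norm (Z T)) \<le> exp (k * T) * (norm (Z 0) + e * T)"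
    by (intro mult_left_mono) auto
  then show ?thesis
    by (simp add: mult.assoc[symmetric] exp_minus)
qed

text \<open>Only the norm of the derivative is limited, so reversing time preserves the hypothesis.
  This direction bounds the initial area of a loop by its final area.\<close>

lemma gronwall_norm_backward:
  fixes Z :: "real \<Rightarrow> 'a::real_inner"
  assumes "0 \<le> T" "0 \<le> k" "0 \<le> e"
    and der: "\<And>t. t \<in> {0..T} \<Longrightarrow> (Z has_vector_derivative Z' t) (at t within {0..T})"
    and bound: "\<And>t. t \<in> {0..T} \<Longrightarrow> norm (Z' t) \<le> k * norm (Z t) + e"
  shows "norm (Z 0) \<le> exp (k * T) * (norm (Z T) + e * T)"
proof -
  have "norm (Z (T - T)) \<le> exp (k * T) * (norm (Z (T - 0)) + e * T)"
  proof (rule gronwall_norm[where Z' = "\<lambda>s. - Z' (T - s)"])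
    fix s assume s: "s \<in> {0..T}"
    have "((\<lambda>s. T - s) has_vector_derivative - 1) (at s within {0..T})"
      by (auto intro!: derivative_eq_intros)
    moreover have "(Z has_vector_derivative Z' (T - s)) (at (T - s) within (\<lambda>s. T - s) ` {0..T})"
      using der[of "T - s"] s by simp
    ultimately show "((\<lambda>s. Z (T - s)) has_vector_derivative - Z' (T - s)) (at s within {0..T})"
      using vector_diff_chain_within[of "\<lambda>s. T - s" "-1" s "{0..T}" Z "Z' (T - s)"] by (simp add: o_def)
    show "norm (- Z' (T - s)) \<le> k * norm (Z (T - s)) + e"
      using bound[of "T - s"] s by simp
  qed (use assms in auto)
  then show ?thesis by simp
qed

section \<open>Vector area and circulation of polygons\<close>

definition axial :: "real^3^3 \<Rightarrow> real^3" where
  "axial A = vector [A $ 3 $ 2 - A $ 2 $ 3, A $ 1 $ 3 - A $ 3 $ 1, A $ 2 $ 1 - A $ 1 $ 2]"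

text \<open>\<open>axial A\<close> is the vector dual to the antisymmetric matrix
  \<open>A - transpose A\<close>, hence the curl if \<open>A\<close> is a Jacobian. Halved, the
  identity is Stokes' theorem for the linear field \<open>A\<close> on the triangle with vertices
  \<open>0\<close>, \<open>y\<close>, \<open>z\<close>.\<close>

lemma axial_inner_cross3:
  "axial A \<bullet> cross3 y z = (A *v y) \<bullet> z - (A *v z) \<bullet> y"
  by (simp add: axial_def cross3_simps matrix_vector_mult_def)

text \<open>Infinitesimal form of the rule that a linear map acts on cross products by its cofactor
  matrix. For trace zero, areas evolve by minus the transpose, which is adjoint to stretching by
  \<open>A\<close>.\<close>

lemma cross3_derivation:
  "cross3 (A *v y) z + cross3 y (A *v z) = trace A *\<^sub>R cross3 y z - transpose A *v cross3 y z"
  by (simp add: vec_eq_iff forall_3 cross3_simps matrix_vector_mult_def transpose_def trace_def)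

lemma norm_cross3_le: "norm (cross3 x y) \<le> norm x * norm y"
proof (rule power2_le_imp_le)
  show "(norm (cross3 x y))\<^sup>2 \<le> (norm x * norm y)\<^sup>2"
    by (simp add: norm_cross power_mult_distrib)
qed simp

lemma bounded_bilinear_cross3: "bounded_bilinear cross3"
  using bilinear_cross by (simp add: bilinear_conv_bounded_bilinear)

text \<open>Sum of the vector areas of the triangles with apex at the origin. For a closed polygon,
  \<open>y N = y 0\<close>, it does not depend on the origin.\<close>

definition polygon_area :: "nat \<Rightarrow> (nat \<Rightarrow> real^3) \<Rightarrow> real^3" where
  "polygon_area N y = (1/2) *\<^sub>R (\<Sum>i<N. cross3 (y i) (y (Suc i)))"

text \<open>The trapezoidal rule on each edge. It is exact for affine velocities, and its symmetry
  in the two endpoints lets the kinetic term telescope when the vertices move with the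
  fluid.\<close>

definition polygon_circulation :: "nat \<Rightarrow> (nat \<Rightarrow> real^3) \<Rightarrow> (nat \<Rightarrow> real^3) \<Rightarrow> real" where
  "polygon_circulation N u y = (1/2) * (\<Sum>i<N. (u i + u (Suc i)) \<bullet> (y (Suc i) - y i))"

lemma sum_Suc_diff_closed:
  fixes f :: "nat \<Rightarrow> 'a::ab_group_add"
  assumes "f N = f 0"
  shows "(\<Sum>i<N. f (Suc i) - f i) = 0"
  using assms by (simp add: sum_lessThan_telescope)

text \<open>On a closed polygon the constant part of the field and the quadratic form of
  \<open>A\<close> telescope, and the antisymmetric part of \<open>A\<close> gives exactly the area
  term. Only the remainders survive, with \<open>\<eta> * \<rho> * d\<close> per edge.\<close>

lemma polygon_circulation_approx:
  assumes closed: "y N = y 0"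
    and y: "\<And>i. i \<le> N \<Longrightarrow> norm (y i) \<le> \<rho>"
    and dy: "\<And>i. i < N \<Longrightarrow> norm (y (Suc i) - y i) \<le> d"
    and r: "\<And>i. i \<le> N \<Longrightarrow> norm (u i - u0 - A *v y i) \<le> \<eta> * \<rho>"
  shows "\<bar>polygon_circulation N u y - axial A \<bullet> polygon_area N y\<bar> \<le> N * (\<eta> * \<rho> * d)"
proof -
  define r where "r i = u i - u0 - A *v y i" for i
  have u: "u i = u0 + A *v y i + r i" for i
    by (simp add: r_def)
  have eq: "(u i + u (Suc i)) \<bullet> (y (Suc i) - y i) - axial A \<bullet> cross3 (y i) (y (Suc i))
     = ((u0 + u0) \<bullet> y (Suc i) - (u0 + u0) \<bullet> y i) + ((A *v y (Suc i)) \<bullet> y (Suc i) - (A *v y i) \<bullet> y i)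
      + (r i + r (Suc i)) \<bullet> (y (Suc i) - y i)" for i
    by (simp add: u axial_inner_cross3 inner_diff_right inner_add_left inner_add_right inner_commute)
  have "2 * (polygon_circulation N u y - axial A \<bullet> polygon_area N y)
     = (\<Sum>i<N. (u i + u (Suc i)) \<bullet> (y (Suc i) - y i) - axial A \<bullet> cross3 (y i) (y (Suc i)))"
    by (simp add: polygon_circulation_def polygon_area_def inner_sum_right sum_subtractf)
  also have "\<dots> = (\<Sum>i<N. (r i + r (Suc i)) \<bullet> (y (Suc i) - y i))"
    unfolding eq sum.distrib sum_distrib_left[symmetric]
    using sum_Suc_diff_closed[of "\<lambda>i. (u0 + u0) \<bullet> y i" N] sum_Suc_diff_closed[of "\<lambda>i. (A *v y i) \<bullet> y i" N] closed
    by simp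
  finally have eq2: "2 * (polygon_circulation N u y - axial A \<bullet> polygon_area N y) = (\<Sum>i<N. (r i + r (Suc i)) \<bullet> (y (Suc i) - y i))" .
  have "\<bar>(r i + r (Suc i)) \<bullet> (y (Suc i) - y i)\<bar> \<le> 2 * (\<eta> * \<rho> * d)" if "i < N" for i
  proof -
    have "norm (r i + r (Suc i)) \<le> 2 * (\<eta> * \<rho>)"
      using r[of i] r[of "Suc i"] that norm_triangle_ineq[of "r i" "r (Suc i)"] by (auto simp: r_def)
    moreover have "norm (y (Suc i) - y i) \<le> d"
      using dy that by auto
    ultimately have "norm (r i + r (Suc i)) * norm (y (Suc i) - y i) \<le> 2 * (\<eta> * \<rho>) * d"
      by (meson mult_mono norm_ge_zero order_trans)
    then show ?thesis
      using Cauchy_Schwarz_ineq2[of "r i + r (Suc i)" "y (Suc i) - y i"] by simp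
  qed
  then have "\<bar>\<Sum>i<N. (r i + r (Suc i)) \<bullet> (y (Suc i) - y i)\<bar> \<le> (\<Sum>i<N. 2 * (\<eta> * \<rho> * d))"
    by (intro order_trans[OF sum_abs] sum_mono) auto
  then show ?thesis
    unfolding eq2[symmetric] by simp
qed

text \<open>With \<open>w\<close> the velocities of the vertices, the sum is the time derivative of
  \<open>polygon_area\<close>. The remainder is small in two ways, relative to \<open>\<rho>\<close>
  at each vertex and relative to \<open>d\<close> across each edge.\<close>

lemma polygon_area_velocity_approx:
  assumes y: "\<And>i. i \<le> N \<Longrightarrow> norm (y i) \<le> \<rho>"
    and dy: "\<And>i. i < N \<Longrightarrow> norm (y (Suc i) - y i) \<le> d"
    and r: "\<And>i. i \<le> N \<Longrightarrow> norm (w i - A *v y i) \<le> \<eta> * \<rho>"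
    and dr: "\<And>i. i < N \<Longrightarrow> norm (w (Suc i) - w i - A *v (y (Suc i) - y i)) \<le> \<eta> * d"
    and tr: "trace A = 0"
  shows "norm ((1/2) *\<^sub>R (\<Sum>i<N. cross3 (w i) (y (Suc i)) + cross3 (y i) (w (Suc i)))
      + transpose A *v polygon_area N y) \<le> N * (\<eta> * \<rho> * d)"
proof -
  define r where "r i = w i - A *v y i" for i
  have w: "w i = A *v y i + r i" for i
    by (simp add: r_def)
  \<comment> \<open>A remainder of size \<open>\<eta> * \<rho>\<close> crossed with a vertex of size
    \<open>\<rho>\<close> would be too large after summing over all edges. This cancellation leaves
    only products in which one factor is a difference across an edge, and so gains
    \<open>d\<close>.\<close>
  have skew: "cross3 (r i) (y i) + cross3 (y i) (r i) = 0" for i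
    using cross_skew[of "r i" "y i"] by simp
  have "cross3 (w i) (y (Suc i)) + cross3 (y i) (w (Suc i)) + transpose A *v cross3 (y i) (y (Suc i))
     = (cross3 (A *v y i) (y (Suc i)) + cross3 (y i) (A *v y (Suc i)) + transpose A *v cross3 (y i) (y (Suc i)))
      + (cross3 (r i) (y (Suc i) - y i) + cross3 (y i) (r (Suc i) - r i))
      + (cross3 (r i) (y i) + cross3 (y i) (r i))" for i
    by (simp add: w cross_add_left cross_add_right Cross3.right_diff_distrib)
  then have eq: "cross3 (w i) (y (Suc i)) + cross3 (y i) (w (Suc i)) + transpose A *v cross3 (y i) (y (Suc i))
     = cross3 (r i) (y (Suc i) - y i) + cross3 (y i) (r (Suc i) - r i)" for i
    unfolding cross3_derivation skew by (simp add: tr)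
  have "(1/2) *\<^sub>R (\<Sum>i<N. cross3 (w i) (y (Suc i)) + cross3 (y i) (w (Suc i))) + transpose A *v polygon_area N y
    = (1/2) *\<^sub>R (\<Sum>i<N. cross3 (w i) (y (Suc i)) + cross3 (y i) (w (Suc i)) + transpose A *v cross3 (y i) (y (Suc i)))"
    unfolding polygon_area_def matrix_vector_mult_scaleR
    by (simp add: sum.distrib scaleR_add_right del: transpose_matrix_vector
        flip: linear_sum[OF matrix_vector_mul_linear, of "transpose A"])
  also have "\<dots> = (1/2) *\<^sub>R (\<Sum>i<N. cross3 (r i) (y (Suc i) - y i) + cross3 (y i) (r (Suc i) - r i))"
    unfolding eq ..
  also have "norm \<dots> \<le> (1/2) * (\<Sum>i<N. 2 * (\<eta> * \<rho> * d))"
  proof -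
    have "norm (cross3 (r i) (y (Suc i) - y i) + cross3 (y i) (r (Suc i) - r i)) \<le> 2 * (\<eta> * \<rho> * d)"
      if "i < N" for i
    proof -
      have "norm (r i) \<le> \<eta> * \<rho>" "norm (y (Suc i) - y i) \<le> d" "norm (y i) \<le> \<rho>"
        using that r dy y by (auto simp: r_def)
      moreover have "r (Suc i) - r i = w (Suc i) - w i - A *v (y (Suc i) - y i)"
        by (simp add: r_def matrix_vector_mult_diff_distrib)
      then have "norm (r (Suc i) - r i) \<le> \<eta> * d"
        using dr that by simp
      ultimately have "norm (r i) * norm (y (Suc i) - y i) \<le> \<eta> * \<rho> * d"
          "norm (y i) * norm (r (Suc i) - r i) \<le> \<rho> * (\<eta> * d)"
        by (meson mult_mono norm_ge_zero order_trans)+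
      then have "norm (cross3 (r i) (y (Suc i) - y i)) \<le> \<eta> * \<rho> * d" "norm (cross3 (y i) (r (Suc i) - r i)) \<le> \<eta> * \<rho> * d"
        using norm_cross3_le[of "r i" "y (Suc i) - y i"] norm_cross3_le[of "y i" "r (Suc i) - r i"]
        by (simp_all add: mult_ac)
      then show ?thesis
        using norm_triangle_ineq[of "cross3 (r i) (y (Suc i) - y i)" "cross3 (y i) (r (Suc i) - r i)"]
        by linarith
    qed
    then have "norm (\<Sum>i<N. cross3 (r i) (y (Suc i) - y i) + cross3 (y i) (r (Suc i) - r i)) \<le> (\<Sum>i<N. 2 * (\<eta> * \<rho> * d))"
      by (intro order_trans[OF norm_sum] sum_mono) auto
    then show ?thesis by simp
  qed
  finally show ?thesis by simp
qed

text \<open>With \<open>q\<close> the acceleration and \<open>\<pi>\<close> the pressure, this is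
  the time derivative of the circulation. The kinetic part is a difference of values of
  \<open>u i \<bullet> u i\<close>, and \<open>q\<close> is close to minus a difference quotient of
  \<open>\<pi>\<close>. Both telescope, leaving the Taylor errors of \<open>\<pi>\<close> from the
  two ends of each edge.\<close>

lemma polygon_pressure_bound:
  assumes closed: "u N = u 0" "\<pi> N = \<pi> 0"
    and dx: "\<And>i. i < N \<Longrightarrow> norm (x (Suc i) - x i) \<le> d"
    and q: "\<And>i. i < N \<Longrightarrow> \<bar>\<pi> (Suc i) - \<pi> i + q i \<bullet> (x (Suc i) - x i)\<bar> \<le> \<kappa> * d"
    and q': "\<And>i. i < N \<Longrightarrow> \<bar>\<pi> (Suc i) - \<pi> i + q (Suc i) \<bullet> (x (Suc i) - x i)\<bar> \<le> \<kappa> * d"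
  shows "\<bar>(1/2) * (\<Sum>i<N. (q i + q (Suc i)) \<bullet> (x (Suc i) - x i) + (u i + u (Suc i)) \<bullet> (u (Suc i) - u i))\<bar> \<le> N * (\<kappa> * d)"
proof -
  have eq: "(q i + q (Suc i)) \<bullet> (x (Suc i) - x i) + (u i + u (Suc i)) \<bullet> (u (Suc i) - u i)
     = (\<pi> (Suc i) - \<pi> i + q i \<bullet> (x (Suc i) - x i)) + (\<pi> (Suc i) - \<pi> i + q (Suc i) \<bullet> (x (Suc i) - x i))
       + (u (Suc i) \<bullet> u (Suc i) - u i \<bullet> u i) - 2 * (\<pi> (Suc i) - \<pi> i)" for i
    by (simp add: inner_simps inner_commute algebra_simps)
  have "(\<Sum>i<N. (q i + q (Suc i)) \<bullet> (x (Suc i) - x i) + (u i + u (Suc i)) \<bullet> (u (Suc i) - u i))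
    = (\<Sum>i<N. (\<pi> (Suc i) - \<pi> i + q i \<bullet> (x (Suc i) - x i)) + (\<pi> (Suc i) - \<pi> i + q (Suc i) \<bullet> (x (Suc i) - x i)))"
    unfolding eq sum_subtractf sum.distrib[of _ "\<lambda>i. u (Suc i) \<bullet> u (Suc i) - u i \<bullet> u i"] sum_distrib_left[symmetric]
    using sum_Suc_diff_closed[of "\<lambda>i. u i \<bullet> u i" N] sum_Suc_diff_closed[of \<pi> N] closed
    unfolding sum_subtractf by simp
  moreover have "\<bar>\<dots>\<bar> \<le> (\<Sum>i<N. 2 * (\<kappa> * d))"
  proof (intro order_trans[OF sum_abs] sum_mono)
    fix i assume "i \<in> {..<N}"
    then have "i < N" by simp
    from q[OF this] q'[OF this]
    show "\<bar>(\<pi> (Suc i) - \<pi> i + q i \<bullet> (x (Suc i) - x i)) + (\<pi> (Suc i) - \<pi> i + q (Suc i) \<bullet> (x (Suc i) - x i))\<bar> \<le> 2 * (\<kappa> * d)"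
      by linarith
  qed
  ultimately show ?thesis by simp
qed

section \<open>Regular polygons inscribed in a circle\<close>

definition circle_point :: "real^3 \<Rightarrow> real^3 \<Rightarrow> nat \<Rightarrow> nat \<Rightarrow> real^3" where
  "circle_point e e' N i = cos (2 * pi * i / N) *\<^sub>R e + sin (2 * pi * i / N) *\<^sub>R e'"

lemma circle_point_closed: "N > 0 \<Longrightarrow> circle_point e e' N N = circle_point e e' N 0"
  by (simp add: circle_point_def)

context
  fixes e e' :: "real^3"
  assumes orthonormal: "norm e = 1" "norm e' = 1" "e \<bullet> e' = 0"
begin

lemma norm_orthonormal_comb: "norm (a *\<^sub>R e + b *\<^sub>R e') = sqrt (a\<^sup>2 + b\<^sup>2)"
proof -
  have "e \<bullet> e = 1" "e' \<bullet> e' = 1" "e' \<bullet> e = 0"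
    using orthonormal by (simp_all add: norm_eq_1 inner_commute)
  then show ?thesis
    using orthonormal by (simp add: norm_eq_sqrt_inner inner_simps power2_eq_square)
qed

lemma norm_circle_point: "norm (circle_point e e' N i) = 1"
  unfolding circle_point_def norm_orthonormal_comb by simp

text \<open>The chord has length \<open>2 * \<bar>sin (pi / N)\<bar>\<close>, which is at most the
  arc.\<close>

lemma norm_circle_point_step: "norm (circle_point e e' N (Suc i) - circle_point e e' N i) \<le> 2 * pi / N"
proof -
  define s t where "s = 2 * pi * Suc i / N" and "t = 2 * pi * i / N"
  have st: "s - t = 2 * pi / N"
    by (simp add: s_def t_def diff_divide_distrib[symmetric] algebra_simps)
  have "circle_point e e' N (Suc i) - circle_point e e' N i = (cos s - cos t) *\<^sub>R e + (sin s - sin t) *\<^sub>R e'"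
    by (simp add: circle_point_def s_def t_def algebra_simps)
  then have "norm (circle_point e e' N (Suc i) - circle_point e e' N i) = sqrt ((cos s - cos t)\<^sup>2 + (sin s - sin t)\<^sup>2)"
    by (simp add: norm_orthonormal_comb)
  also have "(cos s - cos t)\<^sup>2 + (sin s - sin t)\<^sup>2 = 2 - 2 * cos (s - t)"
  proof -
    have "(cos s - cos t)\<^sup>2 + (sin s - sin t)\<^sup>2 = ((cos s)\<^sup>2 + (sin s)\<^sup>2) + ((cos t)\<^sup>2 + (sin t)\<^sup>2) - 2 * (cos s * cos t + sin s * sin t)"
      by (simp add: power2_eq_square algebra_simps)
    then show ?thesis by (simp add: cos_diff)
  qed
  also have "\<dots> = (2 * sin ((s - t) / 2))\<^sup>2"
  proof -
    have "cos (s - t) = 1 - 2 * (sin ((s - t) / 2))\<^sup>2"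
      using cos_double_sin[of "(s - t) / 2"] by (metis field_sum_of_halves mult_2)
    then show ?thesis by (simp add: power_mult_distrib)
  qed
  also have "sqrt \<dots> = 2 * \<bar>sin ((s - t) / 2)\<bar>"
    unfolding real_sqrt_abs abs_mult by simp
  also have "\<dots> \<le> \<bar>s - t\<bar>"
    using abs_sin_x_le_abs_x[of "(s - t) / 2"] by simp
  finally show ?thesis by (simp add: st)
qed

lemma cross3_circle_point:
  "cross3 (circle_point e e' N i) (circle_point e e' N (Suc i)) = sin (2 * pi / N) *\<^sub>R cross3 e e'"
proof -
  define s t where "s = 2 * pi * Suc i / N" and "t = 2 * pi * i / N"
  have st: "s - t = 2 * pi / N"
    by (simp add: s_def t_def diff_divide_distrib[symmetric] algebra_simps)
  have "cross3 (circle_point e e' N i) (circle_point e e' N (Suc i)) = (sin s * cos t - cos s * sin t) *\<^sub>R cross3 e e'"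
    using cross_skew[of e' e]
    unfolding circle_point_def s_def[symmetric] t_def[symmetric]
    by (simp add: cross_add_left cross_add_right
        cross_mult_left cross_mult_right scaleR_diff_left mult.commute)
  then show ?thesis
    by (simp add: st[symmetric] sin_diff)
qed

lemma polygon_area_circle:
  "polygon_area N (\<lambda>i. h *\<^sub>R circle_point e e' N i) = (h\<^sup>2 * (N * sin (2 * pi / N) / 2)) *\<^sub>R cross3 e e'"
  by (simp add: polygon_area_def cross_mult_left cross_mult_right cross3_circle_point sum_constant_scaleR power2_eq_square mult_ac del: sum_constant)

end

text \<open>The areas tend to \<open>pi\<close>. A lower bound free of \<open>N\<close> allows loops
  to be normalized by their area although \<open>N\<close> is chosen after the radius.\<close>

lemma eventually_circle_area_ge_1: "\<forall>\<^sub>F N in sequentially. real N * sin (2 * pi / N) / 2 \<ge> 1"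
proof -
  have "(\<lambda>N. real N * sin (2 * pi / N) / 2) \<longlonglongrightarrow> pi"
    by real_asymp
  then have "\<forall>\<^sub>F N in sequentially. real N * sin (2 * pi / N) / 2 > 1"
    by (rule order_tendstoD) (use pi_gt3 in auto)
  then show ?thesis
    by eventually_elim simp
qed

section \<open>Transport of the vorticity along trajectories\<close>

text \<open>\<open>q\<close> is at once the acceleration along trajectories and minus the pressure
  gradient; the momentum equation enters only through this identification. \<open>J\<close> and
  \<open>q\<close> are merely continuous, and nothing is assumed about derivatives of
  \<open>X\<close> in the starting point.\<close>

locale euler_flow =
  fixes t0 :: real and v X q :: "real \<Rightarrow> real^3 \<Rightarrow> real^3" and p :: "real \<Rightarrow> real^3 \<Rightarrow> real"
    and J :: "real \<Rightarrow> real^3 \<Rightarrow> real^3^3" and K :: real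
  assumes t0_pos: "0 < t0"
    and v_deriv: "\<And>t x. t \<in> {0..t0} \<Longrightarrow> (v t has_derivative (*v) (J t x)) (at x)"
    and J_cont: "continuous_on ({0..t0} \<times> UNIV) (\<lambda>(t, x). J t x)"
    and J_bound: "\<And>t x. t \<in> {0..t0} \<Longrightarrow> norm (J t x) \<le> K"
    and J_trace: "\<And>t x. t \<in> {0..t0} \<Longrightarrow> trace (J t x) = 0"
    and X_0: "\<And>b. X 0 b = b"
    and X_deriv: "\<And>t b. t \<in> {0..t0} \<Longrightarrow> ((\<lambda>s. X s b) has_vector_derivative v t (X t b)) (at t within {0..t0})"
    and vX_deriv: "\<And>t b. t \<in> {0..t0} \<Longrightarrow>
      ((\<lambda>s. v s (X s b)) has_vector_derivative q t (X t b)) (at t within {0..t0})"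
    and q_cont: "continuous_on ({0..t0} \<times> UNIV) (\<lambda>(t, x). q t x)"
    and p_deriv: "\<And>t x. t \<in> {0..t0} \<Longrightarrow> (p t has_derivative (\<lambda>y. - (q t x \<bullet> y))) (at x)"
begin

lemma K_nonneg: "0 \<le> K"
  using J_bound[of 0 0] t0_pos norm_ge_zero[of "J 0 0"] by (auto simp del: norm_ge_zero)

lemma v_lipschitz: "t \<in> {0..t0} \<Longrightarrow> norm (v t x - v t y) \<le> K * norm (x - y)"
  by (rule differentiable_bound[of UNIV])
     (auto intro: v_deriv order_trans[OF onorm_matrix_le J_bound])

definition L where "L = exp (K * t0)"

lemma L_ge_1: "1 \<le> L"
  using K_nonneg t0_pos by (simp add: L_def)

lemma X_lipschitz:
  assumes t: "t \<in> {0..t0}"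
  shows "norm (X t b - X t b') \<le> L * norm (b - b')"
proof -
  have "norm (X t b - X t b') \<le> exp (K * t) * (norm (X 0 b - X 0 b') + 0 * t)"
  proof (rule gronwall_norm)
    fix s assume s: "s \<in> {0..t}"
    then have s': "s \<in> {0..t0}" using t by auto
    show "((\<lambda>s. X s b - X s b') has_vector_derivative v s (X s b) - v s (X s b')) (at s within {0..t})"
      by (intro has_vector_derivative_diff has_vector_derivative_within_subset[OF X_deriv[OF s']]) (use t in auto)
    show "norm (v s (X s b) - v s (X s b')) \<le> K * norm (X s b - X s b') + 0"
      using v_lipschitz[OF s'] by simp
  qed (use t K_nonneg in auto)
  also have "\<dots> \<le> L * norm (b - b')"
    unfolding L_def using t K_nonneg by (auto simp: X_0 intro!: mult_right_mono mult_left_mono)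
  finally show ?thesis .
qed

lemma X_bounded: obtains R where "\<And>t. t \<in> {0..t0} \<Longrightarrow> norm (X t a) \<le> R"
proof -
  have "continuous_on {0..t0} (\<lambda>t. X t a)"
    using X_deriv by (meson continuous_on_eq_continuous_within has_vector_derivative_continuous)
  then have "bounded ((\<lambda>t. X t a) ` {0..t0})"
    by (intro compact_imp_bounded compact_continuous_image) auto
  then show ?thesis
    using that unfolding bounded_iff by (metis imageI)
qed

section \<open>Linearization of velocity and pressure, uniform in time\<close>

lemma uniform_modulus:
  fixes F :: "real \<Rightarrow> real^3 \<Rightarrow> 'b::metric_space"
  assumes "continuous_on ({0..t0} \<times> UNIV) (\<lambda>(t, x). F t x)" "0 < \<eta>"
  obtains \<delta> where "0 < \<delta>"
    "\<And>t (x :: real^3) (y :: real^3). t \<in> {0..t0} \<Longrightarrow> norm x \<le> R \<Longrightarrow> norm y \<le> R \<Longrightarrow> norm (x - y) < \<delta> \<Longrightarrow> dist (F t x) (F t y) < \<eta>"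
proof -
  have "uniformly_continuous_on ({0..t0} \<times> cball 0 R) (\<lambda>(t, x). F t x)"
    by (intro compact_uniformly_continuous continuous_on_subset[OF assms(1)] compact_Times) auto
  then obtain \<delta> where "0 < \<delta>" and
    \<delta>: "\<And>z z'. z \<in> {0..t0} \<times> cball 0 R \<Longrightarrow> z' \<in> {0..t0} \<times> cball 0 R \<Longrightarrow> dist z' z < \<delta> \<Longrightarrow>
       dist (case z' of (t, x) \<Rightarrow> F t x) (case z of (t, x) \<Rightarrow> F t x) < \<eta>"
    unfolding uniformly_continuous_on_def using \<open>0 < \<eta>\<close> by metis
  show ?thesis
  proof (rule that[OF \<open>0 < \<delta>\<close>])
    fix t and x y :: "real^3" assume "t \<in> {0..t0}" "norm x \<le> R" "norm y \<le> R" "norm (x - y) < \<delta>"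
    then show "dist (F t x) (F t y) < \<eta>"
      using \<delta>[of "(t, y)" "(t, x)"] by (simp add: dist_Pair_Pair dist_norm)
  qed
qed

text \<open>Strict differentiability along a trajectory. With \<open>y = X t a\<close> it controls
  the vertices of a loop, with two neighbouring vertices its edges, so it supplies both remainder
  bounds of \<open>polygon_area_velocity_approx\<close>.\<close>

lemma v_linearization:
  assumes "0 < \<eta>"
  obtains \<delta> where "0 < \<delta>"
    "\<And>t x y. t \<in> {0..t0} \<Longrightarrow> norm (x - X t a) < \<delta> \<Longrightarrow> norm (y - X t a) < \<delta> \<Longrightarrow>
        norm (v t x - v t y - J t (X t a) *v (x - y)) \<le> \<eta> * norm (x - y)"
proof -
  obtain R where R: "\<And>t. t \<in> {0..t0} \<Longrightarrow> norm (X t a) \<le> R"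
    using X_bounded[of a] by blast
  obtain \<delta> where "0 < \<delta>" and \<delta>: "\<And>t (x::real^3) (y::real^3). t \<in> {0..t0} \<Longrightarrow> norm x \<le> R + 1 \<Longrightarrow> norm y \<le> R + 1 \<Longrightarrow>
      norm (x - y) < \<delta> \<Longrightarrow> dist (J t x) (J t y) < \<eta>"
    using uniform_modulus[OF J_cont \<open>0 < \<eta>\<close>, of "R + 1"] by blast
  show ?thesis
  \<comment> \<open>The 1 keeps the ball inside \<open>cball 0 (R + 1)\<close>, where the modulus of
    \<open>J\<close> holds.\<close>
  proof (rule that[of "min 1 \<delta>"])
    fix t and x y :: "real^3" assume t: "t \<in> {0..t0}" and xy: "norm (x - X t a) < min 1 \<delta>" "norm (y - X t a) < min 1 \<delta>"
    have "norm (v t x - v t y - J t (X t a) *v (x - y)) \<le> norm (x - y) * \<eta>"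
    proof (rule differentiable_bound_linearization[where S="ball (X t a) (min 1 \<delta>)" and f' = "\<lambda>z. (*v) (J t z)"])
      fix s :: real assume "s \<in> {0..1}"
      then have "(1 - s) *\<^sub>R y + s *\<^sub>R x \<in> ball (X t a) (min 1 \<delta>)"
        using xy by (intro convexD[OF convex_ball]) (auto simp: dist_norm norm_minus_commute)
      then show "y + s *\<^sub>R (x - y) \<in> ball (X t a) (min 1 \<delta>)"
        by (simp add: algebra_simps)
    next
      fix z assume z: "z \<in> ball (X t a) (min 1 \<delta>)"
      show "(v t has_derivative (*v) (J t z)) (at z within ball (X t a) (min 1 \<delta>))"
        by (rule has_derivative_at_withinI[OF v_deriv[OF t]])
      have "norm z \<le> R + 1"
        using z R[OF t] norm_triangle_sub[of z "X t a"] by (auto simp: dist_norm norm_minus_commute)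
      then have "dist (J t z) (J t (X t a)) < \<eta>"
        using z R[OF t] by (intro \<delta> t) (auto simp: dist_norm norm_minus_commute)
      then have "onorm ((*v) (J t z - J t (X t a))) \<le> \<eta>"
        using onorm_matrix_le[of "J t z - J t (X t a)"] by (simp add: dist_norm)
      moreover have "(*v) (J t z) - (*v) (J t (X t a)) = (*v) (J t z - J t (X t a))"
        by (auto simp: matrix_vector_mult_diff_rdistrib)
      ultimately show "onorm ((*v) (J t z) - (*v) (J t (X t a))) \<le> \<eta>"
        by simp
    qed (use \<open>0 < \<delta>\<close> in auto)
    then show "norm (v t x - v t y - J t (X t a) *v (x - y)) \<le> \<eta> * norm (x - y)"
      by (simp add: mult.commute)
  qed (use \<open>0 < \<delta>\<close> in auto)
qed

text \<open>As \<open>q\<close> is only continuous, the Taylor error is a small multiple of the edge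
  length, not of its square. This suffices because the edge lengths add up to a bounded
  perimeter.\<close>

lemma p_linearization:
  assumes "0 < \<kappa>"
  obtains \<delta> where "0 < \<delta>"
    "\<And>t (x :: real^3) (y :: real^3). t \<in> {0..t0} \<Longrightarrow> norm x \<le> R \<Longrightarrow> norm y \<le> R \<Longrightarrow> norm (y - x) < \<delta> \<Longrightarrow>
        \<bar>p t y - p t x + q t x \<bullet> (y - x)\<bar> \<le> \<kappa> * norm (y - x)"
proof -
  obtain \<delta> where "0 < \<delta>" and \<delta>: "\<And>t (x::real^3) (y::real^3). t \<in> {0..t0} \<Longrightarrow> norm x \<le> R \<Longrightarrow> norm y \<le> R \<Longrightarrow>
      norm (x - y) < \<delta> \<Longrightarrow> dist (q t x) (q t y) < \<kappa>"
    using uniform_modulus[OF q_cont \<open>0 < \<kappa>\<close>, of R] by blast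
  show ?thesis
  proof (rule that[OF \<open>0 < \<delta>\<close>])
    fix t and x y :: "real^3" assume t: "t \<in> {0..t0}" and xy: "norm x \<le> R" "norm y \<le> R" "norm (y - x) < \<delta>"
    have "norm (p t y - p t x - - (q t x \<bullet> (y - x))) \<le> norm (y - x) * \<kappa>"
    proof (rule differentiable_bound_linearization[where S="ball x \<delta> \<inter> cball 0 R" and f' = "\<lambda>z y. - (q t z \<bullet> y)"])
      fix s :: real assume "s \<in> {0..1}"
      then have "(1 - s) *\<^sub>R x + s *\<^sub>R y \<in> ball x \<delta> \<inter> cball 0 R"
        using xy \<open>0 < \<delta>\<close> by (intro convexD[OF convex_Int[OF convex_ball convex_cball]])
          (auto simp: dist_norm norm_minus_commute)
      then show "x + s *\<^sub>R (y - x) \<in> ball x \<delta> \<inter> cball 0 R"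
        by (simp add: algebra_simps)
    next
      fix z assume z: "z \<in> ball x \<delta> \<inter> cball 0 R"
      show "(p t has_derivative (\<lambda>y. - (q t z \<bullet> y))) (at z within ball x \<delta> \<inter> cball 0 R)"
        by (rule has_derivative_at_withinI[OF p_deriv[OF t]])
      have "dist (q t z) (q t x) < \<kappa>"
        using z xy by (intro \<delta> t) (auto simp: dist_norm norm_minus_commute)
      then have "\<bar>(q t z - q t x) \<bullet> y\<bar> \<le> \<kappa> * norm y" for y
        using Cauchy_Schwarz_ineq2[of "q t z - q t x" y] mult_right_mono[of "dist (q t z) (q t x)" \<kappa> "norm y"]
        by (simp add: dist_norm)
      then show "onorm ((\<lambda>y. - (q t z \<bullet> y)) - (\<lambda>y. - (q t x \<bullet> y))) \<le> \<kappa>"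
        by (intro onorm_le) (simp add: inner_diff_left abs_minus_commute)
    qed (use xy \<open>0 < \<delta>\<close> in auto)
    then show "\<bar>p t y - p t x + q t x \<bullet> (y - x)\<bar> \<le> \<kappa> * norm (y - x)"
      by (simp add: mult.commute)
  qed
qed

text \<open>Counts the errors of one loop in units of \<open>\<eta> * (2 * pi * L\<^sup>2)\<close>:
  one for replacing circulation by area at each of the two end times, and \<open>t0\<close> for the
  drift of the circulation in between.\<close>

definition D where "D = (t0 + 2) * (2 * pi * L\<^sup>2)"

text \<open>\<open>S\<close> is the vector area of a polygon of particles divided by its initial
  area \<open>c\<close>, so all errors must be of order \<open>\<eta> * h\<^sup>2\<close> before the
  division, where \<open>h\<close> is the initial radius.\<close>

lemma transported_loop:
  assumes e: "norm e = 1" "norm e' = 1" "e \<bullet> e' = 0" and \<eta>: "0 < \<eta>"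
  obtains S S' where "S 0 = cross3 e e'"
    "\<And>t. t \<in> {0..t0} \<Longrightarrow> (S has_vector_derivative S' t) (at t within {0..t0})"
    "\<And>t. t \<in> {0..t0} \<Longrightarrow> norm (S' t + transpose (J t (X t a)) *v S t) \<le> D * \<eta>"
    "\<bar>axial (J t0 (X t0 a)) \<bullet> S t0 - axial (J 0 a) \<bullet> S 0\<bar> \<le> D * \<eta>"
proof -
  have L_pos: "0 < L" using L_ge_1 by simp
  obtain \<delta> where "0 < \<delta>" and \<delta>: "\<And>t x y. t \<in> {0..t0} \<Longrightarrow> norm (x - X t a) < \<delta> \<Longrightarrow> norm (y - X t a) < \<delta> \<Longrightarrow>
        norm (v t x - v t y - J t (X t a) *v (x - y)) \<le> \<eta> * norm (x - y)"
    using v_linearization[OF \<eta>] by blast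
  \<comment> \<open>The flow expands distances at most by \<open>L\<close>, so the loop stays within
    \<open>\<rho> = \<delta> / 2\<close> of the moving centre.\<close>
  define h where "h = \<delta> / (2 * L)"
  have "0 < h" using \<open>0 < \<delta>\<close> L_pos by (simp add: h_def)
  define \<rho> where "\<rho> = L * h"
  have "0 < \<rho>" "\<rho> < \<delta>" using \<open>0 < h\<close> \<open>0 < \<delta>\<close> L_pos by (simp_all add: \<rho>_def h_def)
  obtain R where R: "\<And>t. t \<in> {0..t0} \<Longrightarrow> norm (X t a) \<le> R"
    using X_bounded[of a] by blast
  \<comment> \<open>The pressure tolerance is \<open>\<eta> * \<rho>\<close> rather than
    \<open>\<eta>\<close>: over a perimeter of order \<open>\<rho>\<close> it has to produce an
    error of order \<open>\<eta> * \<rho>\<^sup>2\<close>.\<close>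
  have "0 < \<eta> * \<rho>" using \<eta> \<open>0 < \<rho>\<close> by simp
  then obtain \<delta>' where "0 < \<delta>'" and \<delta>': "\<And>t (x::real^3) (y::real^3). t \<in> {0..t0} \<Longrightarrow> norm x \<le> R + \<rho> \<Longrightarrow> norm y \<le> R + \<rho> \<Longrightarrow>
      norm (y - x) < \<delta>' \<Longrightarrow> \<bar>p t y - p t x + q t x \<bullet> (y - x)\<bar> \<le> \<eta> * \<rho> * norm (y - x)"
    using p_linearization[of "\<eta> * \<rho>" "R + \<rho>"] by blast
  have "(\<lambda>N. \<rho> * (2 * pi / real N)) \<longlonglongrightarrow> 0"
    by (intro tendsto_mult_right_zero lim_const_over_n)
  then have "\<forall>\<^sub>F N in sequentially. \<rho> * (2 * pi / real N) < \<delta>'"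
    using \<open>0 < \<delta>'\<close> by (rule order_tendstoD)
  with eventually_circle_area_ge_1 have "\<forall>\<^sub>F N in sequentially. 0 < N \<and> \<rho> * (2 * pi / real N) < \<delta>' \<and> real N * sin (2 * pi / N) / 2 \<ge> 1"
    using eventually_gt_at_top[of 0] by eventually_elim auto
  from eventually_happens'[OF sequentially_bot this]
  obtain N :: nat where N: "0 < N" "\<rho> * (2 * pi / real N) < \<delta>'" "real N * sin (2 * pi / N) / 2 \<ge> 1"
    by blast
  define d where "d = \<rho> * (2 * pi / real N)"
  define P where "P i = a + h *\<^sub>R circle_point e e' N i" for i
  define x where "x i t = X t (P i)" for i t
  define y where "y i t = x i t - X t a" for i t
  define u where "u i t = v t (x i t)" for i t
  have closed: "x N t = x 0 t" "u N t = u 0 t" "y N t = y 0 t" for t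
    using circle_point_closed[OF N(1)] by (simp_all add: x_def u_def y_def P_def)
  have y_le: "norm (y i t) \<le> \<rho>" if "t \<in> {0..t0}" for i t
    using X_lipschitz[OF that, of "P i" a] norm_circle_point[OF e, of N i] \<open>0 < h\<close>
    by (simp add: y_def x_def P_def \<rho>_def)
  have x_le: "norm (x i t) \<le> R + \<rho>" if "t \<in> {0..t0}" for i t
    using y_le[OF that, of i] R[OF that] norm_triangle_sub[of "x i t" "X t a"] by (simp add: y_def)
  have dx: "norm (x (Suc i) t - x i t) \<le> d" if "t \<in> {0..t0}" for i t
  proof -
    have "norm (x (Suc i) t - x i t) \<le> L * norm (P (Suc i) - P i)"
      unfolding x_def by (rule X_lipschitz[OF that])
    also have "norm (P (Suc i) - P i) = h * norm (circle_point e e' N (Suc i) - circle_point e e' N i)"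
      using \<open>0 < h\<close> by (simp add: P_def scaleR_diff_right[symmetric])
    also have "\<dots> \<le> h * (2 * pi / N)"
      using norm_circle_point_step[OF e] \<open>0 < h\<close> by (intro mult_left_mono) auto
    finally show ?thesis
      using L_pos by (simp add: d_def \<rho>_def mult_ac)
  qed
  have dy_eq: "y (Suc i) t - y i t = x (Suc i) t - x i t" for i t
    by (simp add: y_def)
  have near: "norm (x i t - X t a) < \<delta>" if "t \<in> {0..t0}" for i t
    using y_le[OF that, of i] \<open>\<rho> < \<delta>\<close> by (simp add: y_def)
  have r: "norm (u i t - v t (X t a) - J t (X t a) *v y i t) \<le> \<eta> * \<rho>" if "t \<in> {0..t0}" for i t
  proof -
    have "norm (u i t - v t (X t a) - J t (X t a) *v y i t) \<le> \<eta> * norm (y i t)"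
      unfolding u_def y_def using \<delta>[OF that near[OF that, of i], of "X t a"] \<open>0 < \<delta>\<close> by simp
    also have "\<dots> \<le> \<eta> * \<rho>"
      using y_le[OF that] \<eta> by simp
    finally show ?thesis .
  qed
  have dr: "norm (u (Suc i) t - u i t - J t (X t a) *v (y (Suc i) t - y i t)) \<le> \<eta> * d" if "t \<in> {0..t0}" for i t
  proof -
    have "norm (u (Suc i) t - u i t - J t (X t a) *v (y (Suc i) t - y i t)) \<le> \<eta> * norm (x (Suc i) t - x i t)"
      unfolding u_def dy_eq using \<delta>[OF that near[OF that, of "Suc i"] near[OF that, of i]] by simp
    also have "\<dots> \<le> \<eta> * d"
      using dx[OF that] \<eta> by simp
    finally show ?thesis .
  qed
  define B where "B = N * (\<eta> * \<rho> * d)"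
  \<comment> \<open>\<open>N\<close> cancels against the edge length, so refining the polygon for
    the sake of the pressure leaves the error unchanged.\<close>
  have B_eq: "B = \<eta> * (2 * pi * L\<^sup>2) * h\<^sup>2"
    using N(1) by (simp add: B_def d_def \<rho>_def power2_eq_square)
  have "0 \<le> B" using \<eta> by (simp add: B_eq)
  define C where "C t = polygon_circulation N (\<lambda>i. u i t) (\<lambda>i. y i t)" for t
  define A where "A t = polygon_area N (\<lambda>i. y i t)" for t
  have C_approx: "\<bar>C t - axial (J t (X t a)) \<bullet> A t\<bar> \<le> B" if "t \<in> {0..t0}" for t
    unfolding C_def A_def B_def
    by (rule polygon_circulation_approx[where ?u0.0 = "v t (X t a)"]) (use closed y_le r dx that in \<open>auto simp: dy_eq\<close>)
  have x_deriv: "(x i has_vector_derivative u i t) (at t within {0..t0})" if "t \<in> {0..t0}" for i t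
    unfolding x_def u_def by (rule X_deriv[OF that])
  have u_deriv: "(u i has_vector_derivative q t (x i t)) (at t within {0..t0})" if "t \<in> {0..t0}" for i t
    unfolding x_def u_def by (rule vX_deriv[OF that])
  have y_deriv: "(y i has_vector_derivative u i t - v t (X t a)) (at t within {0..t0})" if "t \<in> {0..t0}" for i t
    unfolding y_def[abs_def] by (intro has_vector_derivative_diff x_deriv X_deriv that)
  \<comment> \<open>Product rule for the trapezoidal sum: the first term differentiates the
    velocities, the second the edges.\<close>
  define C' where "C' t = (1/2) * (\<Sum>i<N. (q t (x i t) + q t (x (Suc i) t)) \<bullet> (x (Suc i) t - x i t)
    + (u i t + u (Suc i) t) \<bullet> (u (Suc i) t - u i t))" for t
  have C_deriv: "(C has_vector_derivative C' t) (at t within {0..t0})" if "t \<in> {0..t0}" for t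
  proof -
    have "((\<lambda>t. (u i t + u (Suc i) t) \<bullet> (x (Suc i) t - x i t)) has_vector_derivative
       (q t (x i t) + q t (x (Suc i) t)) \<bullet> (x (Suc i) t - x i t) + (u i t + u (Suc i) t) \<bullet> (u (Suc i) t - u i t))
       (at t within {0..t0})" for i
      using bounded_bilinear.has_vector_derivative[OF bounded_bilinear_inner
          has_vector_derivative_add[OF u_deriv[OF that, of i] u_deriv[OF that, of "Suc i"]]
          has_vector_derivative_diff[OF x_deriv[OF that, of "Suc i"] x_deriv[OF that, of i]]]
      by (simp only: add.commute)
    then show ?thesis
      unfolding C_def[abs_def] polygon_circulation_def C'_def dy_eq
      by (intro has_vector_derivative_mult_right has_vector_derivative_sum)
  qed
  have C'_le: "\<bar>C' t\<bar> \<le> B" if t: "t \<in> {0..t0}" for t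
    unfolding C'_def B_def
  proof (rule polygon_pressure_bound[where \<pi> = "\<lambda>i. p t (x i t)"])
    fix i
    have "norm (x (Suc i) t - x i t) < \<delta>'"
      using dx[OF t, of i] N(2) by (simp add: d_def)
    then have "\<bar>p t (x (Suc i) t) - p t (x i t) + q t (x i t) \<bullet> (x (Suc i) t - x i t)\<bar> \<le> \<eta> * \<rho> * norm (x (Suc i) t - x i t)"
       "\<bar>p t (x i t) - p t (x (Suc i) t) + q t (x (Suc i) t) \<bullet> (x i t - x (Suc i) t)\<bar> \<le> \<eta> * \<rho> * norm (x i t - x (Suc i) t)"
      using \<delta>'[OF t x_le[OF t, of i] x_le[OF t, of "Suc i"]] \<delta>'[OF t x_le[OF t, of "Suc i"] x_le[OF t, of i]]
      by (simp_all add: norm_minus_commute)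
    moreover have "\<eta> * \<rho> * norm (x (Suc i) t - x i t) \<le> \<eta> * \<rho> * d"
      using dx[OF t] \<open>0 < \<eta> * \<rho>\<close> by (intro mult_left_mono) auto
    ultimately show "\<bar>p t (x (Suc i) t) - p t (x i t) + q t (x i t) \<bullet> (x (Suc i) t - x i t)\<bar> \<le> \<eta> * \<rho> * d"
      "\<bar>p t (x (Suc i) t) - p t (x i t) + q t (x (Suc i) t) \<bullet> (x (Suc i) t - x i t)\<bar> \<le> \<eta> * \<rho> * d"
      by (auto simp: norm_minus_commute inner_diff_right)
  qed (use closed dx t in auto)
  have C_diff: "\<bar>C t0 - C 0\<bar> \<le> B * t0"
  proof -
    have "norm (C t0 - C 0) \<le> B * norm (t0 - 0)"
      by (rule field_differentiable_bound[of "{0..t0}" C C'])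
         (use C_deriv C'_le t0_pos in \<open>auto simp: has_real_derivative_iff_has_vector_derivative\<close>)
    then show ?thesis using t0_pos by simp
  qed
  define A' where "A' t = (1/2) *\<^sub>R (\<Sum>i<N. cross3 (u i t - v t (X t a)) (y (Suc i) t) + cross3 (y i t) (u (Suc i) t - v t (X t a)))" for t
  have A_deriv: "(A has_vector_derivative A' t) (at t within {0..t0})" if "t \<in> {0..t0}" for t
  proof -
    have "((\<lambda>t. cross3 (y i t) (y (Suc i) t)) has_vector_derivative
       cross3 (u i t - v t (X t a)) (y (Suc i) t) + cross3 (y i t) (u (Suc i) t - v t (X t a)))
       (at t within {0..t0})" for i
      using bounded_bilinear.has_vector_derivative[OF bounded_bilinear_cross3
          y_deriv[OF that, of i] y_deriv[OF that, of "Suc i"]]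
      by (simp only: add.commute)
    then show ?thesis
      unfolding A_def[abs_def] polygon_area_def A'_def
      by (intro bounded_linear.has_vector_derivative[OF bounded_linear_scaleR_right] has_vector_derivative_sum)
  qed
  have A'_le: "norm (A' t + transpose (J t (X t a)) *v A t) \<le> B" if t: "t \<in> {0..t0}" for t
    unfolding A'_def A_def B_def
    by (rule polygon_area_velocity_approx) (use y_le r dx dr t J_trace in \<open>auto simp: dy_eq\<close>)
  \<comment> \<open>The initially enclosed area. By the choice of \<open>N\<close> it is at least
    \<open>h\<^sup>2\<close>, so dividing by it removes the scale from \<open>B\<close>.\<close>
  define c where "c = h\<^sup>2 * (real N * sin (2 * pi / N) / 2)"
  have c: "c \<ge> h\<^sup>2" "0 < c"
    using N(3) \<open>0 < h\<close> unfolding c_def by (auto intro: mult_pos_pos)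
  have A_0: "A 0 = c *\<^sub>R cross3 e e'"
    unfolding A_def c_def by (simp add: y_def x_def X_0 P_def polygon_area_circle[OF e])
  have Bc: "B / c \<le> \<eta> * (2 * pi * L\<^sup>2)"
    unfolding B_eq using c \<eta> mult_right_mono[OF c(1), of "\<eta> * (2 * pi * L\<^sup>2)"] by (simp add: pos_divide_le_eq mult_ac)
  have BD: "B / c \<le> D * \<eta>" "B / c * (t0 + 2) \<le> D * \<eta>"
  proof -
    have "B / c * (t0 + 2) \<le> \<eta> * (2 * pi * L\<^sup>2) * (t0 + 2)"
      using Bc t0_pos by (intro mult_right_mono) auto
    then show "B / c * (t0 + 2) \<le> D * \<eta>"
      by (simp add: D_def mult_ac)
    moreover have "B / c * 1 \<le> B / c * (t0 + 2)"
      using \<open>0 \<le> B\<close> c t0_pos by (intro mult_left_mono) auto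
    ultimately show "B / c \<le> D * \<eta>" by simp
  qed
  show ?thesis
  proof (rule that[of "\<lambda>t. (1 / c) *\<^sub>R A t" "\<lambda>t. (1 / c) *\<^sub>R A' t"])
    show "(1 / c) *\<^sub>R A 0 = cross3 e e'"
      using c by (simp add: A_0)
    fix t assume t: "t \<in> {0..t0}"
    show "((\<lambda>t. (1 / c) *\<^sub>R A t) has_vector_derivative (1 / c) *\<^sub>R A' t) (at t within {0..t0})"
      by (intro bounded_linear.has_vector_derivative[OF bounded_linear_scaleR_right] A_deriv t)
    have "norm ((1 / c) *\<^sub>R (A' t + transpose (J t (X t a)) *v A t)) \<le> B / c"
      using A'_le[OF t] c by (simp add: divide_right_mono)
    then show "norm ((1 / c) *\<^sub>R A' t + transpose (J t (X t a)) *v ((1 / c) *\<^sub>R A t)) \<le> D * \<eta>"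
      using BD by (simp add: matrix_vector_mult_scaleR scaleR_add_right del: transpose_matrix_vector)
  next
    have "\<bar>axial (J t0 (X t0 a)) \<bullet> A t0 - axial (J 0 a) \<bullet> A 0\<bar> \<le> B * (t0 + 2)"
      using C_approx[of t0] C_approx[of 0] C_diff t0_pos by (simp add: X_0 algebra_simps)
    then have "\<bar>axial (J t0 (X t0 a)) \<bullet> A t0 - axial (J 0 a) \<bullet> A 0\<bar> / c \<le> B / c * (t0 + 2)"
      using c by (simp add: divide_right_mono)
    moreover have "axial (J t0 (X t0 a)) \<bullet> ((1 / c) *\<^sub>R A t0) - axial (J 0 a) \<bullet> ((1 / c) *\<^sub>R A 0)
        = (axial (J t0 (X t0 a)) \<bullet> A t0 - axial (J 0 a) \<bullet> A 0) / c"
      by (simp add: diff_divide_distrib)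
    ultimately show "\<bar>axial (J t0 (X t0 a)) \<bullet> ((1 / c) *\<^sub>R A t0) - axial (J 0 a) \<bullet> ((1 / c) *\<^sub>R A 0)\<bar> \<le> D * \<eta>"
      using BD c by simp
  qed
qed

text \<open>\<open>k\<close> bounds the gradient along this one trajectory only. The global constant
  \<open>K\<close> enters through \<open>L\<close> in \<open>D\<close>, always multiplied by
  \<open>\<eta>\<close>, and vanishes in the limit; hence the rate is \<open>k\<close>
  alone.\<close>

lemma axial_transport_bound:
  assumes k: "\<And>t. t \<in> {0..t0} \<Longrightarrow> norm (J t (X t a)) \<le> k"
  shows "norm (axial (J t0 (X t0 a))) \<le> exp (k * t0) * norm (axial (J 0 a))"
proof -
  define w\<^sub>t w\<^sub>0 E where "w\<^sub>t = axial (J t0 (X t0 a))" and "w\<^sub>0 = axial (J 0 a)" and "E = exp (k * t0)"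
  have "0 \<le> k" using k[of 0] t0_pos by (auto intro: order_trans[OF norm_ge_zero])
  have "0 \<le> D" using t0_pos by (simp add: D_def)
  have sum_comp: "(\<Sum>j\<in>UNIV. \<bar>c $ j\<bar>) \<le> 3 * norm c" for c :: "real^3"
    using sum_bounded_above[of UNIV "\<lambda>j. \<bar>c $ j\<bar>" "norm c"] component_le_norm_cart[of c] by simp
  \<comment> \<open>The factor \<open>1 - \<eta> * (3 * D * t0 * E)\<close> is kept on the left so
    that both sides are polynomial in \<open>\<eta>\<close>. Its positivity ensures that the three
    areas are still independent at time \<open>t0\<close>.\<close>
  have key: "(1 - \<eta> * (3 * D * t0 * E)) * (norm w\<^sub>t)\<^sup>2 \<le> E * (norm w\<^sub>0 + 3 * D * \<eta>) * norm w\<^sub>t"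
    if \<eta>: "0 < \<eta>" "\<eta> * (3 * D * t0 * E) < 1" for \<eta>
  proof -
    have "\<exists>S S'. S 0 = axis j (1::real) \<and>
       (\<forall>t\<in>{0..t0}. (S has_vector_derivative S' t) (at t within {0..t0})) \<and>
       (\<forall>t\<in>{0..t0}. norm (S' t + transpose (J t (X t a)) *v S t) \<le> D * \<eta>) \<and>
       \<bar>w\<^sub>t \<bullet> S t0 - w\<^sub>0 \<bullet> S 0\<bar> \<le> D * \<eta>" for j :: 3
    proof -
      obtain e e' :: "real^3" where e: "norm e = 1" "norm e' = 1" "e \<bullet> e' = 0" "cross3 e e' = axis j 1"
      proof -
        \<comment> \<open>Taking the other two axes in cyclic order gives
          \<open>cross3 e e' = axis j 1\<close> with the right sign.\<close>
        consider "j = 1" | "j = 2" | "j = 3"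
          using exhaust_3 by blast
        then show ?thesis
          using that[of "axis 2 1" "axis 3 1"] that[of "axis 3 1" "axis 1 1"] that[of "axis 1 1" "axis 2 1"]
          by cases (simp_all add: cross_basis inner_axis_axis)
      qed
      show ?thesis
        using transported_loop[OF e(1-3) \<eta>(1), of a] unfolding e(4) w\<^sub>t_def w\<^sub>0_def by metis
    qed
    then obtain S S' where S_0: "\<And>j::3. S j 0 = axis j (1::real)"
      and S_deriv: "\<And>j t. t \<in> {0..t0} \<Longrightarrow> (S j has_vector_derivative S' j t) (at t within {0..t0})"
      and S': "\<And>j t. t \<in> {0..t0} \<Longrightarrow> norm (S' j t + transpose (J t (X t a)) *v S j t) \<le> D * \<eta>"
      and S_w: "\<And>j. \<bar>w\<^sub>t \<bullet> S j t0 - w\<^sub>0 \<bullet> S j 0\<bar> \<le> D * \<eta>"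
      by metis
    \<comment> \<open>By linearity the combination with coefficients \<open>c\<close> behaves like a
      loop of initial area \<open>c\<close>. The factor 3 in its error comes from summing the three
      coefficients.\<close>
    define F where "F c t = (\<Sum>j\<in>UNIV. c $ j *\<^sub>R S j t)" for c t
    define F' where "F' c t = (\<Sum>j\<in>UNIV. c $ j *\<^sub>R S' j t)" for c t
    have F_0: "F c 0 = c" for c
      by (simp add: F_def S_0 vec_eq_iff axis_def if_distrib cong: if_cong)
    have F_deriv: "(F c has_vector_derivative F' c t) (at t within {0..t0})" if "t \<in> {0..t0}" for c t
      unfolding F_def[abs_def] F'_def
      by (intro has_vector_derivative_sum bounded_linear.has_vector_derivative[OF bounded_linear_scaleR_right] S_deriv that)
    have F'_le: "norm (F' c t) \<le> k * norm (F c t) + 3 * D * \<eta> * norm c" if t: "t \<in> {0..t0}" for c t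
    proof -
      have "F' c t + transpose (J t (X t a)) *v F c t = (\<Sum>j\<in>UNIV. c $ j *\<^sub>R (S' j t + transpose (J t (X t a)) *v S j t))"
        unfolding F_def F'_def
        by (simp add: linear_sum[OF matrix_vector_mul_linear] matrix_vector_mult_scaleR sum.distrib scaleR_add_right
            del: transpose_matrix_vector)
      also have "norm \<dots> \<le> (\<Sum>j\<in>UNIV. \<bar>c $ j\<bar> * (D * \<eta>))"
        by (intro order_trans[OF norm_sum] sum_mono) (use S'[OF t] in \<open>auto intro!: mult_left_mono\<close>)
      also have "\<dots> \<le> 3 * norm c * (D * \<eta>)"
        unfolding sum_distrib_right[symmetric] using sum_comp[of c] \<open>0 \<le> D\<close> \<eta>(1) by (intro mult_right_mono) auto
      finally have 1: "norm (F' c t + transpose (J t (X t a)) *v F c t) \<le> 3 * norm c * (D * \<eta>)" .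
      have "norm (transpose (J t (X t a)) *v F c t) \<le> norm (J t (X t a)) * norm (F c t)"
        using norm_matrix_vector_mult_le[of "transpose (J t (X t a))"] by (simp add: norm_transpose del: transpose_matrix_vector)
      also have "\<dots> \<le> k * norm (F c t)"
        by (intro mult_right_mono k t) auto
      finally show ?thesis
        using 1 norm_triangle_ineq4[of "F' c t + transpose (J t (X t a)) *v F c t" "transpose (J t (X t a)) *v F c t"]
        by (simp add: mult_ac del: transpose_matrix_vector)
    qed
    \<comment> \<open>Gronwall from \<open>t0\<close> back to 0; the error, proportional to
      \<open>norm c\<close>, is absorbed on the left.\<close>
    have lower: "norm c * (1 - \<eta> * (3 * D * t0 * E)) \<le> E * norm (F c t0)" for c
    proof -
      have "norm (F c 0) \<le> exp (k * t0) * (norm (F c t0) + 3 * D * \<eta> * norm c * t0)"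
        by (rule gronwall_norm_backward) (use F_deriv F'_le t0_pos \<open>0 \<le> k\<close> \<open>0 \<le> D\<close> \<eta> in auto)
      then show ?thesis
        by (simp add: F_0 E_def algebra_simps)
    qed
    have lin: "linear (\<lambda>c. F c t0)"
      by (rule linearI) (simp_all add: F_def scaleR_add_left sum.distrib scaleR_sum_right)
    \<comment> \<open>The lower bound makes this linear map of \<open>real^3\<close> injective and
      thus surjective, so some combination arrives exactly at \<open>w\<^sub>t\<close>.\<close>
    have "inj (\<lambda>c. F c t0)"
      unfolding linear_injective_0[OF lin]
    proof safe
      fix c assume "F c t0 = 0"
      with lower[of c] have "norm c * (1 - \<eta> * (3 * D * t0 * E)) \<le> 0"
        by simp
      with \<eta>(2) show "c = 0"
        by (simp add: mult_le_0_iff)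
    qed
    then have "surj (\<lambda>c. F c t0)"
      by (rule linear_inj_imp_surj[OF lin])
    then obtain c where c: "F c t0 = w\<^sub>t"
      by (metis surjD)
    have "w\<^sub>t \<bullet> F c t0 - w\<^sub>0 \<bullet> F c 0 = (\<Sum>j\<in>UNIV. c $ j * (w\<^sub>t \<bullet> S j t0 - w\<^sub>0 \<bullet> S j 0))"
      by (simp add: F_def inner_sum_right sum_subtractf right_diff_distrib)
    also have "\<bar>\<dots>\<bar> \<le> (\<Sum>j\<in>UNIV. \<bar>c $ j\<bar> * (D * \<eta>))"
      by (intro order_trans[OF sum_abs] sum_mono) (use S_w in \<open>auto simp: abs_mult intro!: mult_left_mono\<close>)
    also have "\<dots> \<le> 3 * norm c * (D * \<eta>)"
      unfolding sum_distrib_right[symmetric] using sum_comp[of c] \<open>0 \<le> D\<close> \<eta>(1) by (intro mult_right_mono) auto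
    finally have "(norm w\<^sub>t)\<^sup>2 \<le> w\<^sub>0 \<bullet> c + 3 * norm c * (D * \<eta>)"
      by (simp add: c F_0 power2_norm_eq_inner)
    also have "\<dots> \<le> norm w\<^sub>0 * norm c + 3 * norm c * (D * \<eta>)"
      using norm_cauchy_schwarz[of w\<^sub>0 c] by simp
    also have "\<dots> = (norm w\<^sub>0 + 3 * D * \<eta>) * norm c"
      by (simp add: algebra_simps)
    finally have "(1 - \<eta> * (3 * D * t0 * E)) * (norm w\<^sub>t)\<^sup>2 \<le> (1 - \<eta> * (3 * D * t0 * E)) * ((norm w\<^sub>0 + 3 * D * \<eta>) * norm c)"
      using \<eta>(2) by (intro mult_left_mono) auto
    also have "\<dots> = (norm w\<^sub>0 + 3 * D * \<eta>) * (norm c * (1 - \<eta> * (3 * D * t0 * E)))"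
      by simp
    also have "\<dots> \<le> (norm w\<^sub>0 + 3 * D * \<eta>) * (E * norm w\<^sub>t)"
      using lower[of c] \<open>0 \<le> D\<close> \<eta>(1) unfolding c by (intro mult_left_mono) auto
    finally show ?thesis
      by (simp add: mult_ac)
  qed
  have "((\<lambda>\<eta>. E * (norm w\<^sub>0 + 3 * D * \<eta>) * norm w\<^sub>t - (1 - \<eta> * (3 * D * t0 * E)) * (norm w\<^sub>t)\<^sup>2)
     \<longlongrightarrow> E * (norm w\<^sub>0 + 3 * D * 0) * norm w\<^sub>t - (1 - 0 * (3 * D * t0 * E)) * (norm w\<^sub>t)\<^sup>2) (at_right 0)"
    by (intro tendsto_intros)
  moreover have "\<forall>\<^sub>F \<eta> in at_right 0. 0 \<le> E * (norm w\<^sub>0 + 3 * D * \<eta>) * norm w\<^sub>t - (1 - \<eta> * (3 * D * t0 * E)) * (norm w\<^sub>t)\<^sup>2"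
  proof -
    have "((\<lambda>\<eta>. \<eta> * (3 * D * t0 * E)) \<longlongrightarrow> 0 * (3 * D * t0 * E)) (at_right 0)"
      by (intro tendsto_intros)
    then have "\<forall>\<^sub>F \<eta> in at_right 0. \<eta> * (3 * D * t0 * E) < 1"
      by (rule order_tendstoD) simp
    with eventually_at_right_less[of 0] show ?thesis
      by eventually_elim (use key in simp)
  qed
  ultimately have "0 \<le> E * (norm w\<^sub>0 + 3 * D * 0) * norm w\<^sub>t - (1 - 0 * (3 * D * t0 * E)) * (norm w\<^sub>t)\<^sup>2"
    by (rule tendsto_lowerbound) simp
  then have "norm w\<^sub>t * norm w\<^sub>t \<le> E * norm w\<^sub>0 * norm w\<^sub>t"
    by (simp add: power2_eq_square)
  then have "norm w\<^sub>t \<le> E * norm w\<^sub>0"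
    by (cases "w\<^sub>t = 0") (auto simp: E_def)
  then show ?thesis
    by (simp add: w\<^sub>t_def w\<^sub>0_def E_def)
qed

end

section \<open>Inversion of the \<open>L\<^sup>2\<close> Fourier transform\<close>

lemma lborel_product_integral:
  fixes f :: "'a::euclidean_space \<Rightarrow> real \<Rightarrow> 'b::{real_normed_field,banach,second_countable_topology}"
  assumes f: "\<And>b. b \<in> Basis \<Longrightarrow> integrable lborel (f b)"
  shows "integrable lborel (\<lambda>x::'a. \<Prod>b\<in>Basis. f b (x \<bullet> b))"
    and "(\<integral>x. (\<Prod>b\<in>Basis. f b (x \<bullet> b)) \<partial>(lborel::'a measure)) = (\<Prod>b\<in>Basis. \<integral>x. f b x \<partial>lborel)"
proof -
  interpret product_sigma_finite "\<lambda>_::'a. lborel :: real measure" ..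
  have [measurable]: "b \<in> Basis \<Longrightarrow> f b \<in> borel_measurable borel" for b
    using f[of b] by (auto dest: borel_measurable_integrable)
  have meas: "(\<lambda>x::'a. \<Prod>b\<in>Basis. f b (x \<bullet> b)) \<in> borel_measurable borel"
    by measurable
  have comp: "(\<Prod>b\<in>Basis. f b ((\<Sum>b'\<in>Basis. x b' *\<^sub>R b') \<bullet> b)) = (\<Prod>b\<in>Basis. f b (x b))" for x :: "'a \<Rightarrow> real"
    by (intro prod.cong refl) simp
  have T: "(\<lambda>x. \<Sum>b\<in>Basis. x b *\<^sub>R b :: 'a) \<in> measurable (\<Pi>\<^sub>M b\<in>Basis. lborel) borel"
    by measurable
  show "integrable lborel (\<lambda>x::'a. \<Prod>b\<in>Basis. f b (x \<bullet> b))"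
    unfolding lborel_eq[where 'a='a] integrable_distr_eq[OF T meas] comp
    by (rule product_integrable_prod) (use f in auto)
  show "(\<integral>x. (\<Prod>b\<in>Basis. f b (x \<bullet> b)) \<partial>(lborel::'a measure)) = (\<Prod>b\<in>Basis. \<integral>x. f b x \<partial>lborel)"
    unfolding lborel_eq[where 'a='a] integral_distr[OF T meas] comp
    by (rule product_integral_prod) (use f in auto)
qed

lemma cis_measurable [measurable]: "cis \<in> borel_measurable borel"
  by (intro borel_measurable_continuous_onI continuous_intros)

lemma gaussian_integrable_real:
  assumes "0 < \<delta>"
  shows "integrable lborel (\<lambda>x::real. exp (- \<delta> * x\<^sup>2 / 2))"
proof -
  have "integrable lborel (\<lambda>x. sqrt (2 * pi / \<delta>) * normal_density 0 (1 / sqrt \<delta>) x)"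
    using assms by (intro integrable_mult_right integrable_normal_density) simp
  also have "(\<lambda>x. sqrt (2 * pi / \<delta>) * normal_density 0 (1 / sqrt \<delta>) x) = (\<lambda>x::real. exp (- \<delta> * x\<^sup>2 / 2))"
    using assms by (auto simp: normal_density_def power_divide real_sqrt_divide mult_ac)
  finally show ?thesis .
qed

text \<open>The characteristic function of the standard normal distribution, after the substitution
  of \<open>sqrt \<delta> * x\<close> for \<open>x\<close>.\<close>

lemma gaussian_fourier_real:
  assumes "0 < \<delta>"
  shows "(\<integral>x. of_real (exp (- \<delta> * x\<^sup>2 / 2)) * cis (z * x) \<partial>lborel) = of_real (sqrt (2 * pi / \<delta>) * exp (- z\<^sup>2 / (2 * \<delta>)))"
proof -
  define t where "t = z / sqrt \<delta>"
  have s: "sqrt \<delta> > 0" "sqrt \<delta> \<noteq> 0" using assms by auto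
  have "complex_of_real (exp (- (t^2) / 2)) = char std_normal_distribution t"
    by (simp add: char_std_normal_distribution)
  also have "\<dots> = (\<integral>x. std_normal_density x *\<^sub>R iexp (t * x) \<partial>lborel)"
    unfolding char_def by (subst integral_density) auto
  also have "\<dots> = sqrt \<delta> *\<^sub>R (\<integral>x. std_normal_density (sqrt \<delta> * x) *\<^sub>R iexp (t * (sqrt \<delta> * x)) \<partial>lborel)"
    using lborel_integral_real_affine[OF s(2), of "\<lambda>x. std_normal_density x *\<^sub>R iexp (t * x)" 0] s by simp
  also have "(\<lambda>x. std_normal_density (sqrt \<delta> * x) *\<^sub>R iexp (t * (sqrt \<delta> * x))) =
      (\<lambda>x. of_real (1 / sqrt (2 * pi)) * (of_real (exp (- \<delta> * x\<^sup>2 / 2)) * cis (z * x)))"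
    using assms s by (auto simp: std_normal_density_def t_def cis_conv_exp scaleR_conv_of_real power_mult_distrib mult_ac)
  finally have "complex_of_real (exp (- (t^2) / 2)) = of_real (sqrt \<delta> / sqrt (2 * pi)) * (\<integral>x. of_real (exp (- \<delta> * x\<^sup>2 / 2)) * cis (z * x) \<partial>lborel)"
    by (simp add: scaleR_conv_of_real)
  moreover have "t\<^sup>2 / 2 = z\<^sup>2 / (2 * \<delta>)"
    using assms by (simp add: t_def power_divide)
  ultimately have eq: "complex_of_real (exp (- z\<^sup>2 / (2 * \<delta>))) = of_real (sqrt \<delta> / sqrt (2 * pi)) * (\<integral>x. of_real (exp (- \<delta> * x\<^sup>2 / 2)) * cis (z * x) \<partial>lborel)"
    by simp
  have "of_real (sqrt (2 * pi / \<delta>) * exp (- z\<^sup>2 / (2 * \<delta>))) = complex_of_real (sqrt (2 * pi / \<delta>)) * complex_of_real (exp (- z\<^sup>2 / (2 * \<delta>)))"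
    by (rule of_real_mult)
  also have "\<dots> = of_real (sqrt (2 * pi / \<delta>) * (sqrt \<delta> / sqrt (2 * pi))) * (\<integral>x. of_real (exp (- \<delta> * x\<^sup>2 / 2)) * cis (z * x) \<partial>lborel)"
    unfolding eq of_real_mult by (simp only: mult.assoc)
  also have "sqrt (2 * pi / \<delta>) * (sqrt \<delta> / sqrt (2 * pi)) = 1"
    using s by (simp add: real_sqrt_divide)
  finally show ?thesis by simp
qed

lemma norm_power2_eq_sum_Basis: "(norm x)\<^sup>2 = (\<Sum>b\<in>Basis. (x \<bullet> b)\<^sup>2)" for x :: "'a::euclidean_space"
  unfolding power2_norm_eq_inner by (subst euclidean_inner) (simp add: power2_eq_square)

lemma gaussian_fourier:
  fixes z :: "'a::euclidean_space"
  assumes \<delta>: "0 < \<delta>"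
  shows "integrable lborel (\<lambda>x::'a. exp (- \<delta> * (norm x)\<^sup>2 / 2))"
    and "(\<integral>x. of_real (exp (- \<delta> * (norm x)\<^sup>2 / 2)) * cis (z \<bullet> x) \<partial>(lborel :: 'a measure))
       = of_real (sqrt (2 * pi / \<delta>) ^ DIM('a) * exp (- (norm z)\<^sup>2 / (2 * \<delta>)))"
proof -
  have exp_prod: "exp (- c * (norm x)\<^sup>2 / d) = (\<Prod>b\<in>Basis. exp (- c * (x \<bullet> b)\<^sup>2 / d))" for c d :: real and x :: 'a
    by (simp add: norm_power2_eq_sum_Basis exp_sum[symmetric] sum_distrib_left sum_divide_distrib sum_negf[symmetric])
  have cis_prod: "cis (z \<bullet> x) = (\<Prod>b\<in>Basis. cis ((z \<bullet> b) * (x \<bullet> b)))" for x :: 'a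
    by (subst euclidean_inner) (simp add: cis_conv_exp exp_sum[symmetric] sum_distrib_left)
  show "integrable lborel (\<lambda>x::'a. exp (- \<delta> * (norm x)\<^sup>2 / 2))"
    unfolding exp_prod by (rule lborel_product_integral(1)) (rule gaussian_integrable_real[OF \<delta>])
  have "(\<integral>x. of_real (exp (- \<delta> * (norm x)\<^sup>2 / 2)) * cis (z \<bullet> x) \<partial>(lborel :: 'a measure))
      = (\<integral>x. (\<Prod>b\<in>Basis. of_real (exp (- \<delta> * (x \<bullet> b)\<^sup>2 / 2)) * cis ((z \<bullet> b) * (x \<bullet> b))) \<partial>(lborel :: 'a measure))"
    unfolding exp_prod cis_prod of_real_prod prod.distrib ..
  also have "\<dots> = (\<Prod>b\<in>Basis. \<integral>x. of_real (exp (- \<delta> * x\<^sup>2 / 2)) * cis ((z \<bullet> b) * x) \<partial>lborel)"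
  proof (rule lborel_product_integral(2))
    fix b :: 'a
    show "integrable lborel (\<lambda>x. of_real (exp (- \<delta> * x\<^sup>2 / 2)) * cis ((z \<bullet> b) * x))"
      by (rule Bochner_Integration.integrable_bound[OF gaussian_integrable_real[OF \<delta>]])
         (auto simp: norm_mult)
  qed
  also have "\<dots> = (\<Prod>b\<in>Basis. of_real (sqrt (2 * pi / \<delta>) * exp (- (z \<bullet> b)\<^sup>2 / (2 * \<delta>))))"
    by (simp only: gaussian_fourier_real[OF \<delta>])
  also have "\<dots> = of_real (sqrt (2 * pi / \<delta>) ^ DIM('a) * exp (- (norm z)\<^sup>2 / (2 * \<delta>)))"
    using exp_prod[of 1 z "2 * \<delta>"] by (simp add: prod.distrib)
  finally show "(\<integral>x. of_real (exp (- \<delta> * (norm x)\<^sup>2 / 2)) * cis (z \<bullet> x) \<partial>(lborel :: 'a measure))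
       = of_real (sqrt (2 * pi / \<delta>) ^ DIM('a) * exp (- (norm z)\<^sup>2 / (2 * \<delta>)))" .
qed

section \<open>Pairings of square integrable functions\<close>

lemma integrable_mult_square_integrable:
  fixes f g :: "'a \<Rightarrow> 'b::{real_normed_algebra,second_countable_topology,banach}"
  assumes [measurable]: "f \<in> borel_measurable M" "g \<in> borel_measurable M"
    and "integrable M (\<lambda>x. (norm (f x))\<^sup>2)" "integrable M (\<lambda>x. (norm (g x))\<^sup>2)"
  shows "integrable M (\<lambda>x. f x * g x)"
proof (rule Bochner_Integration.integrable_bound)
  show "integrable M (\<lambda>x. (norm (f x))\<^sup>2 + (norm (g x))\<^sup>2)"
    using assms by simp
  have "norm (f x * g x) \<le> (norm (f x))\<^sup>2 + (norm (g x))\<^sup>2" for x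
  proof -
    have "norm (f x * g x) \<le> norm (f x) * norm (g x)"
      by (rule norm_mult_ineq)
    also have "\<dots> \<le> (norm (f x))\<^sup>2 + (norm (g x))\<^sup>2"
      using zero_le_power2[of "norm (f x) - norm (g x)"] mult_nonneg_nonneg[OF norm_ge_zero norm_ge_zero, of "f x" "g x"]
      unfolding power2_diff by linarith
    finally show ?thesis .
  qed
  then show "AE x in M. norm (f x * g x) \<le> norm ((norm (f x))\<^sup>2 + (norm (g x))\<^sup>2)"
    by simp
qed measurable

text \<open>Cauchy-Schwarz is applied in \<open>ennreal\<close> because the distance of
  \<open>F n\<close> to \<open>g\<close> is not known to be finite for each \<open>n\<close>.
  Finiteness of \<open>G\<close> then lets the product tend to 0.\<close>

lemma tendsto_integral_mult_L2:
  fixes F :: "nat \<Rightarrow> 'a \<Rightarrow> complex"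
  assumes [measurable]: "\<And>n. F n \<in> borel_measurable M" "g \<in> borel_measurable M" "\<phi> \<in> borel_measurable M"
    and lim: "(\<lambda>n. \<integral>\<^sup>+x. ennreal ((cmod (F n x - g x))\<^sup>2) \<partial>M) \<longlonglongrightarrow> 0"
    and \<phi>: "integrable M (\<lambda>x. (cmod (\<phi> x))\<^sup>2)"
    and intF: "\<And>n. integrable M (\<lambda>x. F n x * \<phi> x)" and intg: "integrable M (\<lambda>x. g x * \<phi> x)"
  shows "(\<lambda>n. \<integral>x. F n x * \<phi> x \<partial>M) \<longlonglongrightarrow> (\<integral>x. g x * \<phi> x \<partial>M)"
proof -
  define G where "G = (\<integral>\<^sup>+x. ennreal ((cmod (\<phi> x))\<^sup>2) \<partial>M)"
  have "G < \<infinity>"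
    using \<phi> unfolding G_def integrable_iff_bounded by simp
  have upper: "ennreal ((cmod ((\<integral>x. F n x * \<phi> x \<partial>M) - (\<integral>x. g x * \<phi> x \<partial>M)))\<^sup>2)
     \<le> G * (\<integral>\<^sup>+x. ennreal ((cmod (F n x - g x))\<^sup>2) \<partial>M)" for n
  proof -
    have "(\<integral>x. F n x * \<phi> x \<partial>M) - (\<integral>x. g x * \<phi> x \<partial>M) = (\<integral>x. (F n x - g x) * \<phi> x \<partial>M)"
      using intF intg by (simp add: left_diff_distrib)
    moreover have "integrable M (\<lambda>x. (F n x - g x) * \<phi> x)"
      using intF intg by (simp add: left_diff_distrib)
    ultimately have "ennreal (cmod ((\<integral>x. F n x * \<phi> x \<partial>M) - (\<integral>x. g x * \<phi> x \<partial>M)))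
      \<le> (\<integral>\<^sup>+x. ennreal (cmod (F n x - g x)) * ennreal (cmod (\<phi> x)) \<partial>M)"
      using integral_norm_bound_ennreal[of M "\<lambda>x. (F n x - g x) * \<phi> x"]
      by (simp add: norm_mult ennreal_mult)
    then have "(ennreal (cmod ((\<integral>x. F n x * \<phi> x \<partial>M) - (\<integral>x. g x * \<phi> x \<partial>M))))\<^sup>2
      \<le> (\<integral>\<^sup>+x. ennreal (cmod (F n x - g x)) * ennreal (cmod (\<phi> x)) \<partial>M)\<^sup>2"
      by (rule power_mono) simp
    also have "\<dots> \<le> (\<integral>\<^sup>+x. (ennreal (cmod (F n x - g x)))\<^sup>2 \<partial>M) * (\<integral>\<^sup>+x. (ennreal (cmod (\<phi> x)))\<^sup>2 \<partial>M)"
      by (rule Cauchy_Schwarz_nn_integral) auto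
    finally show ?thesis
      by (simp add: ennreal_power G_def mult.commute)
  qed
  have limG: "(\<lambda>n. G * (\<integral>\<^sup>+x. ennreal ((cmod (F n x - g x))\<^sup>2) \<partial>M)) \<longlonglongrightarrow> 0"
    using ennreal_tendsto_cmult[OF _ lim, of G] \<open>G < \<infinity>\<close> by simp
  then have "(\<lambda>n. ennreal ((cmod ((\<integral>x. F n x * \<phi> x \<partial>M) - (\<integral>x. g x * \<phi> x \<partial>M)))\<^sup>2)) \<longlonglongrightarrow> 0"
    by (intro tendsto_sandwich[OF _ _ tendsto_const limG]) (simp_all add: upper)
  then have "(\<lambda>n. (cmod ((\<integral>x. F n x * \<phi> x \<partial>M) - (\<integral>x. g x * \<phi> x \<partial>M)))\<^sup>2) \<longlonglongrightarrow> 0"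
    by (subst (asm) ennreal_tendsto_0_iff) auto
  then have "(\<lambda>n. sqrt ((cmod ((\<integral>x. F n x * \<phi> x \<partial>M) - (\<integral>x. g x * \<phi> x \<partial>M)))\<^sup>2)) \<longlonglongrightarrow> sqrt 0"
    by (rule tendsto_real_sqrt)
  then show ?thesis
    by (simp add: LIM_zero_iff tendsto_norm_zero_iff)
qed

section \<open>Gaussian kernels as an approximate identity\<close>

lemma lborel_shift:
  fixes h :: "'a::euclidean_space \<Rightarrow> 'b::{banach,second_countable_topology}"
  assumes "integrable lborel h"
  shows "integrable lborel (\<lambda>y. h (y - x))" and "(\<integral>y. h (y - x) \<partial>lborel) = (\<integral>y. h y \<partial>lborel)"
proof -
  have [measurable]: "h \<in> borel_measurable borel"
    using assms by (auto dest: borel_measurable_integrable)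
  have T: "(+) (- x) \<in> measurable lborel borel"
    by measurable
  have eq: "lborel = distr lborel borel ((+) (- x))"
    by (rule lborel_distr_plus[symmetric])
  have "integrable (distr lborel borel ((+) (- x))) h"
    using assms by (simp add: lborel_distr_plus)
  then show "integrable lborel (\<lambda>y. h (y - x))"
    by (subst (asm) integrable_distr_eq[OF T]) simp_all
  have "integral\<^sup>L lborel h = integral\<^sup>L (distr lborel borel ((+) (- x))) h"
    by (simp add: lborel_distr_plus)
  also have "\<dots> = (\<integral>y. h (y - x) \<partial>lborel)"
    by (subst integral_distr[OF T]) simp_all
  finally show "(\<integral>y. h (y - x) \<partial>lborel) = (\<integral>y. h y \<partial>lborel)" ..
qed

text \<open>The Fourier transform of \<open>exp (- \<delta> * (norm \<xi>)\<^sup>2 / 2)\<close> in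
  dimension three. It has mass \<open>(2 * pi) ^ 3\<close>, matching the transform, which carries no
  normalizing factor.\<close>

definition gauss_kernel :: "real \<Rightarrow> real^3 \<Rightarrow> real" where
  "gauss_kernel \<delta> z = sqrt (2 * pi / \<delta>) ^ 3 * exp (- (norm z)\<^sup>2 / (2 * \<delta>))"

lemma gauss_kernel_pos: "0 < \<delta> \<Longrightarrow> 0 < gauss_kernel \<delta> z"
  by (simp add: gauss_kernel_def)

lemma gauss_kernel_measurable [measurable]: "gauss_kernel \<delta> \<in> borel_measurable borel"
  unfolding gauss_kernel_def[abs_def] by measurable

lemma integrable_gauss_kernel:
  assumes "0 < \<delta>" shows "integrable lborel (gauss_kernel \<delta>)"
  using gaussian_fourier(1)[of "1 / \<delta>", where 'a = "real^3"] assms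
  by (simp add: gauss_kernel_def[abs_def] mult.commute)

lemma integral_gauss_kernel:
  assumes "0 < \<delta>" shows "(\<integral>z. gauss_kernel \<delta> z \<partial>lborel) = (2 * pi) ^ 3"
proof -
  have "complex_of_real (\<integral>z. exp (- (norm z)\<^sup>2 / (2 * \<delta>)) \<partial>(lborel :: (real^3) measure)) = of_real (sqrt (2 * pi * \<delta>) ^ 3)"
    using gaussian_fourier(2)[of "1 / \<delta>" "0 :: real^3"] assms by (simp add: mult.commute flip: integral_complex_of_real)
  then have "(\<integral>z. exp (- (norm z)\<^sup>2 / (2 * \<delta>)) \<partial>(lborel :: (real^3) measure)) = sqrt (2 * pi * \<delta>) ^ 3"
    by (simp only: of_real_eq_iff)
  then have "(\<integral>z. gauss_kernel \<delta> z \<partial>lborel) = (sqrt (2 * pi / \<delta>) * sqrt (2 * pi * \<delta>)) ^ 3"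
    by (simp add: gauss_kernel_def power_mult_distrib)
  also have "sqrt (2 * pi / \<delta>) * sqrt (2 * pi * \<delta>) = 2 * pi"
  proof -
    have "(2 * pi / \<delta>) * (2 * pi * \<delta>) = (2 * pi)\<^sup>2"
      using assms by (simp add: power2_eq_square)
    then show ?thesis
      by (simp only: real_sqrt_mult[symmetric] real_sqrt_abs) simp
  qed
  finally show ?thesis .
qed

lemma integrable_gauss_kernel_square:
  assumes "0 < \<delta>" shows "integrable lborel (\<lambda>z. (gauss_kernel \<delta> z)\<^sup>2)"
proof (rule Bochner_Integration.integrable_bound)
  show "integrable lborel (\<lambda>z. sqrt (2 * pi / \<delta>) ^ 3 * gauss_kernel \<delta> z)"
    using integrable_gauss_kernel[OF assms] by simp
  have "gauss_kernel \<delta> z \<le> sqrt (2 * pi / \<delta>) ^ 3" for z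
    unfolding gauss_kernel_def using assms by (intro mult_right_le_one_le) auto
  then have "norm ((gauss_kernel \<delta> z)\<^sup>2) \<le> sqrt (2 * pi / \<delta>) ^ 3 * gauss_kernel \<delta> z" for z
    using gauss_kernel_pos[OF assms, of z] by (simp add: power2_eq_square mult_right_mono)
  then show "AE z in lborel. norm ((gauss_kernel \<delta> z)\<^sup>2) \<le> norm (sqrt (2 * pi / \<delta>) ^ 3 * gauss_kernel \<delta> z)"
    by (intro AE_I2) (simp only: real_norm_def order_trans[OF _ abs_ge_self])
qed measurable

lemma integrable_mult_gauss_kernel:
  fixes f :: "real^3 \<Rightarrow> real"
  assumes [measurable]: "f \<in> borel_measurable borel" and "integrable lborel (\<lambda>y. (f y)\<^sup>2)" "0 < \<delta>"
  shows "integrable lborel (\<lambda>y. f y * gauss_kernel \<delta> (y - x))"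
  by (rule integrable_mult_square_integrable)
     (use assms lborel_shift(1)[OF integrable_gauss_kernel_square[OF \<open>0 < \<delta>\<close>]] in auto)

text \<open>\<open>f\<close> may be unbounded away from \<open>x\<close>, so concentration of the
  mass does not by itself control the far part. That part is handled by dominated convergence, with
  a majorant built from \<open>f\<close> and one fixed Gaussian.\<close>

lemma gauss_approximate_identity:
  fixes f :: "real^3 \<Rightarrow> real"
  assumes [measurable]: "f \<in> borel_measurable borel" and f2: "integrable lborel (\<lambda>y. (f y)\<^sup>2)" and cont: "isCont f x"
  shows "(\<lambda>n. \<integral>y. f y * gauss_kernel (1 / real (Suc n)) (y - x) \<partial>lborel) \<longlonglongrightarrow> (2 * pi) ^ 3 * f x"
proof (rule tendstoI)
  fix e :: real assume "0 < e"
  define W where "W n y = gauss_kernel (1 / real (Suc n)) (y - x)" for n y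
  have W_pos: "0 < W n y" for n y
    unfolding W_def by (rule gauss_kernel_pos) simp
  have [measurable]: "W n \<in> borel_measurable borel" for n
    unfolding W_def[abs_def] by measurable
  have W_int: "integrable lborel (W n)" "(\<integral>y. W n y \<partial>lborel) = (2 * pi) ^ 3" for n
    using lborel_shift[OF integrable_gauss_kernel, of "1 / real (Suc n)" x]
    by (simp_all add: W_def[abs_def] integral_gauss_kernel)
  have fW_int: "integrable lborel (\<lambda>y. f y * W n y)" for n
    unfolding W_def by (rule integrable_mult_gauss_kernel) (use f2 in auto)
  have diff_int: "integrable lborel (\<lambda>y. (f y - f x) * W n y)" for n
    unfolding left_diff_distrib using fW_int W_int by simp
  \<comment> \<open>The kernel has mass \<open>(2 * pi) ^ 3\<close>, so the part near
    \<open>x\<close> contributes at most \<open>e / 2\<close>.\<close>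
  define \<epsilon> where "\<epsilon> = e / (2 * (2 * pi) ^ 3)"
  have "0 < \<epsilon>" using \<open>0 < e\<close> by (simp add: \<epsilon>_def)
  then obtain r where "0 < r" and r: "\<And>y. norm (y - x) < r \<Longrightarrow> \<bar>f y - f x\<bar> < \<epsilon>"
    using cont unfolding continuous_at_eps_delta dist_norm by (metis real_norm_def)
  define H where "H n y = indicator {y. r \<le> norm (y - x)} y * (\<bar>f y - f x\<bar> * W n y)" for n y
  have [measurable]: "H n \<in> borel_measurable borel" for n
    unfolding H_def[abs_def] by measurable
  have "(\<lambda>n. \<integral>y. H n y \<partial>lborel) \<longlonglongrightarrow> (\<integral>y. 0 \<partial>(lborel :: (real^3) measure))"
  proof (rule integral_dominated_convergence)
    \<comment> \<open>The exponent \<open>s * Q / 2\<close> is split in halves, where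
      \<open>s = real (Suc n)\<close> and \<open>Q\<close> is the squared distance to
      \<open>x\<close>. Outside radius \<open>r\<close> one half is at least \<open>c * s\<close>,
      which pays for the growing prefactor \<open>sqrt s ^ 3\<close>; the other is at least
      \<open>Q / 4\<close> and leaves a Gaussian independent of \<open>n\<close>.\<close>
    define c where "c = r\<^sup>2 / 4"
    define B where "B = sqrt (2 * pi) ^ 3 * (2 / c\<^sup>2)"
    have "0 < c" using \<open>0 < r\<close> by (simp add: c_def)
    define G where "G y = B / sqrt (pi) ^ 3 * gauss_kernel 2 (y - x)" for y
    have G_eq: "G y = B * exp (- (norm (y - x))\<^sup>2 / 4)" for y
      by (simp add: G_def gauss_kernel_def)
    show "integrable lborel (\<lambda>y. (\<bar>f y\<bar> + \<bar>f x\<bar>) * G y)"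
      unfolding distrib_right G_def
      using integrable_mult_gauss_kernel[of "\<lambda>y. \<bar>f y\<bar>" 2 x] f2 lborel_shift(1)[OF integrable_gauss_kernel[of 2], of x]
      by (auto simp: mult_ac intro!: Bochner_Integration.integrable_add) 
    have W_le: "W n y \<le> G y" if "r \<le> norm (y - x)" for n y
    proof -
      define s where "s = real (Suc n)"
      have "1 \<le> s" by (simp add: s_def)
      define Q where "Q = (norm (y - x))\<^sup>2"
      have "r\<^sup>2 \<le> Q"
        unfolding Q_def using that \<open>0 < r\<close> by (intro power_mono) auto
      have "sqrt s ^ 3 \<le> sqrt s ^ 4"
        using \<open>1 \<le> s\<close> by (intro power_increasing) auto
      also have "sqrt s ^ 4 = (sqrt s ^ 2)\<^sup>2"
        by (simp flip: power_mult)
      also have "\<dots> = s\<^sup>2"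
        using \<open>1 \<le> s\<close> by simp
      also have "s\<^sup>2 \<le> 2 / c\<^sup>2 * exp (c * s)"
      proof -
        have "(c * s)\<^sup>2 / 2 \<le> exp (c * s)"
          using exp_lower_Taylor_quadratic[of "c * s"] \<open>0 < c\<close> \<open>1 \<le> s\<close> by (smt (verit) mult_nonneg_nonneg)
        then show ?thesis
          using \<open>0 < c\<close> by (simp add: field_simps power_mult_distrib)
      qed
      finally have s_le: "sqrt s ^ 3 \<le> 2 / c\<^sup>2 * exp (c * s)" .
      have "W n y = sqrt (2 * pi) ^ 3 * (sqrt s ^ 3 * exp (- s * Q / 2))"
      proof -
        have "W n y = sqrt (2 * pi / (1 / s)) ^ 3 * exp (- Q / (2 * (1 / s)))"
          by (simp only: W_def gauss_kernel_def s_def Q_def)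
        then show ?thesis
          by (simp add: real_sqrt_mult power_mult_distrib mult_ac)
      qed
      also have "\<dots> \<le> sqrt (2 * pi) ^ 3 * (2 / c\<^sup>2 * exp (c * s) * exp (- s * Q / 2))"
        using s_le by (intro mult_left_mono mult_right_mono) auto
      also have "\<dots> = B * exp (c * s - s * Q / 2)"
      proof -
        have "exp (c * s - s * Q / 2) = exp (c * s) * exp (- s * Q / 2)"
          by (simp flip: exp_add)
        then show ?thesis by (simp add: B_def)
      qed
      also have "\<dots> \<le> B * exp (- Q / 4)"
      proof -
        have "s * r\<^sup>2 \<le> s * Q" "1 * Q \<le> s * Q"
          using \<open>r\<^sup>2 \<le> Q\<close> \<open>1 \<le> s\<close> by (intro mult_left_mono mult_right_mono; simp add: Q_def)+
        then have "c * s - s * Q / 2 \<le> - Q / 4"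
          by (simp add: c_def mult.commute)
        then show ?thesis
          by (intro mult_left_mono) (auto simp: B_def)
      qed
      finally show ?thesis by (simp add: G_eq Q_def)
    qed
    show "AE y in lborel. norm (H n y) \<le> (\<bar>f y\<bar> + \<bar>f x\<bar>) * G y" for n
    proof (rule AE_I2)
      fix y
      have "0 \<le> G y" by (simp add: G_eq B_def)
      moreover have "\<bar>f y - f x\<bar> * W n y \<le> (\<bar>f y\<bar> + \<bar>f x\<bar>) * G y" if "r \<le> norm (y - x)"
        using W_le[OF that, of n] W_pos[of n y] by (intro mult_mono) auto
      ultimately show "norm (H n y) \<le> (\<bar>f y\<bar> + \<bar>f x\<bar>) * G y"
        using W_pos[of n y] by (auto simp: H_def indicator_def abs_mult)
    qed
    show "AE y in lborel. (\<lambda>n. H n y) \<longlonglongrightarrow> 0"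
    proof (rule AE_I2)
      fix y
      show "(\<lambda>n. H n y) \<longlonglongrightarrow> 0"
      proof (cases "r \<le> norm (y - x)")
        case True
        define Q where "Q = (norm (y - x))\<^sup>2"
        have "0 < Q" using True \<open>0 < r\<close> by (auto simp: Q_def)
        then have "(\<lambda>n. \<bar>f y - f x\<bar> * (sqrt (2 * pi / (1 / real (Suc n))) ^ 3 * exp (- Q / (2 * (1 / real (Suc n)))))) \<longlonglongrightarrow> \<bar>f y - f x\<bar> * 0"
          by (intro tendsto_mult tendsto_const) real_asymp
        then show ?thesis
          using True by (simp add: H_def W_def gauss_kernel_def Q_def)
      qed (simp add: H_def)
    qed
  qed measurable
  then have "\<forall>\<^sub>F n in sequentially. (\<integral>y. H n y \<partial>lborel) < e / 2"
    using \<open>0 < e\<close> by (intro order_tendstoD(2)[of _ "0::real"]) auto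
  then show "\<forall>\<^sub>F n in sequentially. dist (\<integral>y. f y * gauss_kernel (1 / real (Suc n)) (y - x) \<partial>lborel) ((2 * pi) ^ 3 * f x) < e"
  proof eventually_elim
    case (elim n)
    have H_int: "integrable lborel (H n)"
    proof (rule Bochner_Integration.integrable_bound[OF diff_int[of n]])
      show "AE y in lborel. norm (H n y) \<le> norm ((f y - f x) * W n y)"
        by (intro AE_I2) (auto simp: H_def indicator_def abs_mult)
    qed measurable
    have "(\<integral>y. f y * W n y \<partial>lborel) - (2 * pi) ^ 3 * f x = (\<integral>y. (f y - f x) * W n y \<partial>lborel)"
      unfolding left_diff_distrib using fW_int W_int by simp
    also have "\<bar>\<dots>\<bar> \<le> (\<integral>y. \<bar>(f y - f x) * W n y\<bar> \<partial>lborel)"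
      by (rule integral_abs_bound)
    also have "\<dots> \<le> (\<integral>y. \<epsilon> * W n y + H n y \<partial>lborel)"
    proof (rule integral_mono)
      show "integrable lborel (\<lambda>y. \<bar>(f y - f x) * W n y\<bar>)" "integrable lborel (\<lambda>y. \<epsilon> * W n y + H n y)"
        using diff_int[of n] W_int H_int by auto
      fix y
      show "\<bar>(f y - f x) * W n y\<bar> \<le> \<epsilon> * W n y + H n y"
        using r[of y] W_pos[of n y] \<open>0 < \<epsilon>\<close>
        by (cases "r \<le> norm (y - x)") (auto simp: H_def abs_mult not_le intro: mult_right_mono)
    qed
    also have "\<dots> = \<epsilon> * (2 * pi) ^ 3 + (\<integral>y. H n y \<partial>lborel)"
      using W_int H_int by simp
    also have "\<dots> < e"
      using elim by (simp add: \<epsilon>_def)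
    finally show ?case
      by (simp add: W_def dist_real_def)
  qed
qed

text \<open>The multiplication formula, which moves the transform from \<open>f\<close> to a
  modulated Gaussian. Fubini's theorem is applied to \<open>f\<close> cut off to balls, where
  \<open>f\<close> is integrable. The cutoff is then removed by convergence in L2 on the left and by
  dominated convergence on the right.\<close>

lemma L2_fourier_gauss_pairing:
  assumes L2: "is_L2_fourier f g" and \<delta>: "0 < \<delta>"
  shows "(\<integral>\<xi>. g \<xi> * (of_real (exp (- \<delta> * (norm \<xi>)\<^sup>2 / 2)) * cis (x \<bullet> \<xi>)) \<partial>lborel)
    = of_real (\<integral>y. f y * gauss_kernel \<delta> (y - x) \<partial>lborel)"
proof -
  have [measurable]: "f \<in> borel_measurable borel" "g \<in> borel_measurable borel"
    and f2: "integrable lborel (\<lambda>x. (f x)\<^sup>2)" and g2: "integrable lborel (\<lambda>\<xi>. (cmod (g \<xi>))\<^sup>2)"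
    and lim: "((\<lambda>R::real. \<integral>\<^sup>+\<xi>. ennreal ((cmod
          ((LINT x:ball 0 R|lborel. cis (- (x \<bullet> \<xi>)) * complex_of_real (f x)) - g \<xi>))\<^sup>2) \<partial>lborel) \<longlongrightarrow> 0) at_top"
    using L2 by (auto simp: is_L2_fourier_def)
  define E where "E \<xi> = exp (- \<delta> * (norm \<xi>)\<^sup>2 / 2)" for \<xi> :: "real^3"
  have [measurable]: "E \<in> borel_measurable borel"
    unfolding E_def[abs_def] by measurable
  define \<phi> where "\<phi> \<xi> = of_real (E \<xi>) * cis (x \<bullet> \<xi>)" for \<xi>
  have [measurable]: "\<phi> \<in> borel_measurable borel"
    unfolding \<phi>_def[abs_def] by measurable
  have \<phi>_norm: "cmod (\<phi> \<xi>) = E \<xi>" for \<xi>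
    by (simp add: \<phi>_def norm_mult E_def)
  have E_int: "integrable lborel E"
    unfolding E_def[abs_def] by (rule gaussian_fourier(1)[OF \<delta>])
  have E2_int: "integrable lborel (\<lambda>\<xi>. (E \<xi>)\<^sup>2)"
  proof -
    have "(E \<xi>)\<^sup>2 = exp (- (2 * \<delta>) * (norm \<xi>)\<^sup>2 / 2)" for \<xi>
      by (simp add: E_def flip: exp_double)
    then show ?thesis
      using gaussian_fourier(1)[of "2 * \<delta>", where 'a = "real^3"] \<delta> by simp
  qed
  have [measurable]: "ball (0 :: real^3) R \<in> sets borel" for R
    by simp
  define fn where "fn n y = indicator (ball 0 (real n)) y * f y" for n y
  have [measurable]: "fn n \<in> borel_measurable borel" for n
    unfolding fn_def[abs_def] by measurable
  have fn_int: "integrable lborel (fn n)" for n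
    unfolding fn_def
  proof (rule integrable_mult_square_integrable)
    have "integrable lborel (indicator (ball 0 (real n)) :: real^3 \<Rightarrow> real)"
      by (intro integrable_real_indicator) (use emeasure_lborel_ball_finite in auto)
    moreover have "(norm (indicator (ball 0 (real n)) y :: real))\<^sup>2 = indicator (ball 0 (real n)) y" for y :: "real^3"
      by (simp add: indicator_def)
    ultimately show "integrable lborel (\<lambda>y :: real^3. (norm (indicator (ball 0 (real n)) y :: real))\<^sup>2)"
      by simp
  qed (use f2 in auto)
  define F where "F n \<xi> = (\<integral>y. cis (- (y \<bullet> \<xi>)) * of_real (fn n y) \<partial>lborel)" for n \<xi>
  have F_eq: "(LINT x:ball 0 (real n)|lborel. cis (- (x \<bullet> \<xi>)) * complex_of_real (f x)) = F n \<xi>" for n \<xi>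
    unfolding set_lebesgue_integral_def F_def fn_def
    by (intro Bochner_Integration.integral_cong) (auto simp: indicator_def)
  have [measurable]: "F n \<in> borel_measurable borel" for n
    unfolding F_def[abs_def] by measurable
  have F_bound: "cmod (F n \<xi>) \<le> (\<integral>y. \<bar>fn n y\<bar> \<partial>lborel)" for n \<xi>
    unfolding F_def by (rule order_trans[OF integral_norm_bound]) (simp add: norm_mult)
  have F\<phi>_int: "integrable lborel (\<lambda>\<xi>. F n \<xi> * \<phi> \<xi>)" for n
  proof (rule Bochner_Integration.integrable_bound)
    show "integrable lborel (\<lambda>\<xi>. (\<integral>y. \<bar>fn n y\<bar> \<partial>lborel) * E \<xi>)"
      using E_int by simp
    show "AE \<xi> in lborel. norm (F n \<xi> * \<phi> \<xi>) \<le> norm ((\<integral>y. \<bar>fn n y\<bar> \<partial>lborel) * E \<xi>)"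
      using F_bound[of n] order_trans[OF norm_ge_zero F_bound[of n]]
      by (intro AE_I2) (auto simp: norm_mult \<phi>_norm E_def intro!: mult_right_mono)
  qed measurable
  have g\<phi>_int: "integrable lborel (\<lambda>\<xi>. g \<xi> * \<phi> \<xi>)"
    by (rule integrable_mult_square_integrable) (use g2 E2_int in \<open>auto simp: \<phi>_norm\<close>)
  have F_eq2: "(\<integral>\<xi>. F n \<xi> * \<phi> \<xi> \<partial>lborel) = of_real (\<integral>y. fn n y * gauss_kernel \<delta> (y - x) \<partial>lborel)" for n
  proof -
    define k where "k \<xi> y = of_real (fn n y) * (of_real (E \<xi>) * cis ((x - y) \<bullet> \<xi>))" for \<xi> y :: "real^3"
    have k_meas [measurable]: "case_prod k \<in> borel_measurable (lborel \<Otimes>\<^sub>M lborel)"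
      unfolding k_def by measurable
    have k_int: "integrable (lborel \<Otimes>\<^sub>M lborel) (case_prod k)"
    proof (rule lborel_pair.Fubini_integrable[OF k_meas])
      have "(\<integral>y. norm (case_prod k (\<xi>, y)) \<partial>lborel) = (\<integral>y. \<bar>fn n y\<bar> \<partial>lborel) * E \<xi>" for \<xi>
        by (simp add: k_def norm_mult E_def)
      then show "integrable lborel (\<lambda>\<xi>. \<integral>y. norm (case_prod k (\<xi>, y)) \<partial>lborel)"
        using E_int by simp
      show "AE \<xi> in lborel. integrable lborel (\<lambda>y. case_prod k (\<xi>, y))"
      proof (rule AE_I2)
        fix \<xi>
        show "integrable lborel (\<lambda>y. case_prod k (\<xi>, y))"
        proof (rule Bochner_Integration.integrable_bound)
          show "integrable lborel (\<lambda>y. E \<xi> * fn n y)"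
            using fn_int by simp
        qed (auto simp: k_def norm_mult abs_mult)
      qed
    qed
    have "F n \<xi> * \<phi> \<xi> = (\<integral>y. k \<xi> y \<partial>lborel)" for \<xi>
    proof -
      have "F n \<xi> * \<phi> \<xi> = (\<integral>y. cis (- (y \<bullet> \<xi>)) * of_real (fn n y) * \<phi> \<xi> \<partial>lborel)"
        unfolding F_def by simp
      also have "\<dots> = (\<integral>y. k \<xi> y \<partial>lborel)"
        by (simp add: k_def \<phi>_def inner_diff_left cis_mult mult_ac flip: cis_divide)
      finally show ?thesis .
    qed
    then have "(\<integral>\<xi>. F n \<xi> * \<phi> \<xi> \<partial>lborel) = (\<integral>\<xi>. \<integral>y. k \<xi> y \<partial>lborel \<partial>lborel)"
      by simp
    also have "\<dots> = (\<integral>y. \<integral>\<xi>. k \<xi> y \<partial>lborel \<partial>lborel)"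
      by (rule lborel_pair.Fubini_integral[OF k_int, symmetric])
    also have "\<dots> = (\<integral>y. of_real (fn n y * gauss_kernel \<delta> (y - x)) \<partial>lborel)"
      unfolding k_def E_def integral_mult_right_zero gaussian_fourier(2)[OF \<delta>]
      by (simp add: gauss_kernel_def norm_minus_commute)
    also have "\<dots> = of_real (\<integral>y. fn n y * gauss_kernel \<delta> (y - x) \<partial>lborel)"
      by (rule integral_complex_of_real)
    finally show ?thesis .
  qed
  have "(\<lambda>n. \<integral>\<xi>. F n \<xi> * \<phi> \<xi> \<partial>lborel) \<longlonglongrightarrow> (\<integral>\<xi>. g \<xi> * \<phi> \<xi> \<partial>lborel)"
  proof (rule tendsto_integral_mult_L2)
    show "(\<lambda>n. \<integral>\<^sup>+ \<xi>. ennreal ((cmod (F n \<xi> - g \<xi>))\<^sup>2) \<partial>lborel) \<longlonglongrightarrow> 0"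
      using filterlim_compose[OF lim filterlim_real_sequentially] by (simp add: F_eq)
  qed (use F\<phi>_int g\<phi>_int E2_int in \<open>auto simp: \<phi>_norm\<close>)
  moreover have "(\<lambda>n. complex_of_real (\<integral>y. fn n y * gauss_kernel \<delta> (y - x) \<partial>lborel)) \<longlonglongrightarrow> of_real (\<integral>y. f y * gauss_kernel \<delta> (y - x) \<partial>lborel)"
  proof (intro tendsto_of_real integral_dominated_convergence)
    show "integrable lborel (\<lambda>y. \<bar>f y * gauss_kernel \<delta> (y - x)\<bar>)"
      by (intro integrable_abs integrable_mult_gauss_kernel f2 \<delta>) measurable
    show "AE y in lborel. (\<lambda>n. fn n y * gauss_kernel \<delta> (y - x)) \<longlonglongrightarrow> f y * gauss_kernel \<delta> (y - x)"
    proof (rule AE_I2)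
      fix y :: "real^3"
      obtain N :: nat where "norm y < real N"
        using reals_Archimedean2 by blast
      then have "\<forall>\<^sub>F n in sequentially. fn n y * gauss_kernel \<delta> (y - x) = f y * gauss_kernel \<delta> (y - x)"
        by (intro eventually_sequentiallyI[of N]) (auto simp: fn_def)
      then show "(\<lambda>n. fn n y * gauss_kernel \<delta> (y - x)) \<longlonglongrightarrow> f y * gauss_kernel \<delta> (y - x)"
        by (rule tendsto_eventually)
    qed
    show "AE y in lborel. norm (fn n y * gauss_kernel \<delta> (y - x)) \<le> \<bar>f y * gauss_kernel \<delta> (y - x)\<bar>" for n
      by (intro AE_I2) (auto simp: fn_def indicator_def)
  qed measurable
  ultimately have "(\<integral>\<xi>. g \<xi> * \<phi> \<xi> \<partial>lborel) = of_real (\<integral>y. f y * gauss_kernel \<delta> (y - x) \<partial>lborel)"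
    unfolding F_eq2 by (rule LIMSEQ_unique)
  then show ?thesis
    by (simp add: \<phi>_def E_def)
qed

text \<open>Gaussian summation: the damped inverse integral is an average of \<open>f\<close> around
  \<open>x\<close>, and integrability of \<open>g\<close> allows the damping to be removed.\<close>

lemma L2_fourier_inversion:
  assumes L2: "is_L2_fourier f g" and g: "integrable lborel g" and cont: "isCont f x"
  shows "of_real ((2 * pi) ^ 3 * f x) = (\<integral>\<xi>. g \<xi> * cis (x \<bullet> \<xi>) \<partial>lborel)"
proof -
  have [measurable]: "f \<in> borel_measurable borel" "g \<in> borel_measurable borel"
    and f2: "integrable lborel (\<lambda>x. (f x)\<^sup>2)"
    using L2 by (auto simp: is_L2_fourier_def)
  have "(\<lambda>n. \<integral>\<xi>. g \<xi> * (of_real (exp (- (1 / real (Suc n)) * (norm \<xi>)\<^sup>2 / 2)) * cis (x \<bullet> \<xi>)) \<partial>lborel)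
    \<longlonglongrightarrow> (\<integral>\<xi>. g \<xi> * cis (x \<bullet> \<xi>) \<partial>lborel)"
  proof (rule integral_dominated_convergence)
    show "integrable lborel (\<lambda>\<xi>. cmod (g \<xi>))"
      using g by simp
    show "AE \<xi> in lborel. (\<lambda>n. g \<xi> * (of_real (exp (- (1 / real (Suc n)) * (norm \<xi>)\<^sup>2 / 2)) * cis (x \<bullet> \<xi>)))
      \<longlonglongrightarrow> g \<xi> * cis (x \<bullet> \<xi>)"
    proof (rule AE_I2)
      fix \<xi> :: "real^3"
      have "(\<lambda>n. exp (- (1 / real (Suc n)) * (norm \<xi>)\<^sup>2 / 2)) \<longlonglongrightarrow> exp (- 0 * (norm \<xi>)\<^sup>2 / 2)"
        by (intro tendsto_intros LIMSEQ_Suc[OF lim_1_over_n]) auto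
      then have "(\<lambda>n. g \<xi> * (of_real (exp (- (1 / real (Suc n)) * (norm \<xi>)\<^sup>2 / 2)) * cis (x \<bullet> \<xi>)))
        \<longlonglongrightarrow> g \<xi> * (of_real (exp (- 0 * (norm \<xi>)\<^sup>2 / 2)) * cis (x \<bullet> \<xi>))"
        by (intro tendsto_mult tendsto_const tendsto_of_real)
      then show "(\<lambda>n. g \<xi> * (of_real (exp (- (1 / real (Suc n)) * (norm \<xi>)\<^sup>2 / 2)) * cis (x \<bullet> \<xi>)))
        \<longlonglongrightarrow> g \<xi> * cis (x \<bullet> \<xi>)"
        by simp
    qed
    show "AE \<xi> in lborel. norm (g \<xi> * (of_real (exp (- (1 / real (Suc n)) * (norm \<xi>)\<^sup>2 / 2)) * cis (x \<bullet> \<xi>))) \<le> cmod (g \<xi>)" for n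
      by (intro AE_I2) (auto simp: norm_mult intro!: mult_right_le_one_le)
  qed measurable
  moreover have "(\<lambda>n. \<integral>\<xi>. g \<xi> * (of_real (exp (- (1 / real (Suc n)) * (norm \<xi>)\<^sup>2 / 2)) * cis (x \<bullet> \<xi>)) \<partial>lborel)
    \<longlonglongrightarrow> of_real ((2 * pi) ^ 3 * f x)"
    \<comment> \<open>The chain of rules in brackets proves \<open>0 < 1 / real (Suc n)\<close>, so
      that the pairing unfolds as an unconditional equation.\<close>
    unfolding L2_fourier_gauss_pairing[OF L2 zero_less_divide_iff[THEN iffD2, OF disjI1, OF conjI, OF zero_less_one of_nat_0_less_iff[THEN iffD2, OF zero_less_Suc]]]
    by (intro tendsto_of_real gauss_approximate_identity f2 cont) measurable
  ultimately show ?thesis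
    using LIMSEQ_unique by blast
qed

section \<open>Decay of functions with integrable Fourier transform\<close>

lemma integral_Cauchy_Schwarz:
  fixes f g :: "'a \<Rightarrow> real"
  assumes [measurable]: "f \<in> borel_measurable M" "g \<in> borel_measurable M"
    and f2: "integrable M (\<lambda>x. (f x)\<^sup>2)" and g2: "integrable M (\<lambda>x. (g x)\<^sup>2)"
  shows "(\<integral>x. f x * g x \<partial>M) \<le> sqrt (\<integral>x. (f x)\<^sup>2 \<partial>M) * sqrt (\<integral>x. (g x)\<^sup>2 \<partial>M)"
proof -
  have fg: "integrable M (\<lambda>x. f x * g x)"
    by (rule integrable_mult_square_integrable) (use f2 g2 in auto)
  then have "ennreal \<bar>\<integral>x. f x * g x \<partial>M\<bar> \<le> (\<integral>\<^sup>+x. ennreal \<bar>f x\<bar> * ennreal \<bar>g x\<bar> \<partial>M)"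
    using integral_norm_bound_ennreal[OF fg] by (simp add: abs_mult ennreal_mult)
  then have "(ennreal \<bar>\<integral>x. f x * g x \<partial>M\<bar>)\<^sup>2 \<le> (\<integral>\<^sup>+x. ennreal \<bar>f x\<bar> * ennreal \<bar>g x\<bar> \<partial>M)\<^sup>2"
    by (rule power_mono) simp
  also have "\<dots> \<le> (\<integral>\<^sup>+x. (ennreal \<bar>f x\<bar>)\<^sup>2 \<partial>M) * (\<integral>\<^sup>+x. (ennreal \<bar>g x\<bar>)\<^sup>2 \<partial>M)"
    by (rule Cauchy_Schwarz_nn_integral) auto
  also have "\<dots> = ennreal ((\<integral>x. (f x)\<^sup>2 \<partial>M) * (\<integral>x. (g x)\<^sup>2 \<partial>M))"
    using nn_integral_eq_integral[OF f2] nn_integral_eq_integral[OF g2]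
    by (simp add: ennreal_power ennreal_mult)
  finally have "(\<integral>x. f x * g x \<partial>M)\<^sup>2 \<le> (\<integral>x. (f x)\<^sup>2 \<partial>M) * (\<integral>x. (g x)\<^sup>2 \<partial>M)"
    by (simp add: ennreal_power)
  then have "sqrt ((\<integral>x. f x * g x \<partial>M)\<^sup>2) \<le> sqrt ((\<integral>x. (f x)\<^sup>2 \<partial>M) * (\<integral>x. (g x)\<^sup>2 \<partial>M))"
    by (rule real_sqrt_le_mono)
  then show ?thesis
    by (simp add: real_sqrt_mult)
qed

lemma japanese_bracket_integrable_real:
  assumes "1 / 2 < s"
  shows "integrable lborel (\<lambda>x::real. (1 + x\<^sup>2) powr (- s))"
proof -
  define T where "T x = indicator {1..} x * x powr (- 2 * s)" for x :: real
  have [measurable]: "T \<in> borel_measurable borel"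
    unfolding T_def[abs_def] by measurable
  have "(\<lambda>x. x powr (- 2 * s)) integrable_on {1::real..}"
    using has_integral_powr_to_inf[of "- 2 * s" 1] assms by (auto simp: integrable_on_def)
  then have "(\<lambda>x. x powr (- 2 * s)) absolutely_integrable_on {1::real..}"
    by (intro nonnegative_absolutely_integrable_1) auto
  then have "integrable lebesgue T"
    by (simp add: set_integrable_def T_def[abs_def])
  then have T_int: "integrable lborel T"
    by (subst (asm) integrable_completion) auto
  then have T'_int: "integrable lborel (\<lambda>x. T (- x))"
    using lborel_integrable_real_affine_iff[of "-1" T 0] by simp
  show ?thesis
  proof (rule Bochner_Integration.integrable_bound)
    show "integrable lborel (\<lambda>x::real. indicator {-1..1} x + T x + T (- x))"
      using T_int T'_int by (intro Bochner_Integration.integrable_add) auto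
    have T_nonneg: "0 \<le> T x" for x by (simp add: T_def)
    have "(1 + x\<^sup>2) powr (- s) \<le> indicator {-1..1} x + T x + T (- x)" for x
    proof (cases "\<bar>x\<bar> \<le> 1")
      case True
      have "(1 + x\<^sup>2) powr (- s) \<le> 1 powr (- s)"
        using assms by (intro powr_mono2') auto
      then show ?thesis
        using True T_nonneg[of x] T_nonneg[of "- x"] by (auto simp: indicator_def)
    next
      case False
      have "(1 + x\<^sup>2) powr (- s) \<le> (x\<^sup>2) powr (- s)"
        using assms False by (intro powr_mono2') auto
      also have "(x\<^sup>2) powr (- s) = \<bar>x\<bar> powr (- 2 * s)"
      proof -
        have "x\<^sup>2 = \<bar>x\<bar> powr 2"
          using False by (simp add: powr_numeral)
        then have "(x\<^sup>2) powr (- s) = \<bar>x\<bar> powr (2 * - s)"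
          by (simp only: powr_powr)
        then show ?thesis by simp
      qed
      also have "\<dots> \<le> T x + T (- x)"
        using False by (cases "0 \<le> x") (auto simp: T_def indicator_def)
      finally show ?thesis
        by (simp add: indicator_def)
    qed
    then show "AE x in lborel. norm ((1 + x\<^sup>2) powr (- s)) \<le> norm (indicator {-1..1} x + T x + T (- x))"
      using T_nonneg by (intro AE_I2) (simp add: order_trans[OF _ abs_ge_self])
  qed measurable
qed

text \<open>Since \<open>1 + (x \<bullet> b)\<^sup>2 \<le> 1 + (norm x)\<^sup>2\<close> in each
  coordinate, sharing the exponent equally bounds the weight by a product of one-dimensional
  weights. Each receives \<open>s / d > 1 / 2\<close>, exactly the one-dimensional
  condition.\<close>

lemma japanese_bracket_integrable:
  assumes "DIM('a) / 2 < s"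
  shows "integrable lborel (\<lambda>x::'a::euclidean_space. (1 + (norm x)\<^sup>2) powr (- s))"
proof (rule Bochner_Integration.integrable_bound)
  define d where "d = real DIM('a)"
  have "0 < d" by (simp add: d_def)
  have "0 < s" using assms \<open>0 < d\<close> by (simp add: d_def)
  show "integrable lborel (\<lambda>x::'a. \<Prod>b\<in>Basis. (1 + (x \<bullet> b)\<^sup>2) powr (- (s / d)))"
    by (intro lborel_product_integral(1) japanese_bracket_integrable_real)
       (use assms \<open>0 < d\<close> in \<open>simp add: d_def field_simps\<close>)
  have "(1 + (norm x)\<^sup>2) powr (- s) \<le> (\<Prod>b\<in>Basis. (1 + (x \<bullet> b)\<^sup>2) powr (- (s / d)))" for x :: 'a
  proof -
    have pos: "0 < 1 + (norm x)\<^sup>2"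
      by (intro add_pos_nonneg) auto
    have "(1 + (norm x)\<^sup>2) powr (- s) = ((1 + (norm x)\<^sup>2) powr (- (s / d))) powr d"
      using \<open>0 < d\<close> by (simp add: powr_powr)
    also have "\<dots> = (\<Prod>b\<in>(Basis::'a set). (1 + (norm x)\<^sup>2) powr (- (s / d)))"
      using pos by (simp add: d_def powr_realpow)
    also have "\<dots> \<le> (\<Prod>b\<in>Basis. (1 + (x \<bullet> b)\<^sup>2) powr (- (s / d)))"
    proof (intro prod_mono conjI powr_mono2')
      fix b :: 'a assume b: "b \<in> Basis"
      have "\<bar>x \<bullet> b\<bar> \<le> norm x"
        by (rule Basis_le_norm[OF b])
      then have "\<bar>x \<bullet> b\<bar>\<^sup>2 \<le> (norm x)\<^sup>2"
        by (rule power_mono) simp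
      then show "1 + (x \<bullet> b)\<^sup>2 \<le> 1 + (norm x)\<^sup>2" by simp
      show "0 < 1 + (x \<bullet> b)\<^sup>2"
        by (intro add_pos_nonneg) auto
    qed (use \<open>0 < s\<close> \<open>0 < d\<close> in auto)
    finally show ?thesis .
  qed
  then show "AE x in (lborel :: 'a measure). norm ((1 + (norm x)\<^sup>2) powr (- s)) \<le> norm (\<Prod>b\<in>Basis. (1 + (x \<bullet> b)\<^sup>2) powr (- (s / d)))"
    by (intro AE_I2) (simp add: order_trans[OF _ abs_ge_self])
qed measurable

text \<open>The embedding constant from \<open>Sobolev m\<close> to functions bounded together with
  their gradient. The integral converges for \<open>m > 5 / 2\<close>, when \<open>m - 1\<close>
  exceeds half the dimension.\<close>

definition bracket_weight :: "real \<Rightarrow> real" where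
  "bracket_weight m = sqrt (\<integral>\<xi>. (1 + (norm \<xi>)\<^sup>2) powr (1 - m) \<partial>(lborel :: (real^3) measure))"

text \<open>Cauchy-Schwarz after splitting the exponent \<open>1 / 2\<close> as
  \<open>(1 - m) / 2 + m / 2\<close>. One power of the frequency in L1 serves the function as well
  as its gradient.\<close>

lemma weighted_L2_imp_weighted_L1:
  fixes g :: "real^3 \<Rightarrow> complex"
  assumes m: "m > 5 / 2" and [measurable]: "g \<in> borel_measurable borel"
    and int: "integrable lborel (\<lambda>\<xi>. (1 + (norm \<xi>)\<^sup>2) powr m * (cmod (g \<xi>))\<^sup>2)"
  shows "integrable lborel (\<lambda>\<xi>. sqrt (1 + (norm \<xi>)\<^sup>2) * cmod (g \<xi>))"
    and "(\<integral>\<xi>. sqrt (1 + (norm \<xi>)\<^sup>2) * cmod (g \<xi>) \<partial>lborel)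
      \<le> bracket_weight m * sqrt (\<integral>\<xi>. (1 + (norm \<xi>)\<^sup>2) powr m * (cmod (g \<xi>))\<^sup>2 \<partial>lborel)"
proof -
  define w where "w \<xi> = 1 + (norm \<xi>)\<^sup>2" for \<xi> :: "real^3"
  have w: "0 < w \<xi>" for \<xi>
    unfolding w_def by (intro add_pos_nonneg) auto
  have [measurable]: "w \<in> borel_measurable borel"
    unfolding w_def[abs_def] by measurable
  define a where "a \<xi> = w \<xi> powr ((1 - m) / 2)" for \<xi>
  define b where "b \<xi> = w \<xi> powr (m / 2) * cmod (g \<xi>)" for \<xi>
  have [measurable]: "a \<in> borel_measurable borel" "b \<in> borel_measurable borel"
    unfolding a_def[abs_def] b_def[abs_def] by measurable
  have powr_sq: "(x powr y)\<^sup>2 = x powr (2 * y)" if "0 < x" for x y :: real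
    using that by (simp add: power2_eq_square flip: powr_add)
  have a2: "(a \<xi>)\<^sup>2 = w \<xi> powr (1 - m)" and b2: "(b \<xi>)\<^sup>2 = w \<xi> powr m * (cmod (g \<xi>))\<^sup>2" for \<xi>
    using w by (simp_all add: a_def b_def power_mult_distrib powr_sq diff_divide_distrib)
  have ab: "a \<xi> * b \<xi> = sqrt (w \<xi>) * cmod (g \<xi>)" for \<xi>
  proof -
    have "w \<xi> powr ((1 - m) / 2) * w \<xi> powr (m / 2) = w \<xi> powr (1 / 2)"
      using w by (simp flip: powr_add add: field_simps)
    then show ?thesis
      using w by (simp add: a_def b_def powr_half_sqrt less_imp_le)
  qed
  have a_int: "integrable lborel (\<lambda>\<xi>. (a \<xi>)\<^sup>2)"
    unfolding a2 w_def using japanese_bracket_integrable[of "m - 1", where 'a = "real^3"] m by simp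
  have b_int: "integrable lborel (\<lambda>\<xi>. (b \<xi>)\<^sup>2)"
    unfolding b2 w_def using int .
  show "integrable lborel (\<lambda>\<xi>. sqrt (1 + (norm \<xi>)\<^sup>2) * cmod (g \<xi>))"
    using integrable_mult_square_integrable[of a lborel b] a_int b_int by (simp add: ab w_def)
  show "(\<integral>\<xi>. sqrt (1 + (norm \<xi>)\<^sup>2) * cmod (g \<xi>) \<partial>lborel)
      \<le> bracket_weight m * sqrt (\<integral>\<xi>. (1 + (norm \<xi>)\<^sup>2) powr m * (cmod (g \<xi>))\<^sup>2 \<partial>lborel)"
    using integral_Cauchy_Schwarz[OF _ _ a_int b_int] unfolding ab a2 b2 bracket_weight_def w_def by simp
qed

section \<open>Differentiating the inversion formula\<close>

lemma norm_cis_minus_one_le: "cmod (cis t - 1) \<le> \<bar>t\<bar>"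
proof -
  have "(cmod (cis t - 1))\<^sup>2 = (cos t - 1)\<^sup>2 + (sin t)\<^sup>2"
    by (simp add: cmod_power2)
  also have "\<dots> = 2 - 2 * cos t"
    using sin_cos_squared_add[of t] by (simp add: power2_diff)
  also have "\<dots> = (2 * sin (t / 2))\<^sup>2"
    using cos_double_sin[of "t / 2"] by (simp add: power_mult_distrib)
  finally have "cmod (cis t - 1) = \<bar>2 * sin (t / 2)\<bar>"
    by (metis norm_ge_zero real_sqrt_abs real_sqrt_unique)
  also have "\<dots> \<le> \<bar>t\<bar>"
    using abs_sin_x_le_abs_x[of "t / 2"] by (simp add: abs_mult)
  finally show ?thesis .
qed

lemma DERIV_along_line:
  fixes f :: "'a::real_normed_vector \<Rightarrow> real"
  assumes "f differentiable (at (x + t *\<^sub>R e))"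
  shows "((\<lambda>h. f (x + h *\<^sub>R e)) has_real_derivative frechet_derivative f (at (x + t *\<^sub>R e)) e) (at t)"
proof -
  have D: "(f has_derivative frechet_derivative f (at (x + t *\<^sub>R e))) (at (x + t *\<^sub>R e))"
    using assms by (simp add: frechet_derivative_works)
  have "((\<lambda>h. x + h *\<^sub>R e) has_derivative (\<lambda>h. h *\<^sub>R e)) (at t)"
    by (auto intro!: derivative_eq_intros)
  from has_derivative_compose[OF this D]
  have "((\<lambda>h. f (x + h *\<^sub>R e)) has_derivative (\<lambda>h. h * frechet_derivative f (at (x + t *\<^sub>R e)) e)) (at t)"
    using linear_frechet_derivative[OF assms] by (simp add: linear_scale)
  then show ?thesis
    by (simp add: has_field_derivative_def mult_commute_abs)
qed

lemma directional_derivative_sequentially: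
  fixes f :: "'a::real_normed_vector \<Rightarrow> real"
  assumes "f differentiable (at x)"
  shows "(\<lambda>n. (f (x + (1 / real (Suc n)) *\<^sub>R e) - f x) / (1 / real (Suc n))) \<longlonglongrightarrow> frechet_derivative f (at x) e"
proof -
  have "((\<lambda>h. (f (x + h *\<^sub>R e) - f x) / h) \<longlongrightarrow> frechet_derivative f (at x) e) (at 0)"
    using DERIV_along_line[of f x 0 e] assms by (simp add: has_field_derivative_iff)
  moreover have "filterlim (\<lambda>n. 1 / real (Suc n)) (at 0) sequentially"
    by (intro filterlim_atI LIMSEQ_Suc[OF lim_1_over_n] always_eventually) auto
  ultimately show ?thesis
    by (rule filterlim_compose)
qed

locale regular_L2_fourier =
  fixes f :: "real^3 \<Rightarrow> real" and g :: "real^3 \<Rightarrow> complex"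
  assumes L2: "is_L2_fourier f g"
    and weight_int: "integrable lborel (\<lambda>\<xi>. sqrt (1 + (norm \<xi>)\<^sup>2) * cmod (g \<xi>))"
    and f_diff: "\<And>x. f differentiable (at x)"
begin

text \<open>A common bound for \<open>f\<close>, for its derivatives in directions of norm at most
  1, and for its Lipschitz constant.\<close>

definition M where "M = (\<integral>\<xi>. sqrt (1 + (norm \<xi>)\<^sup>2) * cmod (g \<xi>) \<partial>lborel)"

lemma measurable_fg [measurable]: "f \<in> borel_measurable borel" "g \<in> borel_measurable borel"
  using L2 by (auto simp: is_L2_fourier_def)

lemma norm_le_weight: "norm \<xi> \<le> sqrt (1 + (norm \<xi>)\<^sup>2)" "1 \<le> sqrt (1 + (norm \<xi>)\<^sup>2)"
  by (auto intro: real_le_rsqrt)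

lemma integrable_of_weight:
  fixes k :: "real^3 \<Rightarrow> complex"
  assumes [measurable]: "k \<in> borel_measurable borel" and "\<And>\<xi>. cmod (k \<xi>) \<le> sqrt (1 + (norm \<xi>)\<^sup>2)"
  shows "integrable lborel (\<lambda>\<xi>. g \<xi> * k \<xi>)" "cmod (\<integral>\<xi>. g \<xi> * k \<xi> \<partial>lborel) \<le> M"
proof -
  have le: "cmod (g \<xi> * k \<xi>) \<le> sqrt (1 + (norm \<xi>)\<^sup>2) * cmod (g \<xi>)" for \<xi>
    using assms(2)[of \<xi>] by (simp add: norm_mult mult.commute mult_left_mono)
  show int: "integrable lborel (\<lambda>\<xi>. g \<xi> * k \<xi>)"
    by (rule Bochner_Integration.integrable_bound[OF weight_int])
       (use le in \<open>auto intro!: AE_I2 order_trans[OF _ abs_ge_self] simp del: abs_mult\<close>)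
  show "cmod (\<integral>\<xi>. g \<xi> * k \<xi> \<partial>lborel) \<le> M"
    unfolding M_def by (rule order_trans[OF integral_norm_bound integral_mono[OF integrable_norm[OF int] weight_int le]])
qed

lemma cont: "isCont f x"
  by (rule differentiable_imp_continuous_within[OF f_diff])

lemma inversion: "of_real ((2 * pi) ^ 3 * f x) = (\<integral>\<xi>. g \<xi> * cis (x \<bullet> \<xi>) \<partial>lborel)"
proof (rule L2_fourier_inversion[OF L2 _ cont])
  show "integrable lborel g"
    using integrable_of_weight(1)[of "\<lambda>_. 1"] norm_le_weight(2) by simp
qed

lemma two_pi_cubed: "1 \<le> (2 * pi) ^ 3"
  using pi_gt3 by (intro one_le_power) auto

text \<open>Inversion yields values multiplied by \<open>(2 * pi) ^ 3\<close>. This factor is at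
  least 1, so upper bounds may drop it.\<close>

lemma bound_of_scaled:
  assumes "cmod (of_real ((2 * pi) ^ 3 * y)) \<le> B"
  shows "\<bar>y\<bar> \<le> B"
proof -
  have "1 * \<bar>y\<bar> \<le> (2 * pi) ^ 3 * \<bar>y\<bar>"
    by (intro mult_right_mono two_pi_cubed) auto
  also have "\<dots> \<le> B"
    using assms by (simp add: norm_mult abs_mult norm_power)
  finally show ?thesis by simp
qed

lemma f_bound: "\<bar>f x\<bar> \<le> M"
  by (rule bound_of_scaled) (unfold inversion, rule integrable_of_weight(2), use norm_le_weight(2) in auto)

text \<open>Differentiation under the integral. The difference quotients of the exponential are at
  most \<open>\<bar>e \<bullet> \<xi>\<bar>\<close> for every step size, so
  \<open>weight_int\<close> provides the majorant.\<close>

lemma derivative_inversion: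
  assumes e: "norm e \<le> 1"
  shows "of_real ((2 * pi) ^ 3 * frechet_derivative f (at x) e) = (\<integral>\<xi>. g \<xi> * (\<i> * of_real (e \<bullet> \<xi>) * cis (x \<bullet> \<xi>)) \<partial>lborel)"
proof -
  define h where "h n = 1 / real (Suc n)" for n
  have h_pos: "0 < h n" for n by (simp add: h_def)
  define Q where "Q n \<xi> = (cis (h n * (e \<bullet> \<xi>)) - 1) / of_real (h n) * cis (x \<bullet> \<xi>)" for n and \<xi> :: "real^3"
  have e_le: "\<bar>e \<bullet> \<xi>\<bar> \<le> norm \<xi>" for \<xi>
    using Cauchy_Schwarz_ineq2[of e \<xi>] mult_right_mono[OF e norm_ge_zero[of \<xi>]] by simp
  have Q_le: "cmod (Q n \<xi>) \<le> sqrt (1 + (norm \<xi>)\<^sup>2)" for n \<xi>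
  proof -
    have "cmod (Q n \<xi>) = cmod (cis (h n * (e \<bullet> \<xi>)) - 1) / h n"
      using h_pos[of n] by (simp add: Q_def norm_mult norm_divide)
    also have "\<dots> \<le> \<bar>h n * (e \<bullet> \<xi>)\<bar> / h n"
      using h_pos[of n] by (intro divide_right_mono norm_cis_minus_one_le) auto
    also have "\<dots> = \<bar>e \<bullet> \<xi>\<bar>"
      using h_pos[of n] by (simp add: abs_mult)
    finally show ?thesis
      using e_le[of \<xi>] norm_le_weight(1)[of \<xi>] by linarith
  qed
  have Q_meas [measurable]: "Q n \<in> borel_measurable borel" for n
    unfolding Q_def[abs_def] by measurable
  have "complex_of_real ((2 * pi) ^ 3 * ((f (x + h n *\<^sub>R e) - f x) / h n)) = (\<integral>\<xi>. g \<xi> * Q n \<xi> \<partial>lborel)" for n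
  proof -
    have "complex_of_real ((2 * pi) ^ 3 * ((f (x + h n *\<^sub>R e) - f x) / h n))
       = (of_real ((2 * pi) ^ 3 * f (x + h n *\<^sub>R e)) - of_real ((2 * pi) ^ 3 * f x)) / of_real (h n)"
      by (simp add: right_diff_distrib)
    also have "\<dots> = (\<integral>\<xi>. g \<xi> * cis ((x + h n *\<^sub>R e) \<bullet> \<xi>) - g \<xi> * cis (x \<bullet> \<xi>) \<partial>lborel) / of_real (h n)"
      unfolding inversion
      by (subst Bochner_Integration.integral_diff) (auto intro!: integrable_of_weight(1) norm_le_weight(2))
    also have "\<dots> = (\<integral>\<xi>. (g \<xi> * cis ((x + h n *\<^sub>R e) \<bullet> \<xi>) - g \<xi> * cis (x \<bullet> \<xi>)) / of_real (h n) \<partial>lborel)"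
      by simp
    also have "\<dots> = (\<integral>\<xi>. g \<xi> * Q n \<xi> \<partial>lborel)"
      by (intro Bochner_Integration.integral_cong refl)
         (simp add: Q_def inner_add_left algebra_simps diff_divide_distrib flip: cis_mult)
    finally show ?thesis .
  qed
  moreover have "(\<lambda>n. complex_of_real ((2 * pi) ^ 3 * ((f (x + h n *\<^sub>R e) - f x) / h n))) \<longlonglongrightarrow> of_real ((2 * pi) ^ 3 * frechet_derivative f (at x) e)"
    unfolding h_def by (intro tendsto_of_real tendsto_mult tendsto_const directional_derivative_sequentially f_diff)
  moreover have "(\<lambda>n. \<integral>\<xi>. g \<xi> * Q n \<xi> \<partial>lborel) \<longlonglongrightarrow> (\<integral>\<xi>. g \<xi> * (\<i> * of_real (e \<bullet> \<xi>) * cis (x \<bullet> \<xi>)) \<partial>lborel)"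
  proof (rule integral_dominated_convergence[OF _ _ weight_int])
    show "AE \<xi> in lborel. (\<lambda>n. g \<xi> * Q n \<xi>) \<longlonglongrightarrow> g \<xi> * (\<i> * of_real (e \<bullet> \<xi>) * cis (x \<bullet> \<xi>))"
    proof (rule AE_I2)
      fix \<xi> :: "real^3"
      define \<theta> where "\<theta> = e \<bullet> \<xi>"
      have "((\<lambda>z. exp (\<i> * of_real \<theta> * z)) has_field_derivative \<i> * of_real \<theta>) (at 0)"
        by (auto intro!: derivative_eq_intros)
      then have "((\<lambda>z. (exp (\<i> * of_real \<theta> * z) - 1) / z) \<longlongrightarrow> \<i> * of_real \<theta>) (at 0)"
        by (simp add: has_field_derivative_iff)
      moreover have "filterlim (\<lambda>n. complex_of_real (h n)) (at 0) sequentially"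
      proof (rule filterlim_atI)
        show "(\<lambda>n. complex_of_real (h n)) \<longlonglongrightarrow> 0"
        proof -
          have "(\<lambda>n. complex_of_real (h n)) \<longlonglongrightarrow> of_real 0"
            unfolding h_def by (intro tendsto_of_real LIMSEQ_Suc[OF lim_1_over_n])
          then show ?thesis by simp
        qed
        show "\<forall>\<^sub>F n in sequentially. complex_of_real (h n) \<noteq> 0"
          using h_pos by (intro always_eventually) (simp add: less_imp_neq[symmetric])
      qed
      ultimately have "(\<lambda>n. (exp (\<i> * of_real \<theta> * of_real (h n)) - 1) / of_real (h n)) \<longlonglongrightarrow> \<i> * of_real \<theta>"
        by (rule filterlim_compose)
      then have "(\<lambda>n. g \<xi> * ((exp (\<i> * of_real \<theta> * of_real (h n)) - 1) / of_real (h n) * cis (x \<bullet> \<xi>)))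
          \<longlonglongrightarrow> g \<xi> * (\<i> * of_real \<theta> * cis (x \<bullet> \<xi>))"
        by (intro tendsto_mult tendsto_const)
      then show "(\<lambda>n. g \<xi> * Q n \<xi>) \<longlonglongrightarrow> g \<xi> * (\<i> * of_real (e \<bullet> \<xi>) * cis (x \<bullet> \<xi>))"
        by (simp add: Q_def \<theta>_def cis_conv_exp mult_ac)
    qed
    show "AE \<xi> in lborel. cmod (g \<xi> * Q n \<xi>) \<le> sqrt (1 + (norm \<xi>)\<^sup>2) * cmod (g \<xi>)" for n
      using Q_le by (intro AE_I2) (simp add: norm_mult mult.commute mult_left_mono)
  qed measurable
  ultimately show ?thesis
    by (simp add: LIMSEQ_unique)
qed

lemma derivative_factor_le:
  assumes "norm e \<le> 1"
  shows "cmod (\<i> * of_real (e \<bullet> \<xi>) * cis (x \<bullet> \<xi>)) \<le> sqrt (1 + (norm \<xi>)\<^sup>2)"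
  using Cauchy_Schwarz_ineq2[of e \<xi>] mult_right_mono[OF assms norm_ge_zero[of \<xi>]] norm_le_weight(1)[of \<xi>]
  by (simp add: norm_mult)

lemma derivative_bound:
  assumes "norm e \<le> 1"
  shows "\<bar>frechet_derivative f (at x) e\<bar> \<le> M"
  by (rule bound_of_scaled)
     (unfold derivative_inversion[OF assms], rule integrable_of_weight(2), use derivative_factor_le[OF assms] in auto)

text \<open>A shift by \<open>z\<close> multiplies the transform by
  \<open>cis (z \<bullet> \<xi>)\<close>. The resulting change of the derivative is at most
  \<open>\<mu> z\<close>, which depends neither on the points nor on the direction; the decay of the
  gradient rests on this uniformity.\<close>

lemma derivative_modulus:
  assumes "0 < \<epsilon>"
  obtains \<delta> where "0 < \<delta>" "\<And>x y e. norm e \<le> 1 \<Longrightarrow> norm (x - y) < \<delta> \<Longrightarrow>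
    \<bar>frechet_derivative f (at x) e - frechet_derivative f (at y) e\<bar> < \<epsilon>"
proof -
  define \<mu> where "\<mu> z = (\<integral>\<xi>. sqrt (1 + (norm \<xi>)\<^sup>2) * cmod (g \<xi>) * cmod (cis (z \<bullet> \<xi>) - 1) \<partial>lborel)" for z :: "real^3"
  have cis_le: "cmod (cis t - 1) \<le> 2" for t
    using norm_triangle_ineq4[of "cis t" 1] by simp
  have \<mu>_int: "integrable lborel (\<lambda>\<xi>. sqrt (1 + (norm \<xi>)\<^sup>2) * cmod (g \<xi>) * cmod (cis (z \<bullet> \<xi>) - 1))" for z
  proof (rule Bochner_Integration.integrable_bound)
    show "integrable lborel (\<lambda>\<xi>. sqrt (1 + (norm \<xi>)\<^sup>2) * cmod (g \<xi>) * 2)"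
      using weight_int by simp
  qed (auto intro!: AE_I2 mult_left_mono simp: cis_le)
  have "isCont \<mu> 0"
    unfolding continuous_at_sequentially
  proof (intro allI impI)
    fix z :: "nat \<Rightarrow> real^3" assume z: "z \<longlonglongrightarrow> 0"
    show "(\<mu> \<circ> z) \<longlonglongrightarrow> \<mu> 0"
      unfolding \<mu>_def o_def
    proof (rule integral_dominated_convergence)
      show "integrable lborel (\<lambda>\<xi>. sqrt (1 + (norm \<xi>)\<^sup>2) * cmod (g \<xi>) * 2)"
        using weight_int by simp
      show "AE \<xi> in lborel. (\<lambda>n. sqrt (1 + (norm \<xi>)\<^sup>2) * cmod (g \<xi>) * cmod (cis (z n \<bullet> \<xi>) - 1))
        \<longlonglongrightarrow> sqrt (1 + (norm \<xi>)\<^sup>2) * cmod (g \<xi>) * cmod (cis (0 \<bullet> \<xi>) - 1)"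
        by (intro AE_I2 tendsto_intros isCont_tendsto_compose[of _ cis] z)
    qed (auto intro!: AE_I2 mult_left_mono simp: cis_le)
  qed
  moreover have "\<mu> 0 = 0" by (simp add: \<mu>_def)
  ultimately obtain \<delta> where "0 < \<delta>" and \<delta>: "\<And>z. norm z < \<delta> \<Longrightarrow> \<bar>\<mu> z\<bar> < \<epsilon>"
    unfolding continuous_at_eps_delta dist_norm using \<open>0 < \<epsilon>\<close> by (metis diff_zero real_norm_def)
  show ?thesis
  proof (rule that[OF \<open>0 < \<delta>\<close>])
    fix x y e :: "real^3" assume e: "norm e \<le> 1" and xy: "norm (x - y) < \<delta>"
    define D where "D x = frechet_derivative f (at x) e" for x
    let ?k = "\<lambda>x \<xi>. \<i> * of_real (e \<bullet> \<xi>) * cis (x \<bullet> \<xi>)"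
    have k_int: "integrable lborel (\<lambda>\<xi>. g \<xi> * ?k x \<xi>)" for x
      by (rule integrable_of_weight(1)) (use derivative_factor_le[OF e] in auto)
    have "\<bar>D x - D y\<bar> \<le> \<mu> (x - y)"
    proof (rule bound_of_scaled)
      have "complex_of_real ((2 * pi) ^ 3 * (D x - D y)) = (\<integral>\<xi>. g \<xi> * ?k x \<xi> - g \<xi> * ?k y \<xi> \<partial>lborel)"
        unfolding right_diff_distrib of_real_diff D_def derivative_inversion[OF e]
        by (rule Bochner_Integration.integral_diff[symmetric, OF k_int k_int])
      also have "cmod \<dots> \<le> \<mu> (x - y)"
        unfolding \<mu>_def
      proof (rule order_trans[OF integral_norm_bound integral_mono[OF integrable_norm \<mu>_int]])
        show "integrable lborel (\<lambda>\<xi>. g \<xi> * ?k x \<xi> - g \<xi> * ?k y \<xi>)"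
          by (intro Bochner_Integration.integrable_diff k_int)
        fix \<xi>
        have "cis (x \<bullet> \<xi>) = cis (y \<bullet> \<xi>) * cis ((x - y) \<bullet> \<xi>)"
          by (simp add: cis_mult inner_diff_left)
        then have "g \<xi> * ?k x \<xi> - g \<xi> * ?k y \<xi> = g \<xi> * ?k y \<xi> * (cis ((x - y) \<bullet> \<xi>) - 1)"
          by (simp add: algebra_simps)
        then have "cmod (g \<xi> * ?k x \<xi> - g \<xi> * ?k y \<xi>) = cmod (?k y \<xi>) * cmod (g \<xi>) * cmod (cis ((x - y) \<bullet> \<xi>) - 1)"
          by (simp only: norm_mult mult_ac)
        also have "\<dots> \<le> sqrt (1 + (norm \<xi>)\<^sup>2) * cmod (g \<xi>) * cmod (cis ((x - y) \<bullet> \<xi>) - 1)"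
          by (intro mult_right_mono derivative_factor_le[OF e]) auto
        finally show "cmod (g \<xi> * ?k x \<xi> - g \<xi> * ?k y \<xi>) \<le> sqrt (1 + (norm \<xi>)\<^sup>2) * cmod (g \<xi>) * cmod (cis ((x - y) \<bullet> \<xi>) - 1)" .
      qed
      finally show "cmod (complex_of_real ((2 * pi) ^ 3 * (D x - D y))) \<le> \<mu> (x - y)" .
    qed
    also have "\<dots> < \<epsilon>"
      using \<delta>[OF xy] by linarith
    finally show "\<bar>frechet_derivative f (at x) e - frechet_derivative f (at y) e\<bar> < \<epsilon>"
      by (simp add: D_def)
  qed
qed

section \<open>Decay at infinity\<close>

lemma M_nonneg: "0 \<le> M"
  using f_bound[of 0] by (rule order_trans[OF abs_ge_zero])

lemma f_lipschitz: "\<bar>f x - f y\<bar> \<le> M * norm (x - y)"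
proof -
  have "onorm (frechet_derivative f (at z)) \<le> M" for z
  proof (rule onorm_le)
    fix e
    have lin: "linear (frechet_derivative f (at z))"
      by (rule linear_frechet_derivative[OF f_diff])
    show "norm (frechet_derivative f (at z) e) \<le> M * norm e"
    proof (cases "e = 0")
      case True
      then show ?thesis using linear_0[OF lin] by simp
    next
      case False
      then have "\<bar>frechet_derivative f (at z) (e /\<^sub>R norm e)\<bar> \<le> M"
        by (intro derivative_bound) simp
      then have "\<bar>frechet_derivative f (at z) e\<bar> / norm e \<le> M"
        using False by (simp add: linear_scale[OF lin] abs_mult divide_inverse mult.commute)
      then show ?thesis
        using False by (simp add: pos_divide_le_eq)
    qed
  qed
  then have "norm (f x - f y) \<le> M * norm (x - y)"
    by (intro differentiable_bound[of UNIV f "\<lambda>z. frechet_derivative f (at z)"])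
       (use f_diff in \<open>auto simp: frechet_derivative_works\<close>)
  then show ?thesis by simp
qed

text \<open>If \<open>\<bar>f x\<bar> > \<epsilon>\<close>, the Lipschitz bound keeps
  \<open>\<bar>f\<bar> \<ge> \<epsilon> / 2\<close> on a ball of fixed radius, which costs a fixed
  amount of L2 mass. Far out, less than that is left.\<close>

lemma f_decay:
  assumes "0 < \<epsilon>"
  obtains R where "\<And>x. R \<le> norm x \<Longrightarrow> \<bar>f x\<bar> \<le> \<epsilon>"
proof -
  \<comment> \<open>\<open>M + 1\<close> instead of \<open>M\<close> guards against
    \<open>M = 0\<close>.\<close>
  define r where "r = \<epsilon> / (2 * (M + 1))"
  have "0 < r" using assms M_nonneg by (simp add: r_def)
  have Mr: "M * r \<le> \<epsilon> / 2"
    using assms M_nonneg by (simp add: r_def field_simps)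
  define V where "V = measure lborel (ball (0::real^3) r)"
  have V: "measure lborel (ball x r) = V" for x :: "real^3"
    using \<open>0 < r\<close> by (simp add: V_def content_ball)
  have "0 < V"
    using \<open>0 < r\<close> by (simp add: V_def content_ball unit_ball_vol_pos)
  have f2: "integrable lborel (\<lambda>y. (f y)\<^sup>2)"
    using L2 by (simp add: is_L2_fourier_def)
  have "(\<lambda>n. \<integral>y. indicator {y. real n \<le> norm y} y * (f y)\<^sup>2 \<partial>lborel) \<longlonglongrightarrow> (\<integral>y. 0 \<partial>(lborel :: (real^3) measure))"
  proof (rule integral_dominated_convergence[OF _ _ f2])
    show "AE y in lborel. (\<lambda>n. indicator {y. real n \<le> norm y} y * (f y)\<^sup>2) \<longlonglongrightarrow> 0"
    proof (rule AE_I2)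
      fix y :: "real^3"
      obtain N :: nat where "norm y < real N"
        using reals_Archimedean2 by blast
      then have "\<forall>\<^sub>F n in sequentially. indicator {y. real n \<le> norm y} y * (f y)\<^sup>2 = 0"
        by (intro eventually_sequentiallyI[of N]) auto
      then show "(\<lambda>n. indicator {y. real n \<le> norm y} y * (f y)\<^sup>2) \<longlonglongrightarrow> 0"
        by (rule tendsto_eventually)
    qed
  qed (auto intro!: AE_I2 simp: indicator_def)
  then have "\<forall>\<^sub>F n in sequentially. (\<integral>y. indicator {y. real n \<le> norm y} y * (f y)\<^sup>2 \<partial>lborel) < (\<epsilon> / 2)\<^sup>2 * V"
    using assms \<open>0 < V\<close> by (intro order_tendstoD(2)[of _ "0::real"]) auto
  from eventually_happens'[OF sequentially_bot this]
  obtain n :: nat where n: "(\<integral>y. indicator {y. real n \<le> norm y} y * (f y)\<^sup>2 \<partial>lborel) < (\<epsilon> / 2)\<^sup>2 * V"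
    by blast
  have "\<bar>f x\<bar> \<le> \<epsilon>" if x: "n + r \<le> norm x" for x
  proof (rule ccontr)
    assume "\<not> \<bar>f x\<bar> \<le> \<epsilon>"
    have large: "indicator (ball x r) y * (\<epsilon> / 2)\<^sup>2 \<le> indicator {y. real n \<le> norm y} y * (f y)\<^sup>2" for y
    proof (cases "y \<in> ball x r")
      case True
      then have xy: "norm (x - y) < r" by (simp add: dist_norm)
      have "real n \<le> norm y"
        using xy x norm_triangle_sub[of x y] by simp
      moreover have "\<bar>f x - f y\<bar> \<le> \<epsilon> / 2"
        using f_lipschitz[of x y] mult_left_mono[OF less_imp_le[OF xy] M_nonneg] Mr by linarith
      then have "\<epsilon> / 2 \<le> \<bar>f y\<bar>"
        using \<open>\<not> \<bar>f x\<bar> \<le> \<epsilon>\<close> by linarith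
      then have "(\<epsilon> / 2)\<^sup>2 \<le> \<bar>f y\<bar>\<^sup>2"
        using assms by (intro power_mono) auto
      ultimately show ?thesis
        using True by simp
    qed simp
    have "V * (\<epsilon> / 2)\<^sup>2 = (\<integral>y. indicator (ball x r) y * (\<epsilon> / 2)\<^sup>2 \<partial>lborel)"
      by (simp add: V)
    also have "\<dots> \<le> (\<integral>y. indicator {y. real n \<le> norm y} y * (f y)\<^sup>2 \<partial>lborel)"
    proof (rule integral_mono[OF _ _ large])
      show "integrable lborel (\<lambda>y. indicator (ball x r) y * (\<epsilon> / 2)\<^sup>2)"
        by (intro integrable_mult_left integrable_real_indicator) (use emeasure_lborel_ball_finite in auto)
      show "integrable lborel (\<lambda>y. indicator {y. real n \<le> norm y} y * (f y)\<^sup>2)"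
        by (rule Bochner_Integration.integrable_bound[OF f2]) (auto intro!: AE_I2 simp: indicator_def)
    qed
    finally show False
      using n by (simp add: mult.commute)
  qed
  then show ?thesis
    using that by blast
qed

text \<open>Barbalat's argument: a derivative of size \<open>\<epsilon>\<close> persists on a segment of fixed length, along which \<open>f\<close>
  would then vary by a fixed amount.\<close>

lemma derivative_decay:
  assumes "0 < \<epsilon>"
  obtains R where "\<And>x e. R \<le> norm x \<Longrightarrow> norm e \<le> 1 \<Longrightarrow> \<bar>frechet_derivative f (at x) e\<bar> \<le> \<epsilon>"
proof -
  have "0 < \<epsilon> / 2" using assms by simp
  then obtain \<delta> where "0 < \<delta>" and \<delta>: "\<And>x y e. norm e \<le> 1 \<Longrightarrow> norm (x - y) < \<delta> \<Longrightarrow>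
      \<bar>frechet_derivative f (at x) e - frechet_derivative f (at y) e\<bar> < \<epsilon> / 2"
    using derivative_modulus by blast
  define s where "s = \<delta> / 2"
  have "0 < s" "s < \<delta>" using \<open>0 < \<delta>\<close> by (simp_all add: s_def)
  \<comment> \<open>Two values of size at most \<open>\<epsilon> * s / 8\<close> give a mean slope
    of at most \<open>\<epsilon> / 4\<close> over the length \<open>s\<close>; this fits into the
    half of \<open>\<epsilon>\<close> not spent on the modulus.\<close>
  have "0 < \<epsilon> * s / 8" using assms \<open>0 < s\<close> by simp
  then obtain R where R: "\<And>x. R \<le> norm x \<Longrightarrow> \<bar>f x\<bar> \<le> \<epsilon> * s / 8"
    using f_decay by blast
  have "\<bar>frechet_derivative f (at x) e\<bar> \<le> \<epsilon>" if x: "R + s \<le> norm x" and e: "norm e \<le> 1" for x e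
  proof -
    have "\<exists>t>0. t < s \<and> f (x + s *\<^sub>R e) - f (x + 0 *\<^sub>R e) = (s - 0) * frechet_derivative f (at (x + t *\<^sub>R e)) e"
      by (rule MVT2[OF \<open>0 < s\<close>]) (rule DERIV_along_line[OF f_diff])
    then obtain t where t: "0 < t" "t < s" "f (x + s *\<^sub>R e) - f x = s * frechet_derivative f (at (x + t *\<^sub>R e)) e"
      by auto
    have te: "norm (t' *\<^sub>R e) \<le> t'" if "0 \<le> t'" for t'
      using mult_left_mono[OF e that] that by simp
    have "R \<le> norm (x + s *\<^sub>R e)"
      using norm_diff_ineq[of x "s *\<^sub>R e"] te[OF less_imp_le[OF \<open>0 < s\<close>]] x by linarith
    then have "\<bar>f (x + s *\<^sub>R e)\<bar> \<le> \<epsilon> * s / 8" "\<bar>f x\<bar> \<le> \<epsilon> * s / 8"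
      using R x \<open>0 < s\<close> by auto
    then have "\<bar>s * frechet_derivative f (at (x + t *\<^sub>R e)) e\<bar> \<le> s * (\<epsilon> / 2)"
    proof -
      have "s * (\<epsilon> / 2) = 4 * (\<epsilon> * s / 8)" by simp
      with \<open>\<bar>f (x + s *\<^sub>R e)\<bar> \<le> \<epsilon> * s / 8\<close> \<open>\<bar>f x\<bar> \<le> \<epsilon> * s / 8\<close> \<open>0 < \<epsilon> * s / 8\<close>
      show ?thesis unfolding t(3)[symmetric] by linarith
    qed
    then have "\<bar>frechet_derivative f (at (x + t *\<^sub>R e)) e\<bar> \<le> \<epsilon> / 2"
      using \<open>0 < s\<close> by (simp add: abs_mult)
    moreover have "\<bar>frechet_derivative f (at (x + t *\<^sub>R e)) e - frechet_derivative f (at x) e\<bar> < \<epsilon> / 2"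
    proof (rule \<delta>[OF e])
      show "norm (x + t *\<^sub>R e - x) < \<delta>"
        unfolding add_diff_cancel_left' using te[OF less_imp_le[OF t(1)]] t(2) \<open>s < \<delta>\<close> by linarith
    qed
    ultimately show ?thesis by linarith
  qed
  then show ?thesis
    using that by blast
qed

end

section \<open>Sobolev vector fields\<close>

lemma cutoff_integrable:
  fixes f :: "real^3 \<Rightarrow> real"
  assumes [measurable]: "f \<in> borel_measurable borel" and "integrable lborel (\<lambda>x. (f x)\<^sup>2)"
  shows "integrable lborel (\<lambda>y. indicator (ball 0 R) y *\<^sub>R (cis (- (y \<bullet> \<xi>)) * complex_of_real (f y)))"
proof -
  have [measurable]: "ball (0 :: real^3) R \<in> sets borel"
    by simp
  have "integrable lborel (\<lambda>y. (indicator (ball 0 R) y *\<^sub>R cis (- (y \<bullet> \<xi>))) * complex_of_real (f y))"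
  proof (rule integrable_mult_square_integrable)
    have "integrable lborel (indicator (ball 0 R) :: real^3 \<Rightarrow> real)"
      by (intro integrable_real_indicator) (use emeasure_lborel_ball_finite in auto)
    moreover have "(norm (indicator (ball 0 R) y *\<^sub>R cis (- (y \<bullet> \<xi>))))\<^sup>2 = indicator (ball 0 R) y" for y :: "real^3"
      by (simp add: indicator_def)
    ultimately show "integrable lborel (\<lambda>y :: real^3. (norm (indicator (ball 0 R) y *\<^sub>R cis (- (y \<bullet> \<xi>))))\<^sup>2)"
      by simp
  qed (use assms in auto)
  then show ?thesis
    by simp
qed

lemma norm_diff_square_le: "(norm (a - b))\<^sup>2 \<le> 2 * (norm a)\<^sup>2 + 2 * (norm b)\<^sup>2"
proof -
  have "(norm (a - b))\<^sup>2 \<le> (norm a + norm b)\<^sup>2"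
    by (intro power_mono norm_triangle_ineq4) auto
  also have "\<dots> \<le> 2 * (norm a)\<^sup>2 + 2 * (norm b)\<^sup>2"
    using zero_le_power2[of "norm a - norm b"] by (simp add: power2_sum power2_diff)
  finally show ?thesis .
qed

lemma integrable_norm_diff_square:
  fixes f g :: "'a \<Rightarrow> 'b::{second_countable_topology,banach}"
  assumes [measurable]: "f \<in> borel_measurable M" "g \<in> borel_measurable M" "w \<in> borel_measurable M"
    and "integrable M (\<lambda>x. w x * (norm (f x))\<^sup>2)" "integrable M (\<lambda>x. w x * (norm (g x))\<^sup>2)" and w: "\<And>x. 0 \<le> w x"
  shows "integrable M (\<lambda>x. w x * (norm (f x - g x))\<^sup>2)"
proof (rule Bochner_Integration.integrable_bound)
  show "integrable M (\<lambda>x. 2 * (w x * (norm (f x))\<^sup>2) + 2 * (w x * (norm (g x))\<^sup>2))"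
    using assms by simp
  have "w x * (norm (f x - g x))\<^sup>2 \<le> 2 * (w x * (norm (f x))\<^sup>2) + 2 * (w x * (norm (g x))\<^sup>2)" for x
    using mult_left_mono[OF norm_diff_square_le w, of x "f x" "g x"] by (simp add: algebra_simps)
  then show "AE x in M. norm (w x * (norm (f x - g x))\<^sup>2) \<le> norm (2 * (w x * (norm (f x))\<^sup>2) + 2 * (w x * (norm (g x))\<^sup>2))"
    using w by (intro AE_I2) (simp add: order_trans[OF _ abs_ge_self])
qed measurable

lemma is_L2_fourier_diff:
  assumes "is_L2_fourier f g" "is_L2_fourier f' g'"
  shows "is_L2_fourier (\<lambda>x. f x - f' x) (\<lambda>\<xi>. g \<xi> - g' \<xi>)"
proof -
  define F where "F f R \<xi> = (LINT x:ball 0 R|lborel. cis (- (x \<bullet> \<xi>)) * complex_of_real (f x))"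
    for f :: "real^3 \<Rightarrow> real" and R \<xi>
  have [measurable]: "f \<in> borel_measurable borel" "g \<in> borel_measurable borel" "f' \<in> borel_measurable borel" "g' \<in> borel_measurable borel"
    and f: "integrable lborel (\<lambda>x. (f x)\<^sup>2)" "integrable lborel (\<lambda>x. (f' x)\<^sup>2)"
    and g: "integrable lborel (\<lambda>\<xi>. (cmod (g \<xi>))\<^sup>2)" "integrable lborel (\<lambda>\<xi>. (cmod (g' \<xi>))\<^sup>2)"
    and lim: "((\<lambda>R. \<integral>\<^sup>+\<xi>. ennreal ((cmod (F f R \<xi> - g \<xi>))\<^sup>2) \<partial>lborel) \<longlongrightarrow> 0) at_top"
      "((\<lambda>R. \<integral>\<^sup>+\<xi>. ennreal ((cmod (F f' R \<xi> - g' \<xi>))\<^sup>2) \<partial>lborel) \<longlongrightarrow> 0) at_top"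
    using assms by (auto simp: is_L2_fourier_def F_def)
  have F_meas [measurable]: "F h R \<in> borel_measurable borel" if [measurable]: "h \<in> borel_measurable borel" for h R
  proof -
    have [measurable]: "ball (0 :: real^3) R \<in> sets borel"
      by simp
    show ?thesis
      unfolding F_def[abs_def] set_lebesgue_integral_def by measurable
  qed
  have F_diff: "F (\<lambda>x. f x - f' x) R \<xi> = F f R \<xi> - F f' R \<xi>" for R \<xi>
    unfolding F_def set_lebesgue_integral_def of_real_diff right_diff_distrib scaleR_diff_right
    by (intro Bochner_Integration.integral_diff cutoff_integrable f) measurable
  have le: "(\<integral>\<^sup>+\<xi>. ennreal ((cmod (F (\<lambda>x. f x - f' x) R \<xi> - (g \<xi> - g' \<xi>)))\<^sup>2) \<partial>lborel)
    \<le> 2 * (\<integral>\<^sup>+\<xi>. ennreal ((cmod (F f R \<xi> - g \<xi>))\<^sup>2) \<partial>lborel) + 2 * (\<integral>\<^sup>+\<xi>. ennreal ((cmod (F f' R \<xi> - g' \<xi>))\<^sup>2) \<partial>lborel)" for R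
  proof -
    have "(\<integral>\<^sup>+\<xi>. ennreal ((cmod (F (\<lambda>x. f x - f' x) R \<xi> - (g \<xi> - g' \<xi>)))\<^sup>2) \<partial>lborel)
      \<le> (\<integral>\<^sup>+\<xi>. 2 * ennreal ((cmod (F f R \<xi> - g \<xi>))\<^sup>2) + 2 * ennreal ((cmod (F f' R \<xi> - g' \<xi>))\<^sup>2) \<partial>lborel)"
    proof (rule nn_integral_mono)
      fix \<xi>
      have "(cmod (F (\<lambda>x. f x - f' x) R \<xi> - (g \<xi> - g' \<xi>)))\<^sup>2 \<le> 2 * (cmod (F f R \<xi> - g \<xi>))\<^sup>2 + 2 * (cmod (F f' R \<xi> - g' \<xi>))\<^sup>2"
        using norm_diff_square_le[of "F f R \<xi> - g \<xi>" "F f' R \<xi> - g' \<xi>"] by (simp add: F_diff algebra_simps)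
      then have "ennreal ((cmod (F (\<lambda>x. f x - f' x) R \<xi> - (g \<xi> - g' \<xi>)))\<^sup>2)
        \<le> ennreal (2 * (cmod (F f R \<xi> - g \<xi>))\<^sup>2 + 2 * (cmod (F f' R \<xi> - g' \<xi>))\<^sup>2)"
        by (rule ennreal_leI)
      then show "ennreal ((cmod (F (\<lambda>x. f x - f' x) R \<xi> - (g \<xi> - g' \<xi>)))\<^sup>2)
        \<le> 2 * ennreal ((cmod (F f R \<xi> - g \<xi>))\<^sup>2) + 2 * ennreal ((cmod (F f' R \<xi> - g' \<xi>))\<^sup>2)"
        by (simp add: ennreal_mult)
    qed
    also have "\<dots> = 2 * (\<integral>\<^sup>+\<xi>. ennreal ((cmod (F f R \<xi> - g \<xi>))\<^sup>2) \<partial>lborel) + 2 * (\<integral>\<^sup>+\<xi>. ennreal ((cmod (F f' R \<xi> - g' \<xi>))\<^sup>2) \<partial>lborel)"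
      by (simp add: nn_integral_add nn_integral_cmult)
    finally show ?thesis .
  qed
  have "((\<lambda>R. 2 * (\<integral>\<^sup>+\<xi>. ennreal ((cmod (F f R \<xi> - g \<xi>))\<^sup>2) \<partial>lborel) + 2 * (\<integral>\<^sup>+\<xi>. ennreal ((cmod (F f' R \<xi> - g' \<xi>))\<^sup>2) \<partial>lborel))
    \<longlongrightarrow> 2 * 0 + 2 * 0) at_top"
    by (intro tendsto_add ennreal_tendsto_cmult lim) auto
  then have lim0: "((\<lambda>R. 2 * (\<integral>\<^sup>+\<xi>. ennreal ((cmod (F f R \<xi> - g \<xi>))\<^sup>2) \<partial>lborel) + 2 * (\<integral>\<^sup>+\<xi>. ennreal ((cmod (F f' R \<xi> - g' \<xi>))\<^sup>2) \<partial>lborel))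
    \<longlongrightarrow> 0) at_top"
    by simp
  have "((\<lambda>R. \<integral>\<^sup>+\<xi>. ennreal ((cmod (F (\<lambda>x. f x - f' x) R \<xi> - (g \<xi> - g' \<xi>)))\<^sup>2) \<partial>lborel) \<longlongrightarrow> 0) at_top"
    by (intro tendsto_sandwich[OF _ _ tendsto_const lim0]) (simp_all add: le)
  moreover have "integrable lborel (\<lambda>x. (f x - f' x)\<^sup>2)"
    using integrable_norm_diff_square[of f lborel f' "\<lambda>_. 1"] f by simp
  moreover have "integrable lborel (\<lambda>x. (cmod (g x - g' x))\<^sup>2)"
    using integrable_norm_diff_square[of g lborel g' "\<lambda>_. 1"] g by simp
  ultimately show ?thesis
    by (simp add: is_L2_fourier_def F_def)
qed

text \<open>\<open>g - g'\<close> is a transform of \<open>f - f\<close>, whose cut-off integrals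
  all vanish. The distance that has to tend to 0 is then constant.\<close>

lemma is_L2_fourier_unique:
  assumes "is_L2_fourier f g" "is_L2_fourier f g'"
  shows "AE \<xi> in lborel. g \<xi> = g' \<xi>"
proof -
  have D: "is_L2_fourier (\<lambda>x. f x - f x) (\<lambda>\<xi>. g \<xi> - g' \<xi>)"
    by (rule is_L2_fourier_diff[OF assms])
  have [measurable]: "g \<in> borel_measurable borel" "g' \<in> borel_measurable borel"
    using assms by (auto simp: is_L2_fourier_def)
  have "((\<lambda>R::real. \<integral>\<^sup>+\<xi>. ennreal ((cmod (g \<xi> - g' \<xi>))\<^sup>2) \<partial>lborel) \<longlongrightarrow> 0) at_top"
    using D by (simp add: is_L2_fourier_def norm_minus_commute)
  then have "(\<integral>\<^sup>+\<xi>. ennreal ((cmod (g \<xi> - g' \<xi>))\<^sup>2) \<partial>lborel) = 0"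
    by (simp add: tendsto_const_iff)
  then have "AE \<xi> in lborel. ennreal ((cmod (g \<xi> - g' \<xi>))\<^sup>2) = 0"
    by (subst (asm) nn_integral_0_iff_AE) auto
  then show ?thesis
    by eventually_elim auto
qed

text \<open>\<open>L2_fourier\<close> chooses some transform, perhaps not the one that witnesses
  membership in \<open>Sobolev m\<close>. Uniqueness up to a null set carries the weighted
  integrability over.\<close>

lemma SobolevD:
  assumes "u \<in> Sobolev m"
  shows "is_L2_fourier (\<lambda>x. u x $ i) (L2_fourier (\<lambda>x. u x $ i))"
    and "integrable lborel (\<lambda>\<xi>. (1 + (norm \<xi>)\<^sup>2) powr m * (cmod (L2_fourier (\<lambda>x. u x $ i) \<xi>))\<^sup>2)"
proof -
  obtain g where g: "is_L2_fourier (\<lambda>x. u x $ i) g"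
    and int: "integrable lborel (\<lambda>\<xi>. (1 + (norm \<xi>)\<^sup>2) powr m * (cmod (g \<xi>))\<^sup>2)"
    using assms unfolding Sobolev_def by blast
  show *: "is_L2_fourier (\<lambda>x. u x $ i) (L2_fourier (\<lambda>x. u x $ i))"
    unfolding L2_fourier_def by (rule someI[where P = "is_L2_fourier (\<lambda>x. u x $ i)"]) (rule g)
  have [measurable]: "g \<in> borel_measurable borel" "L2_fourier (\<lambda>x. u x $ i) \<in> borel_measurable borel"
    using g * by (auto simp: is_L2_fourier_def)
  show "integrable lborel (\<lambda>\<xi>. (1 + (norm \<xi>)\<^sup>2) powr m * (cmod (L2_fourier (\<lambda>x. u x $ i) \<xi>))\<^sup>2)"
  proof (rule integrable_cong_AE_imp[OF int])
    show "AE \<xi> in lborel. (1 + (norm \<xi>)\<^sup>2) powr m * (cmod (g \<xi>))\<^sup>2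
      = (1 + (norm \<xi>)\<^sup>2) powr m * (cmod (L2_fourier (\<lambda>x. u x $ i) \<xi>))\<^sup>2"
      using is_L2_fourier_unique[OF * g] by eventually_elim simp
  qed measurable
qed

lemma Sobolev_diff:
  assumes "u \<in> Sobolev m" "w \<in> Sobolev m"
  shows "(\<lambda>x. u x - w x) \<in> Sobolev m"
  unfolding Sobolev_def
proof (intro CollectI allI)
  fix i
  note u = SobolevD[OF assms(1), of i] and w = SobolevD[OF assms(2), of i]
  have [measurable]: "L2_fourier (\<lambda>x. u x $ i) \<in> borel_measurable borel" "L2_fourier (\<lambda>x. w x $ i) \<in> borel_measurable borel"
    using u w by (auto simp: is_L2_fourier_def)
  have "is_L2_fourier (\<lambda>x. (u x - w x) $ i) (\<lambda>\<xi>. L2_fourier (\<lambda>x. u x $ i) \<xi> - L2_fourier (\<lambda>x. w x $ i) \<xi>)"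
    using is_L2_fourier_diff[OF u(1) w(1)] by simp
  moreover have "integrable lborel (\<lambda>\<xi>. (1 + (norm \<xi>)\<^sup>2) powr m * (cmod (L2_fourier (\<lambda>x. u x $ i) \<xi> - L2_fourier (\<lambda>x. w x $ i) \<xi>))\<^sup>2)"
    by (intro integrable_norm_diff_square u(2) w(2)) auto
  ultimately show "\<exists>g. is_L2_fourier (\<lambda>x. (u x - w x) $ i) g \<and> integrable lborel (\<lambda>\<xi>. (1 + (norm \<xi>)\<^sup>2) powr m * (cmod (g \<xi>))\<^sup>2)"
    by blast
qed

lemma component_le_Sobolev_norm:
  "sqrt (\<integral>\<xi>. (1 + (norm \<xi>)\<^sup>2) powr m * (cmod (L2_fourier (\<lambda>x. u x $ i) \<xi>))\<^sup>2 \<partial>lborel) \<le> Sobolev_norm m u"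
  unfolding Sobolev_norm_def
  by (intro real_sqrt_le_mono member_le_sum[of i UNIV]) auto

lemma Sobolev_norm_nonneg: "0 \<le> Sobolev_norm m u"
  unfolding Sobolev_norm_def by (intro real_sqrt_ge_zero sum_nonneg) auto

section \<open>Jacobians of Sobolev fields\<close>

abbreviation jac :: "(real^3 \<Rightarrow> real^3) \<Rightarrow> real^3 \<Rightarrow> real^3^3" where
  "jac u x \<equiv> jacobian u (at x)"

lemma jacobian_has_derivative:
  assumes "u differentiable (at x)"
  shows "(u has_derivative (*v) (jac u x)) (at x)"
  using assms by (simp add: jacobian_works)

lemma component_differentiable:
  fixes u :: "'a::real_normed_vector \<Rightarrow> real^'n"
  assumes "u differentiable (at x)"
  shows "(\<lambda>x. u x $ i) differentiable (at x)"
    and "frechet_derivative (\<lambda>x. u x $ i) (at x) e = frechet_derivative u (at x) e $ i"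
proof -
  have D: "((\<lambda>x. u x $ i) has_derivative (\<lambda>e. frechet_derivative u (at x) e $ i)) (at x)"
    using assms by (intro bounded_linear.has_derivative[OF bounded_linear_vec_nth]) (simp add: frechet_derivative_works)
  then show "(\<lambda>x. u x $ i) differentiable (at x)"
    by (rule differentiableI)
  show "frechet_derivative (\<lambda>x. u x $ i) (at x) e = frechet_derivative u (at x) e $ i"
    using frechet_derivative_at[OF D] by (metis)
qed

lemma jacobian_component: "jac u x $ i $ j = partial_deriv j u x $ i"
  by (simp add: jacobian_def matrix_def partial_deriv_def)

lemma jacobian_component':
  assumes "u differentiable (at x)"
  shows "jac u x $ i $ j = frechet_derivative (\<lambda>x. u x $ i) (at x) (axis j 1)"
  by (simp add: jacobian_component partial_deriv_def component_differentiable(2)[OF assms])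

lemma jacobian_diff:
  assumes "u differentiable (at x)" "w differentiable (at x)"
  shows "jac (\<lambda>x. u x - w x) x = jac u x - jac w x"
proof -
  have "frechet_derivative (\<lambda>x. u x - w x) (at x) = (\<lambda>e. frechet_derivative u (at x) e - frechet_derivative w (at x) e)"
    by (rule frechet_derivative_at[symmetric]) (use assms in \<open>auto intro!: derivative_intros simp: frechet_derivative_works\<close>)
  then show ?thesis
    by (simp add: jacobian_def matrix_def vec_eq_iff)
qed

lemma norm_vector_le_components:
  fixes x :: "'a::real_normed_vector^3"
  assumes "\<And>i. norm (x $ i) \<le> B"
  shows "norm x \<le> 3 * B"
proof -
  have "norm x \<le> (\<Sum>i\<in>UNIV. norm (x $ i))"
    unfolding norm_vec_def by (rule L2_set_le_sum) auto
  also have "\<dots> \<le> 3 * B"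
    using sum_bounded_above[of UNIV "\<lambda>i. norm (x $ i)" B] assms by simp
  finally show ?thesis .
qed

context
  fixes m :: real and u :: "real^3 \<Rightarrow> real^3"
  assumes m: "m > 5 / 2" and u: "u \<in> Sobolev m" and diff: "\<And>x. u differentiable (at x)"
begin

lemma Sobolev_component: "regular_L2_fourier (\<lambda>x. u x $ i) (L2_fourier (\<lambda>x. u x $ i))"
  by unfold_locales
     (use SobolevD[OF u, of i] m component_differentiable(1)[OF diff] in
       \<open>auto intro!: weighted_L2_imp_weighted_L1(1) simp: is_L2_fourier_def\<close>)

lemma Sobolev_component_bound:
  "regular_L2_fourier.M (L2_fourier (\<lambda>x. u x $ i)) \<le> bracket_weight m * Sobolev_norm m u"
proof -
  have "regular_L2_fourier.M (L2_fourier (\<lambda>x. u x $ i)) \<le>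
    bracket_weight m * sqrt (\<integral>\<xi>. (1 + (norm \<xi>)\<^sup>2) powr m * (cmod (L2_fourier (\<lambda>x. u x $ i) \<xi>))\<^sup>2 \<partial>lborel)"
    unfolding regular_L2_fourier.M_def[OF Sobolev_component]
    by (rule weighted_L2_imp_weighted_L1(2)) (use SobolevD[OF u, of i] m in \<open>auto simp: is_L2_fourier_def\<close>)
  also have "\<dots> \<le> bracket_weight m * Sobolev_norm m u"
    by (intro mult_left_mono component_le_Sobolev_norm) (simp add: bracket_weight_def)
  finally show ?thesis .
qed

lemma Sobolev_sup_bound: "norm (u x) \<le> 3 * (bracket_weight m * Sobolev_norm m u)"
proof (rule norm_vector_le_components)
  fix i
  show "norm (u x $ i) \<le> bracket_weight m * Sobolev_norm m u"
    using regular_L2_fourier.f_bound[OF Sobolev_component, of x i] Sobolev_component_bound[of i] by simp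
qed

text \<open>Meant also for differences \<open>v s - v t\<close>: continuity in the Sobolev norm
  becomes uniform convergence of the gradients on the whole space. The 9 is the factor 3 of
  \<open>norm_vector_le_components\<close>, once for rows and once for entries.\<close>

lemma jacobian_sup_bound: "norm (jac u x) \<le> 9 * (bracket_weight m * Sobolev_norm m u)"
proof -
  have "norm (jac u x) \<le> 3 * (3 * (bracket_weight m * Sobolev_norm m u))"
  proof (intro norm_vector_le_components)
    fix i j
    show "norm (jac u x $ i $ j) \<le> bracket_weight m * Sobolev_norm m u"
      using regular_L2_fourier.derivative_bound[OF Sobolev_component, of "axis j 1" i x] Sobolev_component_bound[of i]
      by (simp add: jacobian_component'[OF diff])
  qed
  then show ?thesis by simp
qed

lemma isCont_jacobian: "isCont (jac u) x"
proof -
  have "isCont (\<lambda>x. frechet_derivative (\<lambda>x. u x $ i) (at x) (axis j 1)) x" for i j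
    unfolding continuous_at_eps_delta dist_norm
  proof (intro allI impI)
    fix \<epsilon> :: real assume "0 < \<epsilon>"
    then obtain \<delta> where "0 < \<delta>" "\<And>x y e. norm e \<le> 1 \<Longrightarrow> norm (x - y) < \<delta> \<Longrightarrow>
        \<bar>frechet_derivative (\<lambda>x. u x $ i) (at x) e - frechet_derivative (\<lambda>x. u x $ i) (at y) e\<bar> < \<epsilon>"
      using regular_L2_fourier.derivative_modulus[OF Sobolev_component] by blast
    then show "\<exists>\<delta>>0. \<forall>y. norm (y - x) < \<delta> \<longrightarrow>
        norm (frechet_derivative (\<lambda>x. u x $ i) (at y) (axis j 1) - frechet_derivative (\<lambda>x. u x $ i) (at x) (axis j 1)) < \<epsilon>"
      by (auto intro!: exI[of _ \<delta>])
  qed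
  then show ?thesis
    unfolding isCont_def by (intro vec_tendstoI) (simp add: jacobian_component'[OF diff])
qed

lemma jacobian_decay:
  assumes "0 < \<epsilon>"
  obtains R where "\<And>x. R \<le> norm x \<Longrightarrow> norm (jac u x) \<le> \<epsilon>"
proof -
  have "\<exists>R. \<forall>x e. R \<le> norm x \<longrightarrow> norm e \<le> 1 \<longrightarrow> \<bar>frechet_derivative (\<lambda>x. u x $ i) (at x) e\<bar> \<le> \<epsilon> / 9" for i
    using regular_L2_fourier.derivative_decay[OF Sobolev_component, of "\<epsilon> / 9" i] assms
    by (metis divide_pos_pos zero_less_numeral)
  then obtain R where R: "\<And>i x e. R i \<le> norm x \<Longrightarrow> norm e \<le> 1 \<Longrightarrow> \<bar>frechet_derivative (\<lambda>x. u x $ i) (at x) e\<bar> \<le> \<epsilon> / 9"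
    by metis
  show ?thesis
  proof (rule that[of "Max (range R)"])
    fix x :: "real^3" assume x: "Max (range R) \<le> norm x"
    have "norm (jac u x) \<le> 3 * (3 * (\<epsilon> / 9))"
    proof (intro norm_vector_le_components)
      fix i j
      have "R i \<le> norm x"
        using x by (meson Max_ge finite_imageI finite order_trans rangeI)
      then show "norm (jac u x $ i $ j) \<le> \<epsilon> / 9"
        using R[of i x "axis j 1"] by (simp add: jacobian_component'[OF diff])
    qed
    then show "norm (jac u x) \<le> \<epsilon>" by simp
  qed
qed

end

lemma axial_jacobian: "axial (jac u x) = curl u x"
  by (simp add: axial_def curl_def jacobian_component)

lemma trace_jacobian: "trace (jac u x) = divergence u x"
  by (simp add: trace_def divergence_def jacobian_component)

lemma advection_eq_jacobian: "advection u w x = jac w x *v u x"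
  by (simp add: advection_def vec_eq_iff matrix_vector_mult_def jacobian_component mult.commute)

lemma has_derivative_grad:
  assumes "q differentiable (at x)"
  shows "(q has_derivative (\<lambda>y. grad q x \<bullet> y)) (at x)"
proof -
  have lin: "linear (frechet_derivative q (at x))"
    by (rule linear_frechet_derivative[OF assms])
  have "frechet_derivative q (at x) y = grad q x \<bullet> y" for y
  proof -
    have "frechet_derivative q (at x) y = frechet_derivative q (at x) (\<Sum>j\<in>UNIV. y $ j *\<^sub>R axis j 1)"
      by (simp add: basis_expansion[of y, unfolded scalar_mult_eq_scaleR])
    also have "\<dots> = grad q x \<bullet> y"
      by (simp add: linear_sum[OF lin] linear_scale[OF lin] inner_vec_def grad_def partial_deriv_def mult.commute)
    finally show ?thesis .
  qed
  then show ?thesis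
    using assms frechet_derivative_works[of q "at x"] by presburger
qed

section \<open>Uniformity in time\<close>

lemma continuous_on_product_uniform:
  fixes F :: "real \<Rightarrow> 'a::metric_space \<Rightarrow> 'b::real_normed_vector"
  assumes t: "\<And>t \<epsilon>. t \<in> I \<Longrightarrow> 0 < \<epsilon> \<Longrightarrow> \<exists>d>0. \<forall>s\<in>I. \<bar>s - t\<bar> < d \<longrightarrow> (\<forall>x. norm (F s x - F t x) \<le> \<epsilon>)"
    and x: "\<And>t x. t \<in> I \<Longrightarrow> isCont (F t) x"
  shows "continuous_on (I \<times> UNIV) (\<lambda>(t, x). F t x)"
  unfolding continuous_on_iff
proof (intro ballI allI impI)
  fix w and \<epsilon> :: real assume w: "w \<in> I \<times> (UNIV :: 'a set)" and "0 < \<epsilon>"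
  obtain t x where tx: "w = (t, x)" "t \<in> I"
    using w by blast
  obtain d where "0 < d" and d: "\<And>s x. s \<in> I \<Longrightarrow> \<bar>s - t\<bar> < d \<Longrightarrow> norm (F s x - F t x) \<le> \<epsilon> / 3"
    using t[OF tx(2), of "\<epsilon> / 3"] \<open>0 < \<epsilon>\<close> by auto
  have "0 < \<epsilon> / 3" using \<open>0 < \<epsilon>\<close> by simp
  then obtain d' where "0 < d'" and d': "\<And>y. dist y x < d' \<Longrightarrow> dist (F t y) (F t x) < \<epsilon> / 3"
    using x[OF tx(2), of x] unfolding continuous_at_eps_delta by blast
  show "\<exists>d>0. \<forall>z\<in>I \<times> UNIV. dist z w < d \<longrightarrow> dist (case z of (t, x) \<Rightarrow> F t x) (case w of (t, x) \<Rightarrow> F t x) < \<epsilon>"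
  proof (intro exI[of _ "min d d'"] conjI ballI impI)
    fix z assume z: "z \<in> I \<times> (UNIV :: 'a set)" "dist z w < min d d'"
    obtain s y where sy: "z = (s, y)" "s \<in> I"
      using z by blast
    have "\<bar>s - t\<bar> < d" "dist y x < d'"
      using z(2) dist_fst_le[of z w] dist_snd_le[of z w] by (auto simp: sy tx dist_real_def)
    then have "norm (F s y - F t y) \<le> \<epsilon> / 3" "dist (F t y) (F t x) < \<epsilon> / 3"
      using d d' sy by auto
    then have "dist (F s y) (F t x) < \<epsilon>"
      using dist_triangle[of "F s y" "F t x" "F t y"] \<open>0 < \<epsilon>\<close> unfolding dist_norm[of "F s y" "F t y"] by linarith
    then show "dist (case z of (t, x) \<Rightarrow> F t x) (case w of (t, x) \<Rightarrow> F t x) < \<epsilon>"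
      by (simp add: sy tx)
  qed (use \<open>0 < d\<close> \<open>0 < d'\<close> in auto)
qed

text \<open>Local thresholds are joined by a finite subcover, and monotonicity lets their maximum
  serve everywhere. It yields both the velocity bounds and the decay radius.\<close>

lemma compact_uniform_threshold:
  fixes P :: "real \<Rightarrow> real \<Rightarrow> bool"
  assumes "compact I" and mono: "\<And>t R R'. P t R \<Longrightarrow> R \<le> R' \<Longrightarrow> P t R'"
    and loc: "\<And>t. t \<in> I \<Longrightarrow> \<exists>d>0. \<exists>R. \<forall>s\<in>I. \<bar>s - t\<bar> < d \<longrightarrow> P s R"
  obtains R where "\<And>t. t \<in> I \<Longrightarrow> P t R"
proof -
  obtain d R where d: "\<And>t. t \<in> I \<Longrightarrow> 0 < d t" and P: "\<And>t s. t \<in> I \<Longrightarrow> s \<in> I \<Longrightarrow> \<bar>s - t\<bar> < d t \<Longrightarrow> P s (R t)"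
    using loc by metis
  have "I \<subseteq> (\<Union>t\<in>I. ball t (d t))"
    using d by force
  then obtain C where C: "C \<subseteq> I" "finite C" "I \<subseteq> (\<Union>t\<in>C. ball t (d t))"
    using compactE_image[OF \<open>compact I\<close>, of I "\<lambda>t. ball t (d t)"] by auto
  show ?thesis
  proof (rule that)
    fix s assume "s \<in> I"
    then obtain t where t: "t \<in> C" "\<bar>s - t\<bar> < d t"
      using C(3) by (auto simp: dist_real_def abs_minus_commute)
    then have "P s (R t)"
      using P C(1) \<open>s \<in> I\<close> by auto
    then show "P s (Max (R ` C))"
      by (rule mono) (use t C in auto)
  qed
qed

locale Sobolev_flow =
  fixes m :: real and I :: "real set" and v :: "real \<Rightarrow> real^3 \<Rightarrow> real^3"
  assumes m: "m > 5 / 2"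
    and Sob: "\<And>t. t \<in> I \<Longrightarrow> v t \<in> Sobolev m"
    and Sob_cont: "\<And>t. t \<in> I \<Longrightarrow> ((\<lambda>s. Sobolev_norm m (\<lambda>x. v s x - v t x)) \<longlongrightarrow> 0) (at t within I)"
    and diff: "\<And>t x. t \<in> I \<Longrightarrow> v t differentiable (at x)"
begin

lemma uniformly_continuous_in_time:
  assumes "t \<in> I" "0 < \<epsilon>"
  obtains d where "0 < d"
    "\<And>s x. s \<in> I \<Longrightarrow> \<bar>s - t\<bar> < d \<Longrightarrow> norm (v s x - v t x) \<le> \<epsilon> \<and> norm (jac (v s) x - jac (v t) x) \<le> \<epsilon>"
proof -
  have "((\<lambda>s. 9 * (bracket_weight m * Sobolev_norm m (\<lambda>x. v s x - v t x))) \<longlongrightarrow> 9 * (bracket_weight m * 0)) (at t within I)"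
    by (intro tendsto_intros Sob_cont assms)
  then have "\<forall>\<^sub>F s in at t within I. 9 * (bracket_weight m * Sobolev_norm m (\<lambda>x. v s x - v t x)) < \<epsilon>"
    by (rule order_tendstoD) (use assms in simp)
  then obtain d where "0 < d" and
    d: "\<And>s. s \<in> I \<Longrightarrow> s \<noteq> t \<Longrightarrow> \<bar>s - t\<bar> < d \<Longrightarrow> 9 * (bracket_weight m * Sobolev_norm m (\<lambda>x. v s x - v t x)) < \<epsilon>"
    unfolding eventually_at by (auto simp: dist_real_def)
  show ?thesis
  proof (rule that[OF \<open>0 < d\<close>])
    fix s x assume s: "s \<in> I" "\<bar>s - t\<bar> < d"
    show "norm (v s x - v t x) \<le> \<epsilon> \<and> norm (jac (v s) x - jac (v t) x) \<le> \<epsilon>"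
    \<comment> \<open>\<open>Sob_cont\<close> is a limit over punctured neighbourhoods, so
      \<open>s = t\<close> is treated apart.\<close>
    proof (cases "s = t")
      case True
      then show ?thesis using assms by simp
    next
      case False
      define u where "u x = v s x - v t x" for x
      have u: "u \<in> Sobolev m" and du: "\<And>x. u differentiable (at x)"
        unfolding u_def[abs_def] using Sobolev_diff[OF Sob[OF s(1)] Sob[OF assms(1)]] diff s assms by auto
      have small: "9 * (bracket_weight m * Sobolev_norm m u) < \<epsilon>"
        using d[OF s(1) False s(2)] by (simp add: u_def[abs_def])
      have "0 \<le> bracket_weight m * Sobolev_norm m u"
        by (intro mult_nonneg_nonneg Sobolev_norm_nonneg) (simp add: bracket_weight_def)
      then have "norm (u x) \<le> \<epsilon>" "norm (jac u x) \<le> \<epsilon>"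
        using Sobolev_sup_bound[OF m u du, of x] jacobian_sup_bound[OF m u du, of x] small by linarith+
      then show ?thesis
        using jacobian_diff[OF diff[OF s(1)] diff[OF assms(1)], of x] by (simp add: u_def[abs_def])
    qed
  qed
qed

lemma continuous_v: "continuous_on (I \<times> UNIV) (\<lambda>(t, x). v t x)"
proof (rule continuous_on_product_uniform)
  fix t \<epsilon> :: real assume t: "t \<in> I" "0 < \<epsilon>"
  then show "\<exists>d>0. \<forall>s\<in>I. \<bar>s - t\<bar> < d \<longrightarrow> (\<forall>x. norm (v s x - v t x) \<le> \<epsilon>)"
    by (rule uniformly_continuous_in_time) blast
qed (rule differentiable_imp_continuous_within[OF diff])

lemma continuous_jacobian: "continuous_on (I \<times> UNIV) (\<lambda>(t, x). jac (v t) x)"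
proof (rule continuous_on_product_uniform)
  fix t \<epsilon> :: real assume t: "t \<in> I" "0 < \<epsilon>"
  then show "\<exists>d>0. \<forall>s\<in>I. \<bar>s - t\<bar> < d \<longrightarrow> (\<forall>x. norm (jac (v s) x - jac (v t) x) \<le> \<epsilon>)"
    by (rule uniformly_continuous_in_time) blast
qed (rule isCont_jacobian[OF m Sob diff])

lemma velocity_bounds:
  assumes "C \<subseteq> I" "compact C"
  obtains K where "\<And>t x. t \<in> C \<Longrightarrow> norm (v t x) \<le> K" "\<And>t x. t \<in> C \<Longrightarrow> norm (jac (v t) x) \<le> K"
proof -
  have "\<exists>d>0. \<exists>R. \<forall>s\<in>C. \<bar>s - t\<bar> < d \<longrightarrow> (\<forall>x. norm (v s x) \<le> R \<and> norm (jac (v s) x) \<le> R)" if "t \<in> C" for t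
  proof -
    have t: "t \<in> I" using that assms by auto
    obtain d where d: "0 < d" "\<And>s x. s \<in> I \<Longrightarrow> \<bar>s - t\<bar> < d \<Longrightarrow> norm (v s x - v t x) \<le> 1 \<and> norm (jac (v s) x - jac (v t) x) \<le> 1"
      using uniformly_continuous_in_time[OF t zero_less_one] by blast
    define B where "B = bracket_weight m * Sobolev_norm m (v t)"
    have "0 \<le> B" unfolding B_def
      by (intro mult_nonneg_nonneg Sobolev_norm_nonneg) (simp add: bracket_weight_def)
    have "norm (v s x) \<le> 9 * B + 1 \<and> norm (jac (v s) x) \<le> 9 * B + 1" if "s \<in> C" "\<bar>s - t\<bar> < d" for s x
    proof -
      have "norm (v s x - v t x) \<le> 1 \<and> norm (jac (v s) x - jac (v t) x) \<le> 1"
        using d that assms by auto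
      then show ?thesis
        using Sobolev_sup_bound[OF m Sob[OF t] diff[OF t], of x] jacobian_sup_bound[OF m Sob[OF t] diff[OF t], of x]
          norm_triangle_sub[of "v s x" "v t x"] norm_triangle_sub[of "jac (v s) x" "jac (v t) x"] \<open>0 \<le> B\<close>
        unfolding B_def[symmetric] by linarith
    qed
    then show ?thesis
      using d(1) by blast
  qed
  then obtain K where "\<And>t. t \<in> C \<Longrightarrow> \<forall>x. norm (v t x) \<le> K \<and> norm (jac (v t) x) \<le> K"
    by (rule compact_uniform_threshold[OF \<open>compact C\<close>, rotated]) (meson order_trans)+
  then show ?thesis
    using that by blast
qed

text \<open>Decay at a single time passes to nearby times because the gradient changes little in
  time, uniformly in space; compactness then provides one radius for all times.\<close>

lemma jacobian_uniform_decay: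
  assumes "C \<subseteq> I" "compact C" "0 < \<epsilon>"
  obtains R where "\<And>t x. t \<in> C \<Longrightarrow> R \<le> norm x \<Longrightarrow> norm (jac (v t) x) \<le> \<epsilon>"
proof -
  have "\<exists>d>0. \<exists>R. \<forall>s\<in>C. \<bar>s - t\<bar> < d \<longrightarrow> (\<forall>x. R \<le> norm x \<longrightarrow> norm (jac (v s) x) \<le> \<epsilon>)" if "t \<in> C" for t
  proof -
    have t: "t \<in> I" using that assms by auto
    have "0 < \<epsilon> / 2" using assms by simp
    then obtain d where d: "0 < d" "\<And>s x. s \<in> I \<Longrightarrow> \<bar>s - t\<bar> < d \<Longrightarrow> norm (v s x - v t x) \<le> \<epsilon> / 2 \<and> norm (jac (v s) x - jac (v t) x) \<le> \<epsilon> / 2"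
      using uniformly_continuous_in_time[OF t] by blast
    obtain R where R: "\<And>x. R \<le> norm x \<Longrightarrow> norm (jac (v t) x) \<le> \<epsilon> / 2"
      using jacobian_decay[OF m Sob[OF t] diff[OF t] \<open>0 < \<epsilon> / 2\<close>] by blast
    have "norm (jac (v s) x) \<le> \<epsilon>" if "s \<in> C" "\<bar>s - t\<bar> < d" "R \<le> norm x" for s x
    proof -
      have "norm (jac (v s) x - jac (v t) x) \<le> \<epsilon> / 2"
        using d that assms by auto
      then show ?thesis
        using R[OF that(3)] norm_triangle_sub[of "jac (v s) x" "jac (v t) x"] by linarith
    qed
    then show ?thesis
      using d(1) by blast
  qed
  then obtain R where "\<And>t. t \<in> C \<Longrightarrow> \<forall>x. R \<le> norm x \<longrightarrow> norm (jac (v t) x) \<le> \<epsilon>"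
    by (rule compact_uniform_threshold[OF \<open>compact C\<close>, rotated]) (meson order_trans)+
  then show ?thesis
    using that by blast
qed

end

section \<open>The vorticity estimate\<close>

text \<open>The chain rule in space and time, where joint differentiability comes from the spatial
  derivative at one point and a jointly continuous time derivative. Pairs are ordered
  \<open>(x, s)\<close> since \<open>has_derivative_partialsI\<close> asks for continuity of the
  second partial derivative. Working within \<open>{0..\<tau>}\<close> covers the one-sided
  derivatives at its ends.\<close>

lemma material_derivative:
  fixes v v' :: "real \<Rightarrow> real^3 \<Rightarrow> real^3" and Y :: "real \<Rightarrow> real^3"
  assumes t: "t \<in> {0..\<tau>}"
    and time: "\<And>s x. s \<in> {0..\<tau>} \<Longrightarrow> ((\<lambda>s. v s x) has_vector_derivative v' s x) (at s within {0..\<tau>})"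
    and cont: "continuous_on ({0..\<tau>} \<times> UNIV) (\<lambda>(s, x). v' s x)"
    and space: "v t differentiable (at (Y t))"
    and Y: "(Y has_vector_derivative v t (Y t)) (at t within {0..\<tau>})"
  shows "((\<lambda>s. v s (Y s)) has_vector_derivative v' t (Y t) + advection (v t) (v t) (Y t)) (at t within {0..\<tau>})"
proof -
  have "((\<lambda>(x, s). v s x) has_derivative
      (\<lambda>(tx, ts). jac (v t) (Y t) *v tx + blinfun_apply (blinfun_scaleR_left (v' t (Y t))) ts)) (at (Y t, t) within UNIV \<times> {0..\<tau>})"
  proof (rule has_derivative_partialsI)
    show "((\<lambda>x. v t x) has_derivative (*v) (jac (v t) (Y t))) (at (Y t) within UNIV)"
      using jacobian_has_derivative[OF space] by simp
    show "((\<lambda>s. v s x) has_derivative blinfun_apply (blinfun_scaleR_left (v' s x))) (at s within {0..\<tau>})" if "s \<in> {0..\<tau>}" for x s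
      using time[OF that, of x] by (simp add: has_vector_derivative_def)
    have "continuous_on (UNIV \<times> {0..\<tau>}) (\<lambda>z. (\<lambda>(s, x). v' s x) (prod.swap z))"
      by (rule continuous_on_compose2[OF cont]) (auto simp: prod.swap_def intro!: continuous_intros)
    then have "continuous_on (UNIV \<times> {0..\<tau>}) (\<lambda>z. blinfun_scaleR_left ((\<lambda>(s, x). v' s x) (prod.swap z)))"
      by (rule bounded_linear.continuous_on[OF bounded_linear_blinfun_scaleR_left])
    then show "continuous (at (Y t, t) within UNIV \<times> {0..\<tau>}) (\<lambda>(x, s). blinfun_scaleR_left (v' s x))"
      using t by (simp add: continuous_on_eq_continuous_within prod.swap_def case_prod_unfold)
  qed (use t in auto)
  then have "((\<lambda>(x, s). v s x) has_derivative (\<lambda>(tx, ts). jac (v t) (Y t) *v tx + ts *\<^sub>R v' t (Y t)))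
      (at (Y t, t) within UNIV \<times> {0..\<tau>})"
    by simp
  then have joint: "((\<lambda>(x, s). v s x) has_derivative (\<lambda>(tx, ts). jac (v t) (Y t) *v tx + ts *\<^sub>R v' t (Y t)))
      (at (Y t, t) within (\<lambda>s. (Y s, s)) ` {0..\<tau>})"
    by (rule has_derivative_subset) auto
  have "((\<lambda>s. (Y s, s)) has_derivative (\<lambda>h. (h *\<^sub>R v t (Y t), h))) (at t within {0..\<tau>})"
    using Y by (auto intro!: derivative_intros simp: has_vector_derivative_def)
  from has_derivative_in_compose[OF this joint]
  show ?thesis
    by (simp add: has_vector_derivative_def advection_eq_jacobian matrix_vector_mult_scaleR scaleR_add_right add.commute)
qed

theorem theorem1p3:
  fixes m :: real
    and T :: ereal
    and v0 :: "real^3 \<Rightarrow> real^3"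
    and v X :: "real \<Rightarrow> real^3 \<Rightarrow> real^3"
    and p :: "real \<Rightarrow> real^3 \<Rightarrow> real"
  assumes "m > 5 / 2"
    and "v0 \<in> Sobolev m"
    and "\<And>x. divergence v0 x = 0"
    and "euler_solution m v0 T v p"
    and "T = euler_lifespan m v0"
    and "particle_trajectories T v X"
  shows "\<forall>\<epsilon>>0. \<forall>t0. 0 < t0 \<and> ereal t0 < T \<longrightarrow>
           (\<exists>R0>0. \<forall>a t. a \<in> UNIV - ball 0 R0 \<and> t \<in> {0..t0} \<longrightarrow>
              norm (curl (v t) (X t a)) \<le> exp (\<epsilon> * t) * norm (curl v0 a))"
proof (intro allI impI)
  fix \<epsilon> t0 :: real assume "0 < \<epsilon>" and t0: "0 < t0 \<and> ereal t0 < T"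
  define I where "I = time_interval T"
  have Icc: "{0..t0} \<subseteq> I"
    using t0 by (auto simp: I_def time_interval_def intro: order.strict_trans1[of "ereal _" "ereal t0"])
  obtain v' where v'_cont: "continuous_on (I \<times> UNIV) (\<lambda>(t, x). v' t x)"
    and v'_deriv: "\<And>t x. t \<in> I \<Longrightarrow> ((\<lambda>s. v s x) has_vector_derivative v' t x) (at t within I)"
    and euler: "\<And>t x. t \<in> I \<Longrightarrow> v' t x + advection (v t) (v t) x = - grad (p t) x"
    and v_diff: "\<And>t x. t \<in> I \<Longrightarrow> v t differentiable (at x)" and p_diff: "\<And>t x. t \<in> I \<Longrightarrow> p t differentiable (at x)"
    and div: "\<And>t x. t \<in> I \<Longrightarrow> divergence (v t) x = 0"
    and Sob: "continuous_in_Sobolev m T v"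
    and v_0: "v 0 = v0"
    using assms(4) unfolding euler_solution_def I_def[symmetric] by (auto simp: fun_eq_iff)
  interpret Sobolev_flow m I v
    by unfold_locales (use assms(1) Sob v_diff in \<open>auto simp: continuous_in_Sobolev_def I_def\<close>)
  have X_0: "X 0 b = b" for b
    using assms(6) by (simp add: particle_trajectories_def)
  have X_deriv: "((\<lambda>s. X s b) has_vector_derivative v t (X t b)) (at t within I)" if "t \<in> I" for t b
    using assms(6) that by (simp add: particle_trajectories_def I_def)
  obtain K where K: "\<And>t x. t \<in> {0..t0} \<Longrightarrow> norm (v t x) \<le> K" "\<And>t x. t \<in> {0..t0} \<Longrightarrow> norm (jac (v t) x) \<le> K"
    using velocity_bounds[OF Icc compact_Icc] by blast
  have "0 \<le> K"
    using K(1)[of 0 0] t0 by (auto intro: order_trans[OF norm_ge_zero])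
  obtain R where R: "\<And>t x. t \<in> {0..t0} \<Longrightarrow> R \<le> norm x \<Longrightarrow> norm (jac (v t) x) \<le> \<epsilon>"
    using jacobian_uniform_decay[OF Icc compact_Icc \<open>0 < \<epsilon>\<close>] by blast
  have displacement: "norm (X t b - b) \<le> K * t0" if "t \<in> {0..t0}" for t b
  proof -
    have "norm (X t b - X 0 b) \<le> K * norm (t - 0)"
    proof (rule differentiable_bound)
      fix s assume s: "s \<in> {0..t0}"
      show "((\<lambda>s. X s b) has_derivative (\<lambda>h. h *\<^sub>R v s (X s b))) (at s within {0..t0})"
        using has_vector_derivative_within_subset[OF X_deriv Icc] s Icc by (auto simp: has_vector_derivative_def)
      show "onorm (\<lambda>h. h *\<^sub>R v s (X s b)) \<le> K"
      proof (rule onorm_le)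
        fix h
        show "norm (h *\<^sub>R v s (X s b)) \<le> K * norm h"
          using mult_left_mono[OF K(1)[OF s, of "X s b"] abs_ge_zero[of h]] by (simp add: mult.commute)
      qed
    qed (use that t0 in auto)
    also have "\<dots> \<le> K * t0"
      using that \<open>0 \<le> K\<close> by (auto intro: mult_left_mono)
    finally show ?thesis by (simp add: X_0)
  qed
  \<comment> \<open>\<open>K * t0\<close> bounds the displacement, so the whole trajectory stays
    outside radius \<open>R\<close>; the 1 provides \<open>0 < R0\<close>.\<close>
  define R0 where "R0 = max 1 (R + K * t0)"
  have bound: "norm (curl (v t) (X t a)) \<le> exp (\<epsilon> * t) * norm (curl v0 a)" if a: "R0 \<le> norm a" and t: "t \<in> {0..t0}" for a t
  \<comment> \<open>The locale \<open>euler_flow\<close> requires a positive final time.\<close>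
  proof (cases "t = 0")
    case True
    then show ?thesis by (simp add: X_0 v_0)
  next
    case False
    with t have "0 < t" by simp
    have sub: "{0..t} \<subseteq> {0..t0}" "{0..t} \<subseteq> I"
      using t Icc by auto
    \<comment> \<open>The acceleration of particles, equal to \<open>- grad (p t) x\<close> by the
      Euler equations. The locale is then interpreted on \<open>{0..t}\<close> rather than
      \<open>{0..t0}\<close>, which gives the exponent \<open>\<epsilon> * t\<close>.\<close>
    define q where "q t x = v' t x + advection (v t) (v t) x" for t x
    interpret euler_flow t v X q p "\<lambda>t. jac (v t)" K
    proof unfold_locales
      fix s x assume s: "s \<in> {0..t}"
      then have sI: "s \<in> I" and s0: "s \<in> {0..t0}" using sub by auto
      show "(v s has_derivative (*v) (jac (v s) x)) (at x)"
        by (rule jacobian_has_derivative[OF v_diff[OF sI]])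
      show "norm (jac (v s) x) \<le> K"
        by (rule K(2)[OF s0])
      show "trace (jac (v s) x) = 0"
        by (simp add: trace_jacobian div[OF sI])
      show X': "((\<lambda>s. X s x) has_vector_derivative v s (X s x)) (at s within {0..t})"
        by (rule has_vector_derivative_within_subset[OF X_deriv[OF sI] sub(2)])
      show "((\<lambda>s. v s (X s x)) has_vector_derivative q s (X s x)) (at s within {0..t})"
        unfolding q_def
      proof (rule material_derivative[where v = v and v' = v' and Y = "\<lambda>s. X s x"])
        show "s \<in> {0..t}" "v s differentiable (at (X s x))"
          "((\<lambda>s. X s x) has_vector_derivative v s (X s x)) (at s within {0..t})"
          by (fact s v_diff[OF sI] X')+
        show "continuous_on ({0..t} \<times> UNIV) (\<lambda>(s, x). v' s x)"
          by (rule continuous_on_subset[OF v'_cont]) (use sub in auto)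
        fix r x assume "r \<in> {0..t}"
        then show "((\<lambda>s. v s x) has_vector_derivative v' r x) (at r within {0..t})"
          using has_vector_derivative_within_subset[OF v'_deriv sub(2)] sub(2) by auto
      qed
      show "(p s has_derivative (\<lambda>y. - (q s x \<bullet> y))) (at x)"
        using has_derivative_grad[OF p_diff[OF sI]] euler[OF sI, of x] by (simp add: q_def)
    next
      have "continuous_on (I \<times> UNIV) (\<lambda>(t, x). q t x)"
      proof -
        have "continuous_on (I \<times> UNIV) (\<lambda>z. (case z of (t, x) \<Rightarrow> v' t x) +
            (case z of (t, x) \<Rightarrow> jac (v t) x) *v (case z of (t, x) \<Rightarrow> v t x))"
          unfolding matrix_vector_mult_def
          by (intro continuous_intros v'_cont continuous_v continuous_jacobian)
        then show ?thesis
          by (simp add: q_def advection_eq_jacobian case_prod_unfold)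
      qed
      then show "continuous_on ({0..t} \<times> UNIV) (\<lambda>(t, x). q t x)"
        by (rule continuous_on_subset) (use sub in auto)
      show "continuous_on ({0..t} \<times> UNIV) (\<lambda>(t, x). jac (v t) x)"
        by (rule continuous_on_subset[OF continuous_jacobian]) (use sub in auto)
    qed (use \<open>0 < t\<close> X_0 in auto)
    have "norm (axial (jac (v t) (X t a))) \<le> exp (\<epsilon> * t) * norm (axial (jac (v 0) a))"
    proof (rule axial_transport_bound)
      fix s assume "s \<in> {0..t}"
      then have s: "s \<in> {0..t0}" using sub by auto
      have "R \<le> norm (X s a)"
        using a displacement[OF s, of a] norm_triangle_sub[of a "X s a"] by (simp add: R0_def norm_minus_commute)
      then show "norm (jac (v s) (X s a)) \<le> \<epsilon>"
        by (rule R[OF s])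
    qed
    then show ?thesis
      by (simp add: axial_jacobian v_0)
  qed
  show "\<exists>R0>0. \<forall>a t. a \<in> UNIV - ball 0 R0 \<and> t \<in> {0..t0} \<longrightarrow>
      norm (curl (v t) (X t a)) \<le> exp (\<epsilon> * t) * norm (curl v0 a)"
    by (intro exI[of _ R0]) (use bound in \<open>auto simp: R0_def not_less\<close>)
qed

end
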